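(* Let $d=2$ and let $\alpha:\mathbb R^2\to U(m)$ be a (smooth) family of matching matrices. Then $\alpha$ admits a continuous and $\mathbb Z^2$-periodic multi-step logarithm (not necessarily satisfying the time-reversal relation), i.e. there are continuous, $\mathbb Z^2$-periodic self-adjoint-matrix-valued maps $h_1,h_2$ with $\alpha(\mathbf k)=e^{ih_2(\mathbf k)/2}e^{ih_1(\mathbf k)}e^{ih_2(\mathbf k)/2}$ for all $\mathbf k$. If moreover $\alpha$ is equivariantly null-homotopic, then $h_1,h_2$ can be chosen to satisfy in addition $\varepsilon\,h_\ell(\mathbf k)=h_\ell(-\mathbf k)^t\,\varepsilon$ for $\ell=1,2$ and all $\mathbf k$, so that $\alpha$ admits a multi-step logarithm.
   Context: $\varepsilon$ is the $m\times m$ identity $\mathbf 1$ or, for $m$ even, $J=\begin{pmatrix}0&\mathbf 1\\-\mathbf 1&0\end{pmatrix}$. A family of matching matrices is a continuous, $\mathbb Z^2$-periodic $\alpha:\mathbb R^2\to U(m)$ with $\varepsilon\alpha(\mathbf k)=\alpha(-\mathbf k)^t\varepsilon$. It is equivariantly null-homotopic if there is a map $(t,\mathbf k)\mapsto\alpha_t(\mathbf k)$, continuous in $t\in[0,1]$, each $\alpha_t$ a family of matching matrices, $\alpha_0=\alpha$, $\alpha_1\equiv\mathbf 1$. A multi-step logarithm is a finite collection $h_1,\dots,h_M$ of continuous, $\mathbb Z^2$-periodic maps into self-adjoint $m\times m$ matrices with $\varepsilon h_\ell(\mathbf k)=h_\ell(-\mathbf k)^t\varepsilon$ and $\alpha=e^{ih_M/2}\cdots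 e^{ih_2/2}e^{ih_1}e^{ih_2/2}\cdots e^{ih_M/2}$. *)

theory Defs
  imports "HOL-Analysis.Analysis"
begin

type_synonym 'n cmat = "complex ^ 'n ^ 'n"

definition cscale :: "complex \<Rightarrow> 'n::finite cmat \<Rightarrow> 'n cmat" where
  "cscale c A = (\<chi> i j. c * A $ i $ j)"

definition cadj :: "'n::finite cmat \<Rightarrow> 'n cmat" where
  "cadj A = (\<chi> i j. cnj (A $ j $ i))"

primrec mpow :: "'n::finite cmat \<Rightarrow> nat \<Rightarrow> 'n cmat" where
  "mpow A 0 = mat 1"
| "mpow A (Suc k) = A ** mpow A k"

definition mexp :: "'n::finite cmat \<Rightarrow> 'n cmat" where
  "mexp A = (\<Sum>k. (1 / fact k) *\<^sub>R mpow A k)"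

definition unitary :: "'n::finite cmat \<Rightarrow> bool" where
  "unitary U \<longleftrightarrow> U ** cadj U = mat 1 \<and> cadj U ** U = mat 1"

definition selfadj :: "'n::finite cmat \<Rightarrow> bool" where
  "selfadj A \<longleftrightarrow> cadj A = A"

text \<open>The symplectic matrix J = [[0, 1],[-1, 0]] (blocks of size m/2), with respect to an
  enumeration b of the index type by 0..m-1.\<close>
definition Jmat :: "('n::finite \<Rightarrow> nat) \<Rightarrow> 'n cmat" where
  "Jmat b = (\<chi> i j. if b j = b i + CARD('n) div 2 then 1
                     else if b i = b j + CARD('n) div 2 then -1 else 0)"

definition admissible_eps :: "'n::finite cmat \<Rightarrow> bool" where
  "admissible_eps \<epsilon> \<longleftrightarrow> \<epsilon> = mat 1 \<or>
     (even CARD('n) \<and> (\<exists>b. bij_betw b (UNIV::'n set) {..<CARD('n)} \<and> \<epsilon> = Jmat b))"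

definition periodic2 :: "(real^2 \<Rightarrow> 'b) \<Rightarrow> bool" where
  "periodic2 f \<longleftrightarrow> (\<forall>k z. (\<forall>i. z $ i \<in> \<int>) \<longrightarrow> f (k + z) = f k)"

definition matching_rel :: "'n::finite cmat \<Rightarrow> (real^2 \<Rightarrow> 'n cmat) \<Rightarrow> bool" where
  "matching_rel \<epsilon> f \<longleftrightarrow> (\<forall>k. \<epsilon> ** f k = transpose (f (-k)) ** \<epsilon>)"

definition matching_family :: "'n::finite cmat \<Rightarrow> (real^2 \<Rightarrow> 'n cmat) \<Rightarrow> bool" where
  "matching_family \<epsilon> \<alpha> \<longleftrightarrow> continuous_on UNIV \<alpha> \<and> periodic2 \<alpha> \<and>
     (\<forall>k. unitary (\<alpha> k)) \<and> matching_rel \<epsilon> \<alpha>"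

definition equiv_null_homotopic :: "'n::finite cmat \<Rightarrow> (real^2 \<Rightarrow> 'n cmat) \<Rightarrow> bool" where
  "equiv_null_homotopic \<epsilon> \<alpha> \<longleftrightarrow> (\<exists>H :: real \<Rightarrow> real^2 \<Rightarrow> 'n cmat.
     continuous_on ({0..1} \<times> UNIV) (\<lambda>(t, k). H t k) \<and>
     (\<forall>t\<in>{0..1}. matching_family \<epsilon> (H t)) \<and>
     H 0 = \<alpha> \<and> H 1 = (\<lambda>k. mat 1))"

fun iter_dd :: "(real^2) list \<Rightarrow> (real^2 \<Rightarrow> 'b::real_normed_vector) \<Rightarrow> real^2 \<Rightarrow> 'b" where
  "iter_dd [] f = f"
| "iter_dd (v # vs) f = (\<lambda>x. vector_derivative (\<lambda>t. iter_dd vs f (x + t *\<^sub>R v)) (at 0))"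

definition smooth2 :: "(real^2 \<Rightarrow> 'b::real_normed_vector) \<Rightarrow> bool" where
  "smooth2 f \<longleftrightarrow> (\<forall>vs. continuous_on UNIV (iter_dd vs f) \<and>
     (\<forall>v x. ((\<lambda>t. iter_dd vs f (x + t *\<^sub>R v)) has_vector_derivative iter_dd (v # vs) f x) (at 0)))"

definition two_step_log :: "(real^2 \<Rightarrow> 'n::finite cmat) \<Rightarrow> (real^2 \<Rightarrow> 'n cmat) \<Rightarrow> (real^2 \<Rightarrow> 'n cmat) \<Rightarrow> bool" where
  "two_step_log \<alpha> h1 h2 \<longleftrightarrow>
     continuous_on UNIV h1 \<and> continuous_on UNIV h2 \<and> periodic2 h1 \<and> periodic2 h2 \<and>
     (\<forall>k. selfadj (h1 k) \<and> selfadj (h2 k)) \<and>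
     (\<forall>k. \<alpha> k = mexp (cscale (\<i>/2) (h2 k)) ** mexp (cscale \<i> (h1 k)) ** mexp (cscale (\<i>/2) (h2 k)))"

end

theory Submission
  imports Defs "HOL-Computational_Algebra.Fundamental_Theorem_Algebra"
begin

text \<open>A unitary matrix with simple spectrum whose determinant has a chosen phase \<open>\<psi>\<close> has exactly one
  Hermitian logarithm with trace \<open>\<psi>\<close> and spectral diameter at most \<open>2\<pi>\<close>; this logarithm is therefore
  continuous wherever the spectrum stays simple, inherits periodicity and the matching relation from
  the family and from \<open>\<psi>\<close>, and no eigenvalues need to be labelled. Unitary matrices with a degenerate
  eigenvalue have codimension three, so over a two-dimensional torus a generic small perturbation of
  \<open>\<alpha>\<close> has simple spectrum, and its logarithm serves as \<open>h2\<close>. What remains is uniformly close to the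
  identity and has a principal logarithm \<open>h1\<close>.

  In the equivariant case simplicity can only be achieved away from the fixed points of
  \<open>k \<mapsto> - k\<close>. There it suffices that some logarithm of trace \<open>\<psi>\<close> commutes with time reversal, since
  contracting its spectrum towards its mean opens the gap. For \<open>\<epsilon> = 1\<close> such a logarithm always exists; for
  \<open>\<epsilon> = J\<close> Kramers degeneracy makes its existence a parity condition, which is both open and closed along an
  equivariant homotopy and holds at its trivial end.\<close>

section \<open>Spectral calculus\<close>

text \<open>The phase \<psi> is a periodic function because the matching relation makes
  \<open>det (\<alpha> k)\<close> even in k, which excludes winding around the torus. Eigenframes
  need not admit a continuous choice. What replaces it is that all frames over all k form a closed
  relation with values in a compact set; a matrix that does not depend on the frame picked at k is
  then continuous in k. Genericity is a statement about null sets: a differentiable map between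
  spaces of equal dimension sends a hyperplane to a null set. Perturbations are therefore written
  with the Cayley transform, whose inverse is explicit and rational, so that the parameter producing
  a given degenerate matrix can be solved for. The matching relation couples the perturbation at k
  to the one at -k, whereas the genericity argument handles a factor on one side only. Hence the
  cut-off functions live where \<open>sin (2 * pi * k $ i) > 0\<close>, a region disjoint from its
  reflection. Using both i = 1 and i = 2 leaves only the points where both sines vanish, and these
  are the fixed points on the torus.\<close>

definition diagm :: "('n::finite \<Rightarrow> complex) \<Rightarrow> 'n cmat" where
  "diagm d = (\<chi> i j. if i = j then d i else 0)"

text \<open>A unitary frame together with a labelled family of values. Normal matrices are kept in
  this form, so that products, adjoints, exponentials and Cayley transforms become pointwise
  operations on the values.\<close>

definition udiag :: "'n::finite cmat \<Rightarrow> ('n \<Rightarrow> complex) \<Rightarrow> 'n cmat" where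
  "udiag W d = W ** diagm d ** cadj W"

lemma cadj_mult: "cadj (A ** B) = cadj B ** cadj A"
  by (simp add: cadj_def matrix_matrix_mult_def vec_eq_iff mult.commute)

lemma cadj_cadj [simp]: "cadj (cadj A) = A"
  by (simp add: cadj_def vec_eq_iff)

lemma cadj_mat_1 [simp]: "cadj (mat 1) = mat 1"
  by (auto simp add: cadj_def mat_def vec_eq_iff)

lemma cadj_add: "cadj (A + B) = cadj A + cadj B"
  by (simp add: cadj_def vec_eq_iff)

lemma diagm_mult: "diagm d ** diagm e = diagm (\<lambda>j. d j * e j)"
  by (simp add: diagm_def matrix_matrix_mult_def vec_eq_iff if_distrib [where f = "\<lambda>x. x * _"]
      if_distrib [where f = "\<lambda>x. _ * x"] cong: if_cong)

lemma diagm_1 [simp]: "diagm (\<lambda>_. 1) = mat 1"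
  by (simp add: diagm_def mat_def)

lemma cadj_diagm: "cadj (diagm d) = diagm (\<lambda>j. cnj (d j))"
  by (auto simp add: diagm_def cadj_def vec_eq_iff)

lemma det_diagm: "det (diagm d) = (\<Prod>j\<in>UNIV. d j)"
  by (subst det_diagonal) (auto simp: diagm_def)

lemma diagm_mult_entry: "(diagm d ** A) $ i $ j = d i * A $ i $ j"
  by (simp add: diagm_def matrix_matrix_mult_def if_distrib [where f = "\<lambda>x. x * _"] cong: if_cong)

lemma mult_diagm_entry: "(A ** diagm d) $ i $ j = A $ i $ j * d j"
  by (simp add: diagm_def matrix_matrix_mult_def if_distrib cong: if_cong)

lemma unitaryD: "unitary U \<Longrightarrow> U ** cadj U = mat 1" "unitary U \<Longrightarrow> cadj U ** U = mat 1"
  by (auto simp: unitary_def)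

lemma unitaryI: "cadj U ** U = mat 1 \<Longrightarrow> unitary U"
  unfolding unitary_def using matrix_left_right_inverse by blast

lemma unitary_cadj: "unitary U \<Longrightarrow> unitary (cadj U)"
  by (simp add: unitary_def)

lemma unitary_mult:
  assumes "unitary U" "unitary V" shows "unitary (U ** V)"
proof (rule unitaryI)
  have "cadj (U ** V) ** (U ** V) = cadj V ** (cadj U ** U) ** V"
    by (simp add: cadj_mult matrix_mul_assoc)
  then show "cadj (U ** V) ** (U ** V) = mat 1"
    using assms by (simp add: unitaryD)
qed

lemma unitary_1 [simp]: "unitary (mat 1)"
  by (simp add: unitary_def)

lemma unitary_cancel_left [simp]: "unitary W \<Longrightarrow> A ** cadj W ** W = A"
  "unitary W \<Longrightarrow> A ** W ** cadj W = A"
  by (simp_all add: matrix_mul_assoc [symmetric] unitaryD)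

lemma udiag_mult: "unitary W \<Longrightarrow> udiag W d ** udiag W e = udiag W (\<lambda>j. d j * e j)"
  unfolding udiag_def diagm_mult [symmetric] by (simp add: matrix_mul_assoc)

lemma udiag_1 [simp]: "unitary W \<Longrightarrow> udiag W (\<lambda>_. 1) = mat 1"
  by (simp add: udiag_def unitaryD)

lemma cadj_udiag: "cadj (udiag W d) = udiag W (\<lambda>j. cnj (d j))"
  by (simp add: udiag_def cadj_mult cadj_diagm matrix_mul_assoc)

lemma unitary_udiag:
  assumes "unitary W" "\<And>j. norm (d j) = 1" shows "unitary (udiag W d)"
  using assms by (intro unitaryI) (simp add: cadj_udiag udiag_mult complex_norm_square [symmetric] mult.commute)

lemma selfadj_udiag: "selfadj (udiag W (\<lambda>j. of_real (x j)))"
  by (simp add: selfadj_def cadj_udiag)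

lemma udiag_entry: "udiag W d $ a $ b = (\<Sum>j\<in>UNIV. W $ a $ j * d j * cnj (W $ b $ j))"
  by (simp add: udiag_def matrix_matrix_mult_def [of "W ** diagm d"] mult_diagm_entry cadj_def)

lemma udiag_add: "udiag W d + udiag W e = udiag W (\<lambda>j. d j + e j)"
  by (simp add: vec_eq_iff udiag_entry sum.distrib algebra_simps)

lemma udiag_diff: "udiag W d - udiag W e = udiag W (\<lambda>j. d j - e j)"
  by (simp add: vec_eq_iff udiag_entry sum_subtractf algebra_simps)

lemma cscale_udiag: "cscale c (udiag W d) = udiag W (\<lambda>j. c * d j)"
  by (simp add: vec_eq_iff udiag_entry cscale_def sum_distrib_left algebra_simps)

lemma scaleR_udiag: "c *\<^sub>R (udiag W d) = udiag W (\<lambda>j. c *\<^sub>R d j)"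
  by (simp add: vec_eq_iff udiag_entry scaleR_sum_right)

lemma mult_udiag: "V ** udiag W d ** cadj V = udiag (V ** W) d"
  by (simp add: udiag_def cadj_mult matrix_mul_assoc)

lemma det_unitary_norm:
  assumes "unitary U" shows "norm (det U) = 1"
proof -
  have "det (cadj U) = cnj (det U)"
  proof -
    have "cadj U = transpose (\<chi> i j. cnj (U $ i $ j))"
      by (simp add: cadj_def transpose_def vec_eq_iff)
    then show ?thesis
      by (simp add: det_transpose) (simp add: det_def)
  qed
  then have "det U * cnj (det U) = 1"
    using unitaryD(1)[OF assms] by (metis det_I det_mul)
  then have "(norm (det U))\<^sup>2 = 1"
    by (metis complex_norm_square of_real_eq_1_iff)
  then show ?thesis
    by (simp add: power2_eq_1_iff) (metis norm_ge_zero not_one_le_zero le_minus_one_simps(3))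
qed

lemma det_cadj_unitary: "unitary W \<Longrightarrow> det W * det (cadj W) = 1"
  by (metis det_I det_mul unitaryD(1))

lemma det_udiag: "unitary W \<Longrightarrow> det (udiag W d) = (\<Prod>j\<in>UNIV. d j)"
  using det_cadj_unitary [of W]
  by (simp add: udiag_def det_mul det_diagm mult.assoc mult.left_commute [of "det W"])

text \<open>Moving both frames to one side gives an intertwining relation for the transition matrix
  \<open>cadj W ** V\<close>: it may couple only indices that carry equal values. Comparisons of two
  diagonalisations rest on this.\<close>

lemma udiag_eq_iff:
  assumes "unitary W" "unitary V"
  shows "udiag W d = udiag V e \<longleftrightarrow> (\<forall>i j. d i * (cadj W ** V) $ i $ j = (cadj W ** V) $ i $ j * e j)"
proof -
  have "udiag W d = udiag V e \<longleftrightarrow> cadj W ** udiag W d ** V = cadj W ** udiag V e ** V"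
    (is "?A \<longleftrightarrow> ?B")
  proof
    assume ?B
    then have "W ** (cadj W ** udiag W d ** V) ** cadj V = W ** (cadj W ** udiag V e ** V) ** cadj V"
      by simp
    then have "(W ** cadj W) ** udiag W d ** (V ** cadj V) = (W ** cadj W) ** udiag V e ** (V ** cadj V)"
      by (simp only: matrix_mul_assoc)
    then show ?A using assms by (simp add: unitaryD)
  qed simp
  also have "cadj W ** udiag W d ** V = diagm d ** (cadj W ** V)"
    using assms by (simp add: udiag_def matrix_mul_assoc unitaryD)
  also have "cadj W ** udiag V e ** V = (cadj W ** V) ** diagm e"
    using assms by (simp add: udiag_def matrix_mul_assoc)
  finally show ?thesis
    by (simp add: vec_eq_iff diagm_mult_entry mult_diagm_entry)
qed

text \<open>A nonzero entry of the transition matrix forces \<open>d i = e j\<close>, hence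
  \<open>g (d i) = g (e j)\<close>. Functional calculus is thus independent of the frame, for an
  arbitrary function \<open>g\<close>.\<close>

lemma udiag_funcalc:
  assumes "unitary W" "unitary V" "udiag W d = udiag V e"
  shows "udiag W (\<lambda>j. g (d j)) = udiag V (\<lambda>j. g (e j))"
  using assms(3) unfolding udiag_eq_iff [OF assms(1,2)]
  by (simp add: mult.commute [of _ "(cadj W ** V) $ _ $ _"]) metis

text \<open>The transition matrix is unitary, so some term in the Leibniz expansion of its
  determinant is nonzero. The permutation of that term pairs equal values.\<close>

lemma udiag_matching:
  assumes "unitary W" "unitary V" "udiag W d = udiag V e"
  shows "\<exists>p. p permutes UNIV \<and> (\<forall>i. d i = e (p i))"
proof -
  let ?U = "cadj W ** V"
  have "norm (det ?U) = 1"
    using assms by (intro det_unitary_norm unitary_mult unitary_cadj)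
  then have "det ?U \<noteq> 0" by auto
  then have "\<exists>p. p permutes UNIV \<and> (\<Prod>i\<in>UNIV. ?U $ i $ p i) \<noteq> 0"
    unfolding det_def by (rule contrapos_np) (intro sum.neutral, auto)
  then obtain p where p: "p permutes UNIV" "(\<Prod>i\<in>UNIV. ?U $ i $ p i) \<noteq> 0"
    by blast
  then have "?U $ i $ p i \<noteq> 0" for i by simp
  then have "d i = e (p i)" for i
    using assms(3) unfolding udiag_eq_iff [OF assms(1,2)]
    by (simp add: mult.commute [of _ "(cadj W ** V) $ _ $ _"]) metis
  with p show ?thesis by auto
qed

section \<open>The Frobenius norm and the trace under unitary factors\<close>

lemma norm_cmat_sq: "(norm (A :: 'n::finite cmat))\<^sup>2 = (\<Sum>i\<in>UNIV. \<Sum>j\<in>UNIV. (norm (A $ i $ j))\<^sup>2)"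
  by (simp add: norm_vec_def L2_set_def sum_nonneg)

lemma cmat_norm_sq_trace: "of_real ((norm (A :: 'n::finite cmat))\<^sup>2) = trace (A ** cadj A)"
  by (simp add: norm_cmat_sq trace_def matrix_matrix_mult_def cadj_def complex_norm_square flip: of_real_power)

lemma norm_mult_unitary_right: "unitary U \<Longrightarrow> norm (A ** U) = norm (A :: 'n::finite cmat)"
proof -
  assume "unitary U"
  then have "complex_of_real ((norm (A ** U))\<^sup>2) = of_real ((norm A)\<^sup>2)"
    unfolding cmat_norm_sq_trace by (simp only: cadj_mult matrix_mul_assoc unitary_cancel_left)
  then show ?thesis by (simp only: of_real_eq_iff power2_eq_iff_nonneg norm_ge_zero)
qed

lemma norm_cadj [simp]: "norm (cadj A) = norm A"
proof -
  have "(norm (cadj A))\<^sup>2 = (norm A)\<^sup>2"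
    unfolding norm_cmat_sq by (subst sum.swap) (simp add: cadj_def)
  then show ?thesis by (simp only: power2_eq_iff_nonneg norm_ge_zero)
qed

lemma norm_mult_unitary_left: "unitary U \<Longrightarrow> norm (U ** A) = norm (A :: 'n::finite cmat)"
  by (metis cadj_mult norm_cadj norm_mult_unitary_right unitary_cadj)

lemma norm_transpose_cmat [simp]: "norm (transpose A :: 'n::finite cmat) = norm A"
proof -
  have "(norm (transpose A))\<^sup>2 = (norm A)\<^sup>2"
    unfolding norm_cmat_sq by (subst sum.swap) (simp add: transpose_def)
  then show ?thesis by (simp only: power2_eq_iff_nonneg norm_ge_zero)
qed

lemma norm_entry_le: "norm ((A :: 'n::finite cmat) $ i $ j) \<le> norm A"
  by (meson Finite_Cartesian_Product.norm_nth_le order_trans)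

lemma norm_udiag_entry_le: "unitary W \<Longrightarrow> norm (d j) \<le> norm (udiag W d)"
proof -
  assume W: "unitary W"
  have "norm (udiag W d) = norm (diagm d)"
    using W by (simp add: udiag_def norm_mult_unitary_left norm_mult_unitary_right unitary_cadj)
  moreover have "norm (d j) \<le> norm (diagm d)"
    using norm_entry_le [of "diagm d" j j] by (simp add: diagm_def)
  ultimately show ?thesis by simp
qed

lemma trace_udiag: "unitary W \<Longrightarrow> trace (udiag W d) = (\<Sum>j\<in>UNIV. d j)"
proof -
  assume W: "unitary W"
  have "trace (udiag W d) = trace (cadj W ** (W ** diagm d))"
    unfolding udiag_def by (rule trace_mul_sym)
  also have "\<dots> = (\<Sum>j\<in>UNIV. d j)"
    using W by (simp add: matrix_mul_assoc unitaryD trace_def diagm_def)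
  finally show ?thesis .
qed

subsection \<open>Matrix exponential and Cayley transform\<close>

lemma mpow_udiag: "unitary W \<Longrightarrow> mpow (udiag W d) k = udiag W (\<lambda>j. d j ^ k)"
  by (induction k) (simp_all add: udiag_mult)

lemma mexp_udiag:
  assumes "unitary W"
  shows "mexp (udiag W d) = udiag W (\<lambda>j. exp (d j))"
proof -
  have "(\<lambda>k. (1 / fact k) *\<^sub>R mpow (udiag W d) k) sums udiag W (\<lambda>j. exp (d j))"
    unfolding sums_def
  proof (rule vec_tendstoI, rule vec_tendstoI)
    fix a b
    have "(\<lambda>k. d j ^ k /\<^sub>R fact k) sums exp (d j)" for j
      by (rule exp_converges)
    then have "(\<lambda>k. \<Sum>j\<in>UNIV. W $ a $ j * (d j ^ k /\<^sub>R fact k) * cnj (W $ b $ j)) sums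
      (\<Sum>j\<in>UNIV. W $ a $ j * exp (d j) * cnj (W $ b $ j))"
      by (intro sums_sum sums_mult sums_mult2)
    then show "(\<lambda>n. (\<Sum>k<n. (1 / fact k) *\<^sub>R mpow (udiag W d) k) $ a $ b) \<longlonglongrightarrow> udiag W (\<lambda>j. exp (d j)) $ a $ b"
      unfolding sums_def
      by (simp add: mpow_udiag assms scaleR_udiag udiag_entry divide_inverse)
  qed
  then show ?thesis
    unfolding mexp_def by (simp add: sums_iff)
qed

lemma mexp_cscale_udiag:
  assumes "unitary W"
  shows "mexp (cscale c (udiag W d)) = udiag W (\<lambda>j. exp (c * d j))"
  by (simp add: cscale_udiag mexp_udiag assms)

text \<open>Cramer's rule: the entries are quotients of polynomials in the entries of
  \<open>A\<close>, so differentiability can be checked entrywise.\<close>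

definition minv :: "'n::finite cmat \<Rightarrow> 'n cmat" where
  "minv A = (\<chi> k l. det (\<chi> i j. if j = k then (if i = l then 1 else 0) else A $ i $ j) / det A)"

lemma minv_right:
  assumes "det A \<noteq> 0"
  shows "A ** minv A = mat 1"
proof -
  have "A *v (\<chi> k. minv A $ k $ l) = axis l 1" for l
    unfolding cramer [OF assms] by (simp add: minv_def axis_def vec_eq_iff if_distrib cong: if_cong)
  then have "(A *v (\<chi> k. minv A $ k $ l)) $ i = axis l 1 $ i" for i l
    by simp
  then show ?thesis
    by (simp add: vec_eq_iff matrix_matrix_mult_def matrix_vector_mult_def mat_def axis_def)
qed

lemma minv_unique:
  assumes "A ** B = mat 1"
  shows "minv A = B"
proof -
  have "det A \<noteq> 0"
    using assms by (metis det_I det_mul mult_zero_left zero_neq_one)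
  then have "A ** minv A = mat 1" by (rule minv_right)
  moreover have "B ** A = mat 1" using assms matrix_left_right_inverse by blast
  ultimately show ?thesis by (metis matrix_mul_assoc matrix_mul_lid matrix_mul_rid)
qed

text \<open>On Hermitian matrices this is a chart of the unitary group around the identity, missing
  exactly the unitaries with eigenvalue -1. It takes the place of the exponential because it is
  rational and has the rational inverse \<open>cayinv\<close>.\<close>

definition cayley :: "'n::finite cmat \<Rightarrow> 'n cmat" where
  "cayley X = (mat 1 + cscale \<i> X) ** minv (mat 1 - cscale \<i> X)"

definition cay :: "complex \<Rightarrow> complex" where
  "cay z = (1 + \<i> * z) / (1 - \<i> * z)"

lemma one_plus_i_neq_0: "1 - \<i> * complex_of_real x \<noteq> 0" "1 + \<i> * complex_of_real x \<noteq> 0"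
  by (simp_all add: complex_eq_iff)

lemma minv_udiag:
  assumes "unitary W" "\<And>j. d j \<noteq> 0"
  shows "minv (udiag W d) = udiag W (\<lambda>j. 1 / d j)"
  by (rule minv_unique) (simp add: udiag_mult assms)

lemma mat1_udiag: "unitary W \<Longrightarrow> mat 1 + cscale c (udiag W d) = udiag W (\<lambda>j. 1 + c * d j)"
  "unitary W \<Longrightarrow> mat 1 - cscale c (udiag W d) = udiag W (\<lambda>j. 1 - c * d j)"
  by (subst udiag_1 [of W, symmetric], simp, simp only: cscale_udiag udiag_add udiag_diff)+

lemma cayley_udiag:
  assumes "unitary W"
  shows "cayley (udiag W (\<lambda>j. of_real (x j))) = udiag W (\<lambda>j. cay (of_real (x j)))"
  unfolding cayley_def mat1_udiag [OF assms]
  by (simp add: minv_udiag assms one_plus_i_neq_0 udiag_mult cay_def)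

text \<open>The half-angle substitution: a prescribed phase s is realised by the Cayley parameter
  tan (s/2).\<close>

lemma cay_tan:
  assumes "cos t \<noteq> 0"
  shows "cay (of_real (tan t)) = cis (2 * t)"
proof -
  have "cay (of_real (tan t)) = (of_real (cos t) + \<i> * of_real (sin t)) / (of_real (cos t) - \<i> * of_real (sin t))"
    using assms by (simp add: cay_def tan_def field_simps)
  also have "\<dots> = cis t / cis (- t)"
    by (simp add: cis.ctr complex_eq_iff [of "_ + _"] complex_eq_iff [of "_ - _"] Complex_eq)
  also have "\<dots> = cis (2 * t)"
    by (simp add: cis_divide)
  finally show ?thesis .
qed

lemma norm_cay [simp]: "norm (cay (of_real x)) = 1"
proof -
  have "cmod (1 + \<i> * of_real x) = cmod (1 - \<i> * of_real x)"
    by (simp add: cmod_def)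
  then show ?thesis
    using one_plus_i_neq_0 [of x] by (simp add: cay_def norm_divide)
qed

lemma exists_cay:
  assumes "norm z = 1" "z \<noteq> -1"
  shows "\<exists>x. z = cay (of_real x)"
proof -
  obtain t where t: "-pi < t" "t \<le> pi" "z = cis t"
    using assms(1) Arg_bounded [of z] rcis_cmod_Arg [of z] by (auto simp: rcis_def)
  with assms(2) have "t \<noteq> pi" by auto
  then have "cos (t / 2) \<noteq> 0"
    using t cos_gt_zero_pi [of "t/2"] by simp
  from cay_tan [OF this] t show ?thesis by (intro exI [of _ "tan (t / 2)"]) simp
qed

text \<open>On eigenvalues, \<open>cay x - 1\<close> divided by \<open>cay x + 1\<close> is i x,
  which explains the factor -i.\<close>

definition cayinv :: "'n::finite cmat \<Rightarrow> 'n cmat" where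
  "cayinv B = cscale (-\<i>) ((B - mat 1) ** minv (B + mat 1))"

lemma cay_plus_1: "cay (of_real x) + 1 = 2 / (1 - \<i> * of_real x)"
  using one_plus_i_neq_0 [of x] by (simp add: cay_def field_simps)

lemma cay_minus_1: "cay (of_real x) - 1 = 2 * \<i> * of_real x / (1 - \<i> * of_real x)"
  using one_plus_i_neq_0 [of x] by (simp add: cay_def field_simps)

lemma cayinv_cayley_udiag:
  assumes W: "unitary W" 
  shows "cayinv (udiag W (\<lambda>j. cay (of_real (x j)))) = udiag W (\<lambda>j. of_real (x j))"
    and "det (udiag W (\<lambda>j. cay (of_real (x j))) + mat 1) \<noteq> 0"
proof -
  let ?B = "udiag W (\<lambda>j. cay (of_real (x j)))"
  have 1: "?B + mat 1 = udiag W (\<lambda>j. 2 / (1 - \<i> * of_real (x j)))"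
    using udiag_add [of W _ "\<lambda>_. 1"] W by (simp add: cay_plus_1)
  have 2: "?B - mat 1 = udiag W (\<lambda>j. 2 * \<i> * of_real (x j) / (1 - \<i> * of_real (x j)))"
    using udiag_diff [of W _ "\<lambda>_. 1"] W by (simp add: cay_minus_1)
  have 3: "minv (?B + mat 1) = udiag W (\<lambda>j. (1 - \<i> * of_real (x j)) / 2)"
    unfolding 1 using W one_plus_i_neq_0 by (subst minv_udiag) auto
  have "- \<i> * (2 * \<i> * of_real r / (1 - \<i> * of_real r) * ((1 - \<i> * of_real r) / 2)) = of_real r" for r
    using one_plus_i_neq_0 [of r] by (simp add: field_simps)
  then show "cayinv ?B = udiag W (\<lambda>j. of_real (x j))"
    unfolding cayinv_def 2 3 using W by (simp add: udiag_mult cscale_udiag)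
  show "det (?B + mat 1) \<noteq> 0"
    unfolding 1 using W one_plus_i_neq_0 by (simp add: det_udiag)
qed

subsection \<open>The time-reversal involution\<close>

text \<open>The anti-automorphism for which the matching relation reads
  \<open>f k = twist \<epsilon> (f (- k))\<close>. On Hermitian matrices it is conjugation by an
  antiunitary operator, time reversal.\<close>

definition twist :: "'n::finite cmat \<Rightarrow> 'n cmat \<Rightarrow> 'n cmat" where
  "twist \<epsilon> A = transpose \<epsilon> ** transpose A ** \<epsilon>"

definition cnjm :: "'n::finite cmat \<Rightarrow> 'n cmat" where
  "cnjm A = (\<chi> i j. cnj (A $ i $ j))"

text \<open>Treats both choices of \<epsilon> at once. The symmetric-or-antisymmetric alternative is
  what makes \<open>twist\<close> an involution.\<close>

definition real_orth :: "'n::finite cmat \<Rightarrow> bool" where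
  "real_orth \<epsilon> \<longleftrightarrow> cadj \<epsilon> = transpose \<epsilon> \<and> unitary \<epsilon> \<and> (transpose \<epsilon> = \<epsilon> \<or> transpose \<epsilon> = - \<epsilon>)"

lemma real_orthD:
  assumes "real_orth \<epsilon>"
  shows "transpose \<epsilon> ** \<epsilon> = mat 1" "\<epsilon> ** transpose \<epsilon> = mat 1" "unitary \<epsilon>" "unitary (transpose \<epsilon>)"
    "cadj (transpose \<epsilon>) = \<epsilon>"
  using assms unfolding real_orth_def by (metis unitaryD unitary_cadj cadj_cadj)+

lemma twist_mult: "real_orth \<epsilon> \<Longrightarrow> twist \<epsilon> (A ** B) = twist \<epsilon> B ** twist \<epsilon> A"
proof -
  assume e: "real_orth \<epsilon>"
  have "twist \<epsilon> B ** twist \<epsilon> A = transpose \<epsilon> ** transpose B ** (\<epsilon> ** transpose \<epsilon>) ** transpose A ** \<epsilon>"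
    by (simp add: twist_def matrix_mul_assoc)
  then show ?thesis
    using real_orthD(2) [OF e] by (simp add: twist_def matrix_transpose_mul matrix_mul_assoc)
qed

lemma twist_1 [simp]: "real_orth \<epsilon> \<Longrightarrow> twist \<epsilon> (mat 1) = mat 1"
  by (simp add: twist_def real_orthD transpose_mat)

lemma minus_mult_minus: "(- A) ** (B :: 'a::ring_1^'n^'m) = - (A ** B)" "A ** (- B) = - (A ** B)"
  by (simp_all add: matrix_matrix_mult_def vec_eq_iff sum_negf)

lemma twist_twist: 
  assumes "real_orth \<epsilon>"
  shows "twist \<epsilon> (twist \<epsilon> A) = A"
proof -
  have e: "transpose \<epsilon> = \<epsilon> \<or> transpose \<epsilon> = - \<epsilon>"
    using assms real_orth_def by blast
  have "twist \<epsilon> (twist \<epsilon> A) = transpose \<epsilon> ** transpose \<epsilon> ** A ** (\<epsilon> ** \<epsilon>)"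
    by (simp add: twist_def matrix_transpose_mul matrix_mul_assoc)
  also have "\<dots> = transpose \<epsilon> ** \<epsilon> ** A ** (transpose \<epsilon> ** \<epsilon>)"
    using e by (auto simp: minus_mult_minus)
  finally show ?thesis
    using assms by (simp add: real_orthD)
qed

text \<open>Transposition conjugates the frame and leaves the values alone: time reversal moves
  eigenvectors but keeps eigenvalues. Frames at -k can therefore be carried to frames at k with the
  same phases.\<close>

lemma twist_udiag:
  assumes "real_orth \<epsilon>"
  shows "twist \<epsilon> (udiag W d) = udiag (transpose \<epsilon> ** cnjm W) d"
proof -
  have "transpose (udiag W d) = udiag (cnjm W) d"
    by (simp add: vec_eq_iff udiag_entry transpose_def cnjm_def mult.commute mult.left_commute)
  then have "twist \<epsilon> (udiag W d) = transpose \<epsilon> ** udiag (cnjm W) d ** cadj (transpose \<epsilon>)"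
    by (simp add: twist_def real_orthD [OF assms])
  then show ?thesis by (simp only: mult_udiag)
qed

lemma unitary_cnjm: "unitary W \<Longrightarrow> unitary (cnjm W)"
proof (rule unitaryI)
  assume W: "unitary W"
  have "cadj (cnjm W) ** cnjm W = cnjm (cadj W ** W)"
    by (simp add: vec_eq_iff cadj_def cnjm_def matrix_matrix_mult_def)
  then show "cadj (cnjm W) ** cnjm W = mat 1"
    using W by (simp add: unitaryD) (simp add: cnjm_def mat_def vec_eq_iff)
qed

lemma unitary_twist_frame: "real_orth \<epsilon> \<Longrightarrow> unitary W \<Longrightarrow> unitary (transpose \<epsilon> ** cnjm W)"
  by (intro unitary_mult unitary_cnjm real_orthD(4))

lemma twist_cadj: "real_orth \<epsilon> \<Longrightarrow> twist \<epsilon> (cadj A) = cadj (twist \<epsilon> A)"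
proof -
  assume e: "real_orth \<epsilon>"
  then have "cadj \<epsilon> = transpose \<epsilon>" by (simp add: real_orth_def)
  moreover have "cadj (transpose A) = transpose (cadj A)"
    by (simp add: cadj_def transpose_def vec_eq_iff)
  ultimately show ?thesis
    by (simp add: twist_def cadj_mult real_orthD(5) [OF e] matrix_mul_assoc)
qed

lemma twist_unitary: "real_orth \<epsilon> \<Longrightarrow> unitary A \<Longrightarrow> unitary (twist \<epsilon> A)"
  by (rule unitaryI) (simp only: unitaryD twist_1 twist_cadj [symmetric] twist_mult [symmetric])

lemma norm_twist: "real_orth \<epsilon> \<Longrightarrow> norm (twist \<epsilon> A) = norm A"
  by (simp add: twist_def norm_mult_unitary_left norm_mult_unitary_right real_orthD)

lemma det_twist: "real_orth \<epsilon> \<Longrightarrow> det (twist \<epsilon> A) = det A"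
proof -
  assume e: "real_orth \<epsilon>"
  have "det (transpose \<epsilon>) * det \<epsilon> = 1"
    by (metis det_I det_mul e real_orthD(1))
  then show ?thesis by (simp add: twist_def det_mul det_transpose mult.assoc mult.left_commute)
qed

lemma transpose_scaleR: "transpose (c *\<^sub>R A) = c *\<^sub>R transpose (A :: 'n::finite cmat)"
  by (simp add: transpose_def vec_eq_iff)

lemma transpose_add: "transpose (A + B) = transpose A + transpose (B :: 'n::finite cmat)"
  by (simp add: transpose_def vec_eq_iff)

lemma scaleR_cmat_mult: "(c *\<^sub>R A) ** B = c *\<^sub>R (A ** (B :: 'n::finite cmat))"
  "A ** (c *\<^sub>R B) = c *\<^sub>R (A ** (B :: 'n::finite cmat))"
  by (simp_all add: matrix_matrix_mult_def vec_eq_iff scaleR_sum_right)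

lemma cmat_add_mult: "(A + B) ** C = A ** C + B ** (C :: 'n::finite cmat)"
  by (simp add: matrix_matrix_mult_def vec_eq_iff distrib_right sum.distrib)

lemma bounded_linear_twist: "bounded_linear (twist \<epsilon>)"
  unfolding linear_conv_bounded_linear [symmetric] twist_def
  by (rule linearI) (simp_all add: transpose_add transpose_scaleR scaleR_cmat_mult
      matrix_add_ldistrib cmat_add_mult)

lemma matching_rel_iff:
  assumes "real_orth \<epsilon>"
  shows "matching_rel \<epsilon> f \<longleftrightarrow> (\<forall>k. f k = twist \<epsilon> (f (- k)))"
proof -
  have "\<epsilon> ** A = B ** \<epsilon> \<longleftrightarrow> A = transpose \<epsilon> ** B ** \<epsilon>" for A B
  proof
    assume "\<epsilon> ** A = B ** \<epsilon>"
    then have "transpose \<epsilon> ** (\<epsilon> ** A) = transpose \<epsilon> ** (B ** \<epsilon>)" by simp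
    then show "A = transpose \<epsilon> ** B ** \<epsilon>" by (simp add: matrix_mul_assoc real_orthD assms)
  next
    assume "A = transpose \<epsilon> ** B ** \<epsilon>"
    then show "\<epsilon> ** A = B ** \<epsilon>" by (simp add: matrix_mul_assoc real_orthD assms)
  qed
  then show ?thesis by (simp add: matching_rel_def twist_def)
qed

subsection \<open>Eigenvectors and the spectral theorem\<close>

definition cdot :: "complex ^ 'n::finite \<Rightarrow> complex ^ 'n \<Rightarrow> complex" where
  "cdot u v = (\<Sum>i\<in>UNIV. cnj (u $ i) * v $ i)"

lemma cdot_add_right: "cdot u (v + w) = cdot u v + cdot u w"
  by (simp add: cdot_def algebra_simps sum.distrib)

lemma cdot_scale_right: "cdot u (a *s v) = a * cdot u v"
  by (simp add: cdot_def sum_distrib_left mult.left_commute)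

lemma cdot_scale_left: "cdot (a *s u) v = cnj a * cdot u v"
  by (simp add: cdot_def sum_distrib_left mult.assoc)

lemma cdot_0_right [simp]: "cdot u 0 = 0"
  by (simp add: cdot_def)

lemma cdot_cnj: "cnj (cdot u v) = cdot v u"
  by (simp add: cdot_def mult.commute)

lemma cdot_adj: "cdot u (A *v v) = cdot (cadj A *v u) v"
proof -
  have "cdot u (A *v v) = (\<Sum>i\<in>UNIV. \<Sum>j\<in>UNIV. cnj (u $ i) * A $ i $ j * v $ j)"
    by (simp add: cdot_def matrix_vector_mult_def sum_distrib_left mult.assoc)
  also have "\<dots> = cdot (cadj A *v u) v"
    by (subst sum.swap) (simp add: cdot_def matrix_vector_mult_def cadj_def sum_distrib_right
        sum_distrib_left mult.commute mult.left_commute)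
  finally show ?thesis .
qed

lemma cdot_self: "cdot v v = of_real ((norm v)\<^sup>2)"
  by (simp add: cdot_def norm_vec_def L2_set_def sum_nonneg complex_norm_square mult.commute
      flip: of_real_power)

lemma cdot_self_eq_0 [simp]: "cdot v v = 0 \<longleftrightarrow> v = 0"
  by (simp add: cdot_self)

lemma exists_unit_multiple:
  assumes "v \<noteq> 0"
  shows "cdot (of_real (1 / norm v) *s v) (of_real (1 / norm v) *s v) = 1"
  using assms unfolding cdot_scale_left cdot_scale_right
  by (simp add: cdot_self power2_eq_square)

text \<open>The vector p(A) v by Horner's scheme, so that a property preserved by u \<mapsto> a v +
  A u passes to every p(A) v.\<close>

definition pact :: "'n::finite cmat \<Rightarrow> complex poly \<Rightarrow> complex ^ 'n \<Rightarrow> complex ^ 'n" where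
  "pact A p v = fold_coeffs (\<lambda>a u. a *s v + A *v u) p 0"

lemma pact_0 [simp]: "pact A 0 v = 0"
  by (simp add: pact_def)

lemma pact_pCons: "pact A (pCons a p) v = a *s v + A *v pact A p v"
  by (cases "p = 0 \<and> a = 0") (auto simp: pact_def)

lemma pact_add: "pact A (p + q) v = pact A p v + pact A q v"
proof (induction p arbitrary: q)
  case (pCons a p)
  obtain b q' where q: "q = pCons b q'" by (metis pCons_cases)
  show ?case
    unfolding q by (simp add: pact_pCons pCons.IH matrix_vector_right_distrib vector_sadd_rdistrib)
qed simp

lemma pact_smult: "pact A (smult c p) v = c *s pact A p v"
  by (induction p) (simp_all add: pact_pCons vector_ssub_ldistrib vector_add_ldistrib
      vec.scale vector_smult_assoc)

lemma pact_monom: "pact A (monom a i) v = a *s (mpow A i *v v)"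
proof (induction i)
  case 0
  then show ?case by (simp add: monom_0 pact_pCons)
next
  case (Suc i)
  then show ?case
    by (simp add: monom_Suc pact_pCons vec.scale matrix_vector_mul_assoc)
qed

lemma pact_sum: "pact A (sum f S) v = (\<Sum>i\<in>S. pact A (f i) v)"
  by (induction S rule: infinite_finite_induct) (simp_all add: pact_add)

lemma pact_linear_factor: "pact A ([:- r, 1:] * q) v = A *v pact A q v - r *s pact A q v"
proof -
  have "[:- r, 1:] * q = smult (- r) q + pCons 0 q" by simp
  then show ?thesis
    by (simp only: pact_add pact_smult pact_pCons) simp
qed

text \<open>With N the real dimension, the N + 1 vectors v, A v, ..., A^N v either contain a
  repetition or are linearly dependent over the reals.\<close>

lemma annihilating_poly:
  fixes v :: "complex ^ 'n::finite"
  shows "\<exists>p. p \<noteq> 0 \<and> pact A p v = 0"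
proof -
  let ?N = "DIM(complex ^ 'n)"
  let ?f = "\<lambda>i. mpow A i *v v"
  show ?thesis
  proof (cases "inj_on ?f {..?N}")
    case True
    then have "card (?f ` {..?N}) > ?N" by (simp add: card_image)
    then have "dependent (?f ` {..?N})" by (intro dependent_biggerset) auto
    then obtain c x where c: "x \<in> ?f ` {..?N}" "c x \<noteq> (0::real)" "(\<Sum>y\<in>?f ` {..?N}. c y *\<^sub>R y) = 0"
      by (auto simp: dependent_finite)
    then obtain i0 where i0: "i0 \<le> ?N" "x = ?f i0" by auto
    define p where "p = (\<Sum>i\<le>?N. monom (complex_of_real (c (?f i))) i)"
    have "coeff p i0 = of_real (c (?f i0))"
      using i0 by (simp add: p_def coeff_sum)
    then have "p \<noteq> 0" using c i0 by auto
    moreover have "pact A p v = (\<Sum>i\<le>?N. c (?f i) *\<^sub>R ?f i)"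
      by (simp add: p_def pact_sum pact_monom vec_eq_iff scaleR_conv_of_real [where 'a = complex])
    then have "pact A p v = 0"
      using c(3) True by (simp add: sum.reindex)
    ultimately show ?thesis by blast
  next
    case False
    then obtain i j where ij: "i \<noteq> j" "?f i = ?f j" by (auto simp: inj_on_def)
    define p where "p = monom 1 i + monom (-1 :: complex) j"
    have "coeff p i = 1" using ij by (simp add: p_def)
    then have "p \<noteq> 0" by auto
    moreover have "pact A p v = 0"
      using ij by (simp add: p_def pact_add pact_monom vec_eq_iff)
    ultimately show ?thesis by blast
  qed
qed

text \<open>Linear factors are split off the annihilating polynomial until q(A) v is nonzero while
  (A - r) q(A) v = 0; then q(A) v is an eigenvector. The predicate \<open>P\<close> keeps the search
  inside an invariant subspace without restricting \<open>A\<close> to it.\<close>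

lemma eigenvector_exists:
  assumes "p \<noteq> 0" "pact A p v = 0" "v \<noteq> 0"
    and "P v" "P 0" "\<And>a u. P u \<Longrightarrow> P (a *s v + A *v u)"
  shows "\<exists>e u. u \<noteq> 0 \<and> P u \<and> A *v u = e *s u"
  using assms(1,2)
proof (induction "degree p" arbitrary: p rule: less_induct)
  case less
  show ?case
  proof (cases "degree p = 0")
    case True
    then obtain a where "p = [:a:]" by (metis degree_eq_zeroE)
    with less.prems assms(3) show ?thesis by (simp add: pact_pCons)
  next
    case False
    then have "\<not> constant (poly p)" by (simp add: constant_degree)
    then obtain r where "poly p r = 0" using fundamental_theorem_of_algebra by blast
    then obtain q where q: "p = [:- r, 1:] * q" by (auto simp: poly_eq_0_iff_dvd dvd_def)
    have q0: "q \<noteq> 0" using q less.prems by auto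
    then have deg: "degree q < degree p"
      unfolding q by (subst degree_mult_eq) auto
    show ?thesis
    proof (cases "pact A q v = 0")
      case True
      then show ?thesis using less.hyps [OF deg q0] by blast
    next
      case False
      have "P (pact A q' v)" for q'
        by (induction q') (use assms(5,6) in \<open>auto simp: pact_pCons\<close>)
      moreover have "A *v pact A q v = r *s pact A q v"
        using less.prems(2) unfolding q pact_linear_factor by simp
      ultimately show ?thesis using False by blast
    qed
  qed
qed

definition normal_mat :: "'n::finite cmat \<Rightarrow> bool" where
  "normal_mat A \<longleftrightarrow> A ** cadj A = cadj A ** A"

lemma normal_unitary: "unitary A \<Longrightarrow> normal_mat A"
  by (simp add: normal_mat_def unitary_def)

lemma normal_selfadj: "selfadj A \<Longrightarrow> normal_mat A"
  by (simp add: normal_mat_def selfadj_def)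

text \<open>For normal \<open>A\<close> the vectors A v and A* v have the same norm, and then the
  square norm of A* v - cnj d v expands to zero.\<close>

lemma normal_eigenvector_adj:
  assumes "normal_mat A" "A *v v = d *s v"
  shows "cadj A *v v = cnj d *s v"
proof -
  have 1: "cdot (cadj A *v v) (cadj A *v v) = cdot (A *v v) (A *v v)"
  proof -
    have "cdot (cadj A *v v) (cadj A *v v) = cdot v (A *v (cadj A *v v))"
      by (simp only: cdot_adj)
    also have "\<dots> = cdot v (cadj A *v (A *v v))"
      using assms(1) by (simp add: matrix_vector_mul_assoc normal_mat_def)
    also have "\<dots> = cdot (A *v v) (A *v v)"
      by (subst cdot_adj) simp
    finally show ?thesis .
  qed
  let ?u = "cadj A *v v"
  have 2: "cdot v ?u = cnj d * cdot v v"
    by (subst cdot_adj) (simp add: assms(2) cdot_scale_left)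
  then have 3: "cdot ?u v = d * cdot v v"
    by (metis cdot_cnj complex_cnj_cnj complex_cnj_mult)
  let ?z = "?u + (- cnj d) *s v"
  have left: "cdot (a + b) c = cdot a c + cdot b c" for a b c :: "complex ^ 'n"
    by (simp add: cdot_def algebra_simps sum.distrib)
  have "cdot ?z ?z = 0"
    unfolding left cdot_add_right cdot_scale_left cdot_scale_right 1 2 3 assms(2) by simp
  then have "?z = 0" by (simp only: cdot_self_eq_0)
  then show ?thesis by (simp add: vec_eq_iff)
qed

definition eigfam :: "'n::finite cmat \<Rightarrow> 'n set \<Rightarrow> ('n \<Rightarrow> complex ^ 'n) \<Rightarrow> ('n \<Rightarrow> complex) \<Rightarrow> bool" where
  "eigfam A I w d \<longleftrightarrow> (\<forall>i\<in>I. A *v w i = d i *s w i) \<and>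
     (\<forall>i\<in>I. \<forall>j\<in>I. cdot (w i) (w j) = (if i = j then 1 else 0))"

lemma eigfam_empty: "eigfam A {} w d"
  by (simp add: eigfam_def)

lemma eigfam_insert:
  assumes "eigfam A I w d" "j \<notin> I" "A *v v = e *s v" "cdot v v = 1" "\<forall>i\<in>I. cdot (w i) v = 0"
  shows "eigfam A (insert j I) (w(j := v)) (d(j := e))"
proof -
  have "\<forall>i\<in>I. cdot v (w i) = 0"
    using assms(5) by (metis cdot_cnj complex_cnj_zero)
  then show ?thesis using assms by (auto simp: eigfam_def)
qed

text \<open>The vectors found so far are eigenvectors of the adjoint as well, so their orthogonal
  complement is invariant under \<open>A\<close>, and the eigenvector search can be run inside
  it.\<close>

lemma eigfam_extend:
  assumes "normal_mat A" "eigfam A I w d" "I \<noteq> UNIV"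
  obtains v e where "cdot v v = 1" "A *v v = e *s v" "\<forall>i\<in>I. cdot (w i) v = 0"
proof -
  let ?P = "\<lambda>u. \<forall>i\<in>I. cdot (w i) u = 0"
  \<comment> \<open>The rows outside \<open>I\<close> are zero, so \<open>M\<close> is singular; a
    kernel vector is orthogonal to every \<open>w i\<close> with i in \<open>I\<close>.\<close>
  define M :: "'a cmat" where "M = (\<chi> i j. if i \<in> I then cnj (w i $ j) else 0)"
  obtain j where j: "j \<notin> I" using assms(3) by blast
  have "det M = 0"
    by (rule det_zero_row(1) [of j]) (simp add: row_def M_def j vec_eq_iff)
  then have "\<not> invertible M" by (simp add: invertible_det_nz)
  then obtain v where v: "M *v v = 0" "v \<noteq> 0"
    using matrix_left_invertible_ker [of M] invertible_left_inverse [of M] by auto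
  have Pv: "?P v"
  proof
    fix i assume "i \<in> I"
    then have "cdot (w i) v = (M *v v) $ i"
      by (simp add: cdot_def M_def matrix_vector_mult_def)
    then show "cdot (w i) v = 0" using v by simp
  qed
  obtain p where p: "p \<noteq> 0" "pact A p v = 0" using annihilating_poly by blast
  have "?P (a *s v + A *v u)" if "?P u" for a u
  proof
    fix i assume i: "i \<in> I"
    then have "A *v w i = d i *s w i" using assms(2) by (simp add: eigfam_def)
    then have "cadj A *v w i = cnj (d i) *s w i" by (rule normal_eigenvector_adj [OF assms(1)])
    then show "cdot (w i) (a *s v + A *v u) = 0"
      using that Pv i by (simp add: cdot_add_right cdot_scale_right cdot_scale_left cdot_adj)
  qed
  then obtain e u where u: "u \<noteq> 0" "?P u" "A *v u = e *s u"
    using eigenvector_exists [OF p v(2), of ?P] Pv by auto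
  show ?thesis
  proof
    show "cdot (of_real (1 / norm u) *s u) (of_real (1 / norm u) *s u) = 1"
      by (rule exists_unit_multiple [OF u(1)])
    show "A *v (of_real (1 / norm u) *s u) = e *s (of_real (1 / norm u) *s u)"
      using u(3) by (simp add: vec.scale vector_smult_assoc mult.commute)
    show "\<forall>i\<in>I. cdot (w i) (of_real (1 / norm u) *s u) = 0"
      using u(2) by (simp add: cdot_scale_right)
  qed
qed

lemma eigfam_UNIV:
  assumes "eigfam A UNIV w d"
  shows "unitary (\<chi> a j. w j $ a)" "A = udiag (\<chi> a j. w j $ a) d"
proof -
  let ?W = "\<chi> a j. w j $ a"
  show W: "unitary ?W"
  proof (rule unitaryI)
    have "(cadj ?W ** ?W) $ i $ j = cdot (w i) (w j)" for i j
      by (simp add: cadj_def matrix_matrix_mult_def cdot_def)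
    then show "cadj ?W ** ?W = mat 1"
      using assms by (simp add: vec_eq_iff eigfam_def mat_def)
  qed
  have "(A ** ?W) $ a $ j = (A *v w j) $ a" for a j
    by (simp add: matrix_matrix_mult_def matrix_vector_mult_def)
  then have "A ** ?W = ?W ** diagm d"
    using assms by (simp add: vec_eq_iff mult_diagm_entry eigfam_def mult.commute)
  then have "A ** ?W ** cadj ?W = udiag ?W d" by (simp add: udiag_def)
  then show "A = udiag ?W d" using W by simp
qed

theorem spectral_normal:
  fixes A :: "'n::finite cmat"
  assumes "normal_mat A"
  obtains W d where "unitary W" "A = udiag W d"
proof -
  have "\<exists>w d. eigfam A I w d" if "finite I" for I :: "'n set"
    using that
  proof induction
    case (insert j I)
    then obtain w d where wd: "eigfam A I w d" by blast
    obtain v e where "cdot v v = 1" "A *v v = e *s v" "\<forall>i\<in>I. cdot (w i) v = 0"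
      by (rule eigfam_extend [OF assms wd]) (use insert in auto)
    then show ?case using eigfam_insert [OF wd insert(2)] by blast
  qed (blast intro: eigfam_empty)
  then obtain w d where "eigfam A UNIV w d" by (meson finite)
  then show ?thesis using eigfam_UNIV that by blast
qed

lemma udiag_inj:
  assumes "unitary W" "udiag W d = udiag W e"
  shows "d j = e j"
proof -
  have "d i * (if i = j then 1 else 0) = (if i = j then 1 else 0) * e j" for i j
    using assms(2) unfolding udiag_eq_iff [OF assms(1,1)] unitaryD(2) [OF assms(1)]
    by (auto simp: mat_def)
  from this [of j j] show ?thesis by simp
qed

lemma spectral_selfadj:
  assumes "selfadj A"
  obtains W x where "unitary W" "A = udiag W (\<lambda>j. of_real (x j))"
proof -
  obtain W d where W: "unitary W" "A = udiag W d"
    using spectral_normal normal_selfadj assms by blast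
  then have "udiag W (\<lambda>j. cnj (d j)) = udiag W d"
    using assms by (simp add: selfadj_def cadj_udiag)
  then have "cnj (d j) = d j" for j
    using udiag_inj [OF W(1)] by metis
  then have "d j = of_real (Re (d j))" for j by (simp add: complex_eq_iff)
  then have "d = (\<lambda>j. of_real (Re (d j)))" by (rule ext)
  with W that show ?thesis by metis
qed

lemma unitary_udiag_norm:
  assumes "unitary W" "unitary (udiag W d)" shows "norm (d j) = 1"
proof -
  have "udiag W (\<lambda>j. cnj (d j) * d j) = udiag W (\<lambda>_. 1)"
    using assms by (simp add: unitary_def cadj_udiag udiag_mult)
  then have "cnj (d j) * d j = 1" using udiag_inj [OF assms(1)] by metis
  then have "(norm (d j))\<^sup>2 = 1"
    by (metis complex_norm_square mult.commute of_real_eq_1_iff)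
  then show ?thesis
    by (simp add: power2_eq_1_iff) (metis norm_ge_zero not_one_le_zero le_minus_one_simps(3))
qed

lemma spectral_unitary:
  assumes "unitary A"
  shows "\<exists>W x. unitary W \<and> A = udiag W (\<lambda>j. cis (x j)) \<and> (\<forall>j. - pi < x j \<and> x j \<le> pi)"
proof -
  obtain W d where W: "unitary W" "A = udiag W d"
    using spectral_normal normal_unitary assms by blast
  then have "norm (d j) = 1" for j using unitary_udiag_norm assms by blast
  then have "d = (\<lambda>j. cis (Arg (d j)))"
    by (intro ext) (metis rcis_cmod_Arg rcis_def mult_1 of_real_1)
  then show ?thesis
    using W Arg_bounded by (intro exI [of _ W] exI [of _ "\<lambda>j. Arg (d j)"]) simp
qed

subsection \<open>Kramers pairs\<close>

text \<open>The antiunitary time-reversal operator; its square is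
  \<open>transpose \<epsilon> ** transpose \<epsilon>\<close>.\<close>

definition trev :: "'n::finite cmat \<Rightarrow> complex ^ 'n \<Rightarrow> complex ^ 'n" where
  "trev \<epsilon> v = transpose \<epsilon> *v (\<chi> i. cnj (v $ i))"

lemma trev_add: "trev \<epsilon> (u + v) = trev \<epsilon> u + trev \<epsilon> v"
proof -
  have "(\<chi> i. cnj ((u + v) $ i)) = (\<chi> i. cnj (u $ i)) + (\<chi> i. cnj (v $ i))"
    by (simp add: vec_eq_iff)
  then show ?thesis by (simp add: trev_def matrix_vector_right_distrib)
qed

lemma trev_scale: "trev \<epsilon> (a *s v) = cnj a *s trev \<epsilon> v"
proof -
  have "(\<chi> i. cnj ((a *s v) $ i)) = cnj a *s (\<chi> i. cnj (v $ i))"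
    by (simp add: vec_eq_iff)
  then show ?thesis by (simp add: trev_def vec.scale)
qed

lemma cnj_mult_vec: "(\<chi> i. cnj ((A *v v) $ i)) = cnjm A *v (\<chi> i. cnj (v $ i))"
  by (simp add: vec_eq_iff matrix_vector_mult_def cnjm_def)

lemma cdot_trev:
  assumes "real_orth \<epsilon>"
  shows "cdot (trev \<epsilon> u) (trev \<epsilon> v) = cdot v u"
proof -
  have "cdot (trev \<epsilon> u) (trev \<epsilon> v) = cdot (cadj (transpose \<epsilon>) *v trev \<epsilon> u) (\<chi> i. cnj (v $ i))"
    unfolding trev_def [of \<epsilon> v] cdot_adj ..
  also have "cadj (transpose \<epsilon>) *v trev \<epsilon> u = (\<chi> i. cnj (u $ i))"
    using assms by (simp add: trev_def matrix_vector_mul_assoc real_orthD del: transpose_matrix_vector)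
  finally show ?thesis by (simp add: cdot_def mult.commute)
qed

lemma cnjm_real_orth: "real_orth \<epsilon> \<Longrightarrow> cnjm (transpose \<epsilon>) = transpose \<epsilon>"
  unfolding real_orth_def cnjm_def cadj_def transpose_def by (simp add: vec_eq_iff)

lemma trev_trev:
  assumes "real_orth \<epsilon>"
  shows "trev \<epsilon> (trev \<epsilon> v) = transpose \<epsilon> ** transpose \<epsilon> *v v"
proof -
  have "(\<chi> i. cnj (trev \<epsilon> v $ i)) = transpose \<epsilon> *v v"
    by (subst trev_def, subst cnj_mult_vec) (simp add: cnjm_real_orth assms del: transpose_matrix_vector)
  then show ?thesis
    by (subst trev_def) (simp add: matrix_vector_mul_assoc del: transpose_matrix_vector)
qed

lemma trev_eigenvector:
  assumes e: "real_orth \<epsilon>" and A: "normal_mat A" "twist \<epsilon> A = A" and v: "A *v v = d *s v"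
  shows "A *v trev \<epsilon> v = d *s trev \<epsilon> v"
proof -
  let ?c = "\<chi> i. cnj (v $ i)"
  have "cadj A *v v = cnj d *s v" by (rule normal_eigenvector_adj [OF A(1) v])
  then have "(\<chi> i. cnj ((cadj A *v v) $ i)) = (\<chi> i. cnj ((cnj d *s v) $ i))" by simp
  then have 1: "transpose A *v ?c = d *s ?c"
    unfolding cnj_mult_vec by (simp add: cnjm_def cadj_def transpose_def vec_eq_iff)
  have "A *v trev \<epsilon> v = (transpose \<epsilon> ** transpose A ** \<epsilon>) *v (transpose \<epsilon> *v ?c)"
    using A(2) by (simp add: trev_def twist_def)
  also have "\<dots> = transpose \<epsilon> ** transpose A ** (\<epsilon> ** transpose \<epsilon>) *v ?c"
    by (simp add: matrix_vector_mul_assoc matrix_mul_assoc del: transpose_matrix_vector)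
  also have "\<dots> = transpose \<epsilon> *v (transpose A *v ?c)"
    by (simp add: real_orthD [OF e] matrix_vector_mul_assoc del: transpose_matrix_vector)
  also have "\<dots> = d *s trev \<epsilon> v"
    by (simp only: 1 vec.scale trev_def)
  finally show ?thesis .
qed

text \<open>A phase has to be allowed: if the square is -1, applying time reversal twice to a vector
  of a pair returns its negative. The phase cancels in \<open>udiag\<close>.\<close>

definition trfam :: "'n::finite cmat \<Rightarrow> ('n \<Rightarrow> 'n) \<Rightarrow> 'n set \<Rightarrow> ('n \<Rightarrow> complex ^ 'n) \<Rightarrow> bool" where
  "trfam \<epsilon> \<tau> I w \<longleftrightarrow> (\<forall>i\<in>I. \<tau> i \<in> I \<and> (\<exists>c. norm c = 1 \<and> trev \<epsilon> (w i) = c *s w (\<tau> i)))"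

text \<open>The index involution encodes the sign of \<open>\<epsilon>\<^sup>2\<close>: for \<open>\<epsilon> = J\<close> time reversal pairs
  orthogonal vectors, whereas for \<open>\<epsilon> = 1\<close> every vector can be made real.\<close>
definition compatible :: "'n::finite cmat \<Rightarrow> ('n \<Rightarrow> 'n) \<Rightarrow> bool" where
  "compatible \<epsilon> \<tau> \<longleftrightarrow> real_orth \<epsilon> \<and> (\<forall>i. \<tau> (\<tau> i) = i) \<and>
     (transpose \<epsilon> ** transpose \<epsilon> = mat 1 \<and> \<tau> = id \<or>
      transpose \<epsilon> ** transpose \<epsilon> = - mat 1 \<and> (\<forall>i. \<tau> i \<noteq> i))"

lemma minus_mat_1_mult: "(- mat 1) *v v = - (v :: complex ^ 'n::finite)"
  by (simp add: vec_eq_iff matrix_vector_mult_def mat_def sum_negf if_distrib [where f = "\<lambda>x. x * _"] cong: if_cong)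

lemma trfam_orthogonal:
  assumes "real_orth \<epsilon>" "\<forall>i. \<tau> (\<tau> i) = i" "trfam \<epsilon> \<tau> I w" "\<forall>i\<in>I. cdot (w i) v = 0"
  shows "\<forall>i\<in>I. cdot (w i) (trev \<epsilon> v) = 0"
proof
  fix i assume i: "i \<in> I"
  then have "\<tau> i \<in> I" using assms(3) by (auto simp: trfam_def)
  then obtain c where c: "norm c = 1" "trev \<epsilon> (w (\<tau> i)) = c *s w i"
    using assms(2,3) unfolding trfam_def by metis
  have "cnj c * cdot (w i) (trev \<epsilon> v) = cdot (trev \<epsilon> (w (\<tau> i))) (trev \<epsilon> v)"
    by (simp add: c cdot_scale_left)
  also have "\<dots> = 0"
    using assms(4) \<open>\<tau> i \<in> I\<close> by (metis cdot_trev [OF assms(1)] cdot_cnj complex_cnj_zero)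
  finally show "cdot (w i) (trev \<epsilon> v) = 0"
    using c(1) by auto
qed

text \<open>Write T for time reversal. If T squares to 1, then v + T v is fixed by T, unless it
  vanishes, and then i v is fixed. If T squares to -1, antiunitarity gives <T v, v> = <T v, T T v> =
  -<T v, v>, so v and T v are orthogonal eigenvectors for the same eigenvalue: Kramers
  degeneracy.\<close>

lemma trfam_extend:
  assumes comp: "compatible \<epsilon> \<tau>" and A: "normal_mat A" "twist \<epsilon> A = A"
    and wd: "eigfam A I w d" "trfam \<epsilon> \<tau> I w" and j: "j \<notin> I"
  shows "\<exists>w d. eigfam A (insert j (insert (\<tau> j) I)) w d \<and> trfam \<epsilon> \<tau> (insert j (insert (\<tau> j) I)) w"
proof -
  have e: "real_orth \<epsilon>" and tt: "\<forall>i. \<tau> (\<tau> i) = i"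
    using comp by (auto simp: compatible_def)
  obtain v a where v: "cdot v v = 1" "A *v v = a *s v" "\<forall>i\<in>I. cdot (w i) v = 0"
    by (rule eigfam_extend [OF A(1) wd(1)]) (use j in auto)
  note Tv = trev_eigenvector [OF e A v(2)] trfam_orthogonal [OF e tt wd(2) v(3)]
  have tj: "\<tau> j \<notin> I" using j wd(2) tt unfolding trfam_def by metis
  have tI: "\<tau> i \<noteq> j" if "i \<in> I" for i using that j wd(2) by (auto simp: trfam_def)
  have tI': "\<tau> i \<noteq> \<tau> j" if "i \<in> I" for i using that j tt by metis
  consider "transpose \<epsilon> ** transpose \<epsilon> = mat 1" "\<tau> = id"
    | "transpose \<epsilon> ** transpose \<epsilon> = - mat 1" "\<tau> j \<noteq> j"
    using comp by (auto simp: compatible_def)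
  then show ?thesis
  proof cases
    case 1
    have "\<exists>u. u \<noteq> 0 \<and> A *v u = a *s u \<and> (\<forall>i\<in>I. cdot (w i) u = 0) \<and> trev \<epsilon> u = u"
    proof (cases "v + trev \<epsilon> v = 0")
      case False
      then show ?thesis
        using v Tv 1 by (intro exI [of _ "v + trev \<epsilon> v"])
          (auto simp: cdot_add_right matrix_vector_right_distrib vector_add_ldistrib trev_add
            trev_trev [OF e] add.commute)
    next
      case True
      then have "trev \<epsilon> v = - v" by (simp add: eq_neg_iff_add_eq_0 add.commute)
      then have "trev \<epsilon> (\<i> *s v) = \<i> *s v" by (simp add: trev_scale vec_eq_iff)
      moreover have "v \<noteq> 0" using v(1) by auto
      ultimately show ?thesis
        using v by (intro exI [of _ "\<i> *s v"])
          (auto simp: cdot_scale_right vec.scale vector_smult_assoc mult.commute)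
    qed
    then obtain u where u: "u \<noteq> 0" "A *v u = a *s u" "\<forall>i\<in>I. cdot (w i) u = 0" "trev \<epsilon> u = u" by blast
    define u' where "u' = complex_of_real (1 / norm u) *s u"
    have u': "cdot u' u' = 1" "A *v u' = a *s u'" "\<forall>i\<in>I. cdot (w i) u' = 0" "trev \<epsilon> u' = u'"
      unfolding u'_def using u exists_unit_multiple [OF u(1)]
      by (simp_all only: vec.scale vector_smult_assoc cdot_scale_right trev_scale complex_cnj_complex_of_real)
        (simp_all add: mult.commute)
    have "eigfam A (insert j I) (w(j := u')) (d(j := a))"
      by (rule eigfam_insert [OF wd(1) j u'(2,1,3)])
    moreover have "trfam \<epsilon> \<tau> (insert j I) (w(j := u'))"
      using wd(2) u'(4) j unfolding trfam_def 1 by (auto intro: exI [of _ 1])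
    ultimately show ?thesis using 1(2) by (auto simp: insert_absorb)
  next
    case 2
    let ?Tv = "trev \<epsilon> v"
    have tjj: "\<tau> j \<noteq> j" by (rule 2)
    have TT: "trev \<epsilon> ?Tv = - v"
      by (simp add: trev_trev [OF e] 2 minus_mat_1_mult)
    have "cdot ?Tv (trev \<epsilon> ?Tv) = cdot ?Tv v" by (rule cdot_trev [OF e])
    moreover have "cdot ?Tv (- v) = - cdot ?Tv v" by (simp add: cdot_def sum_negf)
    ultimately have orth: "cdot ?Tv v = 0" by (simp add: TT)
    then have orth': "cdot v ?Tv = 0" by (metis cdot_cnj complex_cnj_zero)
    let ?w = "(w(j := v))(\<tau> j := ?Tv)"
    have "eigfam A (insert (\<tau> j) (insert j I)) ?w ((d(j := a))(\<tau> j := a))"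
    proof (rule eigfam_insert [OF eigfam_insert [OF wd(1) j v(2,1,3)]])
      show "\<tau> j \<notin> insert j I" using 2 tj by auto
      show "cdot ?Tv ?Tv = 1" using cdot_trev [OF e] v(1) by simp
      show "\<forall>i\<in>insert j I. cdot ((w(j := v)) i) ?Tv = 0" using Tv(2) orth' j by auto
    qed (rule Tv)
    moreover have "trfam \<epsilon> \<tau> (insert (\<tau> j) (insert j I)) ?w"
      unfolding trfam_def
    proof
      fix i assume "i \<in> insert (\<tau> j) (insert j I)"
      then consider "i = \<tau> j" | "i = j" | "i \<in> I" "i \<noteq> j" "i \<noteq> \<tau> j" using j tj by auto
      then show "\<tau> i \<in> insert (\<tau> j) (insert j I) \<and> (\<exists>c. norm c = 1 \<and> trev \<epsilon> (?w i) = c *s ?w (\<tau> i))"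
      proof cases
        case 1
        have "trev \<epsilon> ?Tv = (-1) *s v" by (simp add: TT vec_eq_iff)
        moreover have "cmod (-1) = 1" by simp
        ultimately show ?thesis using 1 tjj tt by fastforce
      next
        case 2
        then show ?thesis using tjj by (auto intro: exI [of _ 1])
      next
        case 3
        then show ?thesis using wd(2) tI tI' unfolding trfam_def by fastforce
      qed
    qed
    ultimately show ?thesis by (metis insert_commute)
  qed
qed

text \<open>In this frame \<open>twist\<close> relabels an arbitrary family of values by \<tau>, not
  only the eigenvalues of \<open>A\<close>. The phases of a logarithm can therefore be chosen
  afterwards, orbit by orbit of \<tau>.\<close>

theorem spectral_kramers:
  fixes A :: "'n::finite cmat"
  assumes comp: "compatible \<epsilon> \<tau>" and A: "normal_mat A" "twist \<epsilon> A = A"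
  obtains W d where "unitary W" "A = udiag W d" "\<And>x. twist \<epsilon> (udiag W x) = udiag W (x \<circ> \<tau>)"
    "d \<circ> \<tau> = d"
proof -
  have e: "real_orth \<epsilon>" and tt: "\<forall>i. \<tau> (\<tau> i) = i"
    using comp by (auto simp: compatible_def)
  \<comment> \<open>Indices enter together with their partners, so the family that absorbs
    \<open>J\<close> may be indexed by a larger set.\<close>
  have "\<exists>I w d. J \<subseteq> I \<and> eigfam A I w d \<and> trfam \<epsilon> \<tau> I w" if "finite J" for J
    using that
  proof induction
    case empty
    have "eigfam A {} w d" "trfam \<epsilon> \<tau> {} w" for w d
      by (simp_all add: eigfam_def trfam_def)
    then show ?case by blast
  next
    case (insert j J)
    then obtain I w d where I: "J \<subseteq> I" "eigfam A I w d" "trfam \<epsilon> \<tau> I w" by blast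
    show ?case
    proof (cases "j \<in> I")
      case True
      then show ?thesis using I by blast
    next
      case False
      from trfam_extend [OF comp A I(2,3) False] obtain w' d' where
        "eigfam A (insert j (insert (\<tau> j) I)) w' d'" "trfam \<epsilon> \<tau> (insert j (insert (\<tau> j) I)) w'"
        by (elim exE conjE)
      moreover have "insert j J \<subseteq> insert j (insert (\<tau> j) I)" using I(1) by auto
      ultimately show ?thesis by (intro exI conjI)
    qed
  qed
  from this [of UNIV] obtain I w d where I: "UNIV \<subseteq> I" "eigfam A I w d" "trfam \<epsilon> \<tau> I w"
    by (elim exE conjE impE meta_impE) auto
  then have wd: "eigfam A UNIV w d" "trfam \<epsilon> \<tau> UNIV w"
    by (simp_all add: top.extremum_unique)
  define W where "W = (\<chi> a j. w j $ a)"
  have W: "unitary W" "A = udiag W d" using eigfam_UNIV [OF wd(1)] by (simp_all add: W_def)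
  have tw: "twist \<epsilon> (udiag W x) = udiag W (x \<circ> \<tau>)" for x
  proof -
    have "transpose \<epsilon> ** cnjm W = (\<chi> a j. trev \<epsilon> (w j) $ a)"
      by (simp add: vec_eq_iff matrix_matrix_mult_def trev_def matrix_vector_mult_def cnjm_def W_def)
    then have "twist \<epsilon> (udiag W x) = udiag (\<chi> a j. trev \<epsilon> (w j) $ a) x"
      by (simp add: twist_udiag [OF e])
    also have "\<dots> = udiag W (x \<circ> \<tau>)"
    proof -
      have "trev \<epsilon> (w j) $ a * x j * cnj (trev \<epsilon> (w j) $ b) = w (\<tau> j) $ a * x j * cnj (w (\<tau> j) $ b)" for a b j
      proof -
        obtain c where c: "norm c = 1" "trev \<epsilon> (w j) = c *s w (\<tau> j)"
          using wd(2) by (auto simp: trfam_def)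
        \<comment> \<open>The phase in the time-reversed frame vector meets its conjugate and
          disappears.\<close>
        have "c * cnj c = 1" using c(1) by (metis complex_norm_square of_real_1 one_power2)
        moreover have "(c * p) * x j * cnj (c * q) = (c * cnj c) * (p * x j * cnj q)" for p q
          by simp
        ultimately show ?thesis unfolding c(2) vector_smult_component by (simp only: mult_1)
      qed
      then have "udiag (\<chi> a j. trev \<epsilon> (w j) $ a) x $ a $ b = (\<Sum>j\<in>UNIV. w (\<tau> j) $ a * x j * cnj (w (\<tau> j) $ b))" for a b
        unfolding udiag_entry by (simp only: vec_lambda_beta)
      also have "(\<Sum>j\<in>UNIV. w (\<tau> j) $ a * x j * cnj (w (\<tau> j) $ b)) = (\<Sum>j\<in>UNIV. w j $ a * x (\<tau> j) * cnj (w j $ b))" for a b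
        by (rule sum.reindex_bij_witness [of _ \<tau> \<tau>]) (use tt in auto)
      finally show ?thesis by (simp add: vec_eq_iff udiag_entry W_def)
    qed
    finally show ?thesis .
  qed
  have "udiag W (d \<circ> \<tau>) = udiag W d" using tw [of d] A(2) W by simp
  then have "d \<circ> \<tau> = d" using udiag_inj [OF W(1)] by blast
  with W tw that show ?thesis by blast
qed

section \<open>Logarithms with a gap\<close>

lemma cis_eq_cis: "cis a = cis b \<longleftrightarrow> (\<exists>n::int. a = b + 2 * pi * n)"
  unfolding cis_conv_exp exp_eq by (auto simp: complex_eq_iff algebra_simps intro!: exI)

lemma cis_eq_imp_eq:
  assumes "cis a = cis b" "\<bar>a - b\<bar> < 2 * pi"
  shows "a = b"
proof -
  obtain n::int where n: "a = b + 2 * pi * n" using assms(1) cis_eq_cis by blast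
  then have "2 * pi * \<bar>real_of_int n\<bar> < 2 * pi * 1"
    using assms(2) by (simp add: abs_mult)
  then have "\<bar>real_of_int n\<bar> < 1" by (rule mult_left_less_imp_less) simp
  then have "n = 0" by linarith
  with n show ?thesis by simp
qed

text \<open>A relation, since frames are not unique. The diameter bound is not strict, so that the
  condition is closed; strictness is kept apart in \<open>gapped\<close>.\<close>

definition logframe :: "'n::finite cmat \<Rightarrow> real \<Rightarrow> ('n cmat \<times> (real ^ 'n)) set" where
  "logframe A \<psi> = {(W, \<theta>). unitary W \<and> A = udiag W (\<lambda>j. cis (\<theta> $ j)) \<and>
     (\<Sum>j\<in>UNIV. \<theta> $ j) = \<psi> \<and> (\<forall>i j. \<theta> $ i - \<theta> $ j \<le> 2 * pi)}"

definition gapped :: "'n::finite cmat \<Rightarrow> real \<Rightarrow> bool" where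
  "gapped A \<psi> \<longleftrightarrow> (\<exists>(W, \<theta>) \<in> logframe A \<psi>. \<forall>i j. \<theta> $ i - \<theta> $ j < 2 * pi)"

definition hmat :: "'n::finite cmat \<times> (real ^ 'n) \<Rightarrow> 'n cmat" where
  "hmat p = udiag (fst p) (\<lambda>j. of_real (snd p $ j))"

lemma hmat_eqI:
  assumes W: "unitary W" "unitary V" and eq: "udiag W (\<lambda>j. cis (\<theta> $ j)) = udiag V (\<lambda>j. cis (\<phi> $ j))"
    and near: "\<And>i j. \<bar>\<theta> $ i - \<phi> $ j\<bar> < 2 * pi"
  shows "hmat (W, \<theta>) = hmat (V, \<phi>)"
proof -
  have "of_real (\<theta> $ i) * (cadj W ** V) $ i $ j = (cadj W ** V) $ i $ j * complex_of_real (\<phi> $ j)" for i j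
  proof (cases "(cadj W ** V) $ i $ j = 0")
    case False
    then have "cis (\<theta> $ i) = cis (\<phi> $ j)"
      using eq unfolding udiag_eq_iff [OF W] by (metis mult.commute mult_cancel_left)
    then have "\<theta> $ i = \<phi> $ j" using near by (rule cis_eq_imp_eq)
    then show ?thesis by simp
  qed simp
  then show ?thesis
    unfolding hmat_def fst_conv snd_conv udiag_eq_iff [OF W] by blast
qed

text \<open>Matched phases differ by 2 pi n_i with integers n_i of sum zero. Were they not all zero,
  one would be at least 1 and another at most -1, and the corresponding phases in \<phi> would be
  more than 4 pi - 2 pi apart.\<close>

lemma logframe_unique_aux:
  assumes p: "(W, \<theta>) \<in> logframe A \<psi>" and strict: "\<forall>i j. \<theta> $ i - \<theta> $ j < 2 * pi"
    and q: "(V, \<phi>) \<in> logframe A \<psi>"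
  shows "hmat (V, \<phi>) = hmat (W, \<theta>)"
proof -
  have W: "unitary W" "unitary V" and eq: "udiag W (\<lambda>j. cis (\<theta> $ j)) = udiag V (\<lambda>j. cis (\<phi> $ j))"
    using p q by (auto simp: logframe_def)
  obtain \<pi> where \<pi>: "\<pi> permutes UNIV" "\<And>i. cis (\<theta> $ i) = cis (\<phi> $ \<pi> i)"
    using udiag_matching [OF W eq] by auto
  then have "\<forall>i. \<exists>n::int. \<phi> $ \<pi> i = \<theta> $ i + 2 * pi * n"
    by (metis cis_eq_cis)
  then obtain n :: "'a \<Rightarrow> int" where n: "\<And>i. \<phi> $ \<pi> i = \<theta> $ i + 2 * pi * n i" by metis
  have "(\<Sum>i\<in>UNIV. \<phi> $ \<pi> i) = (\<Sum>i\<in>UNIV. \<phi> $ i)"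
    using sum.permute [OF \<pi>(1), of "\<lambda>i. \<phi> $ i"] by (simp add: o_def)
  also have "\<dots> = (\<Sum>i\<in>UNIV. \<theta> $ i)" using p q by (simp add: logframe_def)
  finally have "2 * pi * (\<Sum>i\<in>UNIV. real_of_int (n i)) = 0"
    by (simp add: n sum.distrib sum_distrib_left)
  then have "(\<Sum>i\<in>UNIV. real_of_int (n i)) = 0" by simp
  then have sum0: "(\<Sum>i\<in>UNIV. n i) = 0" by (metis of_int_eq_0_iff of_int_sum)
  have le: "\<not> (n i \<ge> 1 \<and> n l \<le> - 1)" for i l
  proof
    assume "n i \<ge> 1 \<and> n l \<le> - 1"
    then have "real_of_int (n i) - real_of_int (n l) \<ge> 2" by linarith
    then have "2 * pi * 2 \<le> 2 * pi * (real_of_int (n i) - real_of_int (n l))"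
      by (intro mult_left_mono) auto
    moreover have "\<phi> $ \<pi> i - \<phi> $ \<pi> l \<le> 2 * pi" using q by (auto simp: logframe_def)
    moreover have "\<theta> $ l - \<theta> $ i < 2 * pi" using strict by blast
    ultimately show False unfolding n by (simp add: algebra_simps)
  qed
  have n0: "n i = 0" for i
  proof (rule ccontr)
    assume "n i \<noteq> 0"
    then consider "n i \<ge> 1" | "n i \<le> -1" by linarith
    then show False
    proof cases
      case 1
      have "n l \<ge> 0" for l using le [of i l] 1 by linarith
      then show False using sum0 1 by (simp add: sum_nonneg_eq_0_iff)
    next
      case 2
      have "- n l \<ge> 0" for l using le [of l i] 2 by linarith
      moreover have "(\<Sum>i\<in>UNIV. - n i) = 0" using sum0 by (simp add: sum_negf)
      ultimately have "- n i = 0" by (subst (asm) sum_nonneg_eq_0_iff) auto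
      then show False using 2 by simp
    qed
  qed
  then have \<phi>: "\<phi> $ \<pi> i = \<theta> $ i" for i using n by simp
  have "\<bar>\<theta> $ i - \<phi> $ j\<bar> < 2 * pi" for i j
  proof -
    obtain i' where "j = \<pi> i'" using \<pi>(1) by (metis permutes_def)
    then show ?thesis using strict by (simp add: \<phi> abs_less_iff)
  qed
  then show ?thesis by (rule hmat_eqI [OF W eq, symmetric])
qed

lemma logframe_unique:
  assumes "gapped A \<psi>" "p \<in> logframe A \<psi>" "q \<in> logframe A \<psi>"
  shows "hmat p = hmat q"
proof -
  obtain W \<theta> where r: "(W, \<theta>) \<in> logframe A \<psi>" "\<forall>i j. \<theta> $ i - \<theta> $ j < 2 * pi"
    using assms(1) by (auto simp: gapped_def)
  show ?thesis
    using logframe_unique_aux [OF r, of "fst p" "snd p"] logframe_unique_aux [OF r, of "fst q" "snd q"]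
      assms(2,3) by simp
qed

text \<open>The phases have mean \<psi>/m, with m the size of the matrix, and each lies within 2 pi
  of the mean. The bound confines frames to a compact set.\<close>

lemma logframe_bound:
  assumes "(W, \<theta>) \<in> logframe A \<psi>"
  shows "\<bar>\<theta> $ j\<bar> \<le> \<bar>\<psi>\<bar> + 2 * pi"
proof -
  let ?m = "real CARD('a)"
  have d: "\<theta> $ i - \<theta> $ j \<le> 2 * pi" for i j using assms by (auto simp: logframe_def)
  have s: "(\<Sum>i\<in>UNIV. \<theta> $ i) = \<psi>" using assms by (auto simp: logframe_def)
  have "(\<Sum>i\<in>(UNIV::'a set). \<theta> $ j - \<theta> $ i) \<le> (\<Sum>i\<in>(UNIV::'a set). 2 * pi)" by (intro sum_mono d)
  then have 1: "?m * \<theta> $ j \<le> \<psi> + ?m * (2 * pi)" by (simp add: sum_subtractf s)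
  have "(\<Sum>i\<in>(UNIV::'a set). \<theta> $ i - \<theta> $ j) \<le> (\<Sum>i\<in>(UNIV::'a set). 2 * pi)" by (intro sum_mono d)
  then have 2: "\<psi> - ?m * (2 * pi) \<le> ?m * \<theta> $ j" by (simp add: sum_subtractf s)
  have m: "1 \<le> ?m" by (simp add: Suc_leI)
  have "\<bar>\<psi>\<bar> \<le> ?m * \<bar>\<psi>\<bar>" using mult_right_mono [OF m, of "\<bar>\<psi>\<bar>"] by simp
  then have "?m * \<theta> $ j \<le> ?m * (\<bar>\<psi>\<bar> + 2 * pi)" "?m * (- (\<bar>\<psi>\<bar> + 2 * pi)) \<le> ?m * \<theta> $ j"
    using 1 2 by (simp_all add: algebra_simps)
  then have "\<theta> $ j \<le> \<bar>\<psi>\<bar> + 2 * pi" "- (\<bar>\<psi>\<bar> + 2 * pi) \<le> \<theta> $ j"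
    using m by (auto dest: mult_left_le_imp_le)
  then show ?thesis by linarith
qed

text \<open>Adding 2 pi to a smallest phase keeps the diameter at most 2 pi and raises the sum by 2
  pi. Negative \<open>n\<close> is reduced to this by changing the sign of all phases.\<close>

lemma shift_phases:
  fixes \<theta> :: "'i \<Rightarrow> real"
  assumes J: "finite J" "J \<noteq> {}" and diam: "\<forall>i\<in>J. \<forall>j\<in>J. \<theta> i - \<theta> j \<le> 2 * pi"
  shows "\<exists>\<theta>'. (\<forall>i\<in>J. cis (\<theta>' i) = cis (\<theta> i)) \<and> sum \<theta>' J = sum \<theta> J + 2 * pi * of_int n
    \<and> (\<forall>i\<in>J. \<forall>j\<in>J. \<theta>' i - \<theta>' j \<le> 2 * pi)"
proof -
  have up: "\<exists>\<theta>'. (\<forall>i\<in>J. cis (\<theta>' i) = cis (\<theta> i)) \<and> sum \<theta>' J = sum \<theta> J + 2 * pi * real n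
    \<and> (\<forall>i\<in>J. \<forall>j\<in>J. \<theta>' i - \<theta>' j \<le> 2 * pi)"
    if "\<forall>i\<in>J. \<forall>j\<in>J. \<theta> i - \<theta> j \<le> 2 * pi" for n and \<theta> :: "'i \<Rightarrow> real"
  proof (induction n)
    case 0
    show ?case using that by auto
  next
    case (Suc n)
    then obtain \<phi> where \<phi>: "\<forall>i\<in>J. cis (\<phi> i) = cis (\<theta> i)" "sum \<phi> J = sum \<theta> J + 2 * pi * real n"
      "\<forall>i\<in>J. \<forall>j\<in>J. \<phi> i - \<phi> j \<le> 2 * pi" by blast
    obtain i0 where i0: "i0 \<in> J" "\<forall>i\<in>J. \<phi> i0 \<le> \<phi> i"
      using ex_min_if_finite [of "\<phi> ` J"] J by (auto simp: not_less)
    let ?\<phi> = "\<phi>(i0 := \<phi> i0 + 2 * pi)"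
    have "sum ?\<phi> J = sum \<phi> J + 2 * pi"
      using J i0 by (simp add: sum.remove [of J i0])
    then have "sum ?\<phi> J = sum \<theta> J + 2 * pi * real (Suc n)"
      using \<phi>(2) by (simp add: algebra_simps)
    moreover have "\<forall>i\<in>J. cis (?\<phi> i) = cis (\<theta> i)"
      using \<phi>(1) by (auto simp flip: cis_mult)
    moreover have "\<forall>i\<in>J. \<forall>j\<in>J. ?\<phi> i - ?\<phi> j \<le> 2 * pi"
    proof (intro ballI)
      fix i j assume "i \<in> J" "j \<in> J"
      then have "\<phi> i - \<phi> j \<le> 2 * pi" "\<phi> i0 \<le> \<phi> j" "\<phi> i - \<phi> i0 \<le> 2 * pi"
        using \<phi>(3) i0 by auto
      then show "?\<phi> i - ?\<phi> j \<le> 2 * pi"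
        using pi_gt_zero by (auto intro: order_trans [of _ "2 * pi"])
    qed
    ultimately show ?case by blast
  qed
  show ?thesis
  proof (cases "n \<ge> 0")
    case True
    then show ?thesis using up [OF diam, of "nat n"] by simp
  next
    case False
    have "\<forall>i\<in>J. \<forall>j\<in>J. - \<theta> i - - \<theta> j \<le> 2 * pi" using diam by auto
    from up [OF this, of "nat (- n)"] obtain \<phi> where \<phi>: "\<forall>i\<in>J. cis (\<phi> i) = cis (- \<theta> i)"
      "sum \<phi> J = sum (\<lambda>i. - \<theta> i) J + 2 * pi * real (nat (- n))"
      "\<forall>i\<in>J. \<forall>j\<in>J. \<phi> i - \<phi> j \<le> 2 * pi" by blast
    have "\<forall>i\<in>J. cis (- \<phi> i) = cis (\<theta> i)"
      using \<phi>(1) by (metis cis_cnj minus_minus)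
    moreover have "sum (\<lambda>i. - \<phi> i) J = sum \<theta> J + 2 * pi * of_int n"
      using \<phi>(2) False by (simp add: sum_negf)
    moreover have "\<forall>i\<in>J. \<forall>j\<in>J. - \<phi> i - - \<phi> j \<le> 2 * pi" using \<phi>(3) by auto
    ultimately show ?thesis by (intro exI [of _ "\<lambda>i. - \<phi> i"]) blast
  qed
qed

lemma cis_sum: "cis (sum \<theta> J) = (\<Prod>j\<in>J. cis (\<theta> j))"
  by (induction J rule: infinite_finite_induct) (simp_all flip: cis_mult)

lemma logframe_exists:
  assumes "unitary A" "det A = cis \<psi>"
  shows "logframe A \<psi> \<noteq> {}"
proof -
  obtain W t where W: "unitary W" "A = udiag W (\<lambda>j. cis (t j))" and t: "\<And>j. - pi < t j" "\<And>j. t j \<le> pi"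
    using spectral_unitary [OF assms(1)] by blast
  have "cis (sum t UNIV) = cis \<psi>"
    using assms(2) W by (simp add: cis_sum det_udiag)
  then obtain n :: int where n: "\<psi> = sum t UNIV + 2 * pi * n" by (metis cis_eq_cis)
  have "\<forall>i\<in>UNIV. \<forall>j\<in>UNIV. t i - t j \<le> 2 * pi" using t by (smt (verit))
  from shift_phases [OF _ _ this, of n] obtain \<theta> where \<theta>: "\<And>i. cis (\<theta> i) = cis (t i)"
    "sum \<theta> UNIV = \<psi>" "\<And>i j. \<theta> i - \<theta> j \<le> 2 * pi" using n by auto
  have "(W, \<chi> j. \<theta> j) \<in> logframe A \<psi>"
    using W \<theta> by (simp add: logframe_def)
  then show ?thesis by blast
qed

subsection \<open>Continuity of the gapped logarithm\<close>

lemma continuous_on_cmat: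
  assumes "\<And>i j. continuous_on S (\<lambda>x. A x $ i $ j)"
  shows "continuous_on S (A :: _ \<Rightarrow> 'n::finite cmat)"
proof -
  have "continuous_on S (\<lambda>x. \<chi> i j. A x $ i $ j)"
    by (intro continuous_on_vec_lambda assms)
  then show ?thesis by simp
qed

lemma continuous_on_cmat_mult [continuous_intros]:
  assumes "continuous_on S A" "continuous_on S B"
  shows "continuous_on S (\<lambda>x. A x ** (B x :: 'n::finite cmat))"
  unfolding matrix_matrix_mult_def
  by (intro continuous_on_vec_lambda continuous_intros continuous_on_component assms)

lemma continuous_on_cadj [continuous_intros]:
  assumes "continuous_on S A"
  shows "continuous_on S (\<lambda>x. cadj (A x))"
  unfolding cadj_def
  by (intro continuous_on_vec_lambda continuous_intros continuous_on_component assms)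

lemma continuous_on_udiag:
  assumes "continuous_on S W" "\<And>j. continuous_on S (\<lambda>x. d x j)"
  shows "continuous_on S (\<lambda>x. udiag (W x) (d x))"
  by (rule continuous_on_cmat, unfold udiag_entry)
    (intro continuous_intros continuous_on_component assms)

lemma continuous_on_det:
  assumes "continuous_on S A"
  shows "continuous_on S (\<lambda>x. det (A x :: 'n::finite cmat))"
  unfolding det_def by (intro continuous_intros continuous_on_component assms)

lemma norm_unitary: "unitary (U :: 'n::finite cmat) \<Longrightarrow> norm U = norm (mat 1 :: 'n cmat)"
  using norm_mult_unitary_left [of U "mat 1"] by (simp only: matrix_mul_rid)

lemma compact_unitary: "compact {U :: 'n::finite cmat. unitary U}"
proof (rule compact_eq_bounded_closed [THEN iffD2], rule conjI)
  show "bounded {U :: 'n cmat. unitary U}"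
    by (rule boundedI [of _ "norm (mat 1 :: 'n cmat)"]) (metis mem_Collect_eq norm_unitary order_refl)
  show "closed {U :: 'n cmat. unitary U}"
    unfolding unitary_def
    by (intro closed_Collect_conj closed_Collect_eq continuous_on_cmat_mult continuous_on_cadj
        continuous_on_id continuous_on_const)
qed

definition frames :: "real \<Rightarrow> ('n::finite cmat \<times> (real ^ 'n)) set" where
  "frames B = {U. unitary U} \<times> cbox (\<chi> j. - B) (\<chi> j. B)"

lemma compact_frames: "compact (frames B)"
  unfolding frames_def by (intro compact_Times compact_unitary compact_cbox)

lemma frames_iff: "(W, \<theta>) \<in> frames B \<longleftrightarrow> unitary W \<and> (\<forall>j. \<bar>\<theta> $ j\<bar> \<le> B)"
proof -
  have "\<bar>x\<bar> \<le> B \<longleftrightarrow> - B \<le> x \<and> x \<le> B" for x by linarith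
  then show ?thesis by (simp add: frames_def mem_box_cart)
qed

text \<open>The preimage of a closed set is the projection, along the compact set
  \<open>frames B\<close>, of a closed set of pairs of a frame and a point, hence closed.
  Independence of the frame is \<open>unique\<close> combined with
  \<open>udiag_funcalc\<close>.\<close>

lemma frame_calculus:
  fixes F :: "'a::euclidean_space \<Rightarrow> ('n::finite cmat \<times> (real ^ 'n)) set"
  assumes sub: "\<And>k. F k \<subseteq> frames B" and ne: "\<And>k. F k \<noteq> {}"
    and closed: "closed {(p, k). p \<in> F k}"
    and unique: "\<And>k p q. p \<in> F k \<Longrightarrow> q \<in> F k \<Longrightarrow> hmat p = hmat q"
  shows "\<exists>H :: (real \<Rightarrow> complex) \<Rightarrow> 'a \<Rightarrow> 'n cmat.
    (\<forall>g k W \<theta>. (W, \<theta>) \<in> F k \<longrightarrow> H g k = udiag W (\<lambda>j. g (\<theta> $ j))) \<and>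
    (\<forall>g. continuous_on UNIV g \<longrightarrow> continuous_on UNIV (H g))"
proof -
  define E :: "(real \<Rightarrow> complex) \<Rightarrow> 'n cmat \<times> (real ^ 'n) \<Rightarrow> 'n cmat"
    where "E = (\<lambda>g p. udiag (fst p) (\<lambda>j. g (snd p $ j)))"
  have E: "E g p = E g q" if "p \<in> F k" "q \<in> F k" for g k p q
  proof -
    have "unitary (fst p)" "unitary (fst q)" using subsetD [OF sub that(1)] subsetD [OF sub that(2)] by (auto simp: frames_def)
    from udiag_funcalc [OF this unique [OF that, unfolded hmat_def], of "\<lambda>z. g (Re z)"]
    show ?thesis by (simp add: E_def)
  qed
  \<comment> \<open>An arbitrary, possibly discontinuous choice of frames; \<open>E g\<close> does
    not depend on it.\<close>
  define c where "c = (\<lambda>k. SOME p. p \<in> F k)"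
  have c: "c k \<in> F k" for k
    unfolding c_def by (rule some_in_eq [THEN iffD2, OF ne])
  show ?thesis
  proof (intro exI [of _ "\<lambda>g k. E g (c k)"] conjI allI impI)
    show "E g (c k) = udiag W (\<lambda>j. g (\<theta> $ j))" if "(W, \<theta>) \<in> F k" for g k W \<theta>
      using E [OF c that, of g] by (simp add: E_def)
    fix g :: "real \<Rightarrow> complex" assume g: "continuous_on UNIV g"
    have contE: "continuous_on UNIV (E g)"
      unfolding E_def
      by (intro continuous_on_udiag continuous_intros continuous_on_compose2 [OF g] continuous_on_component) auto
    show "continuous_on UNIV (\<lambda>k. E g (c k))"
    proof (subst continuous_on_closed_vimage, simp, intro allI impI)
      fix C :: "'n cmat set" assume C: "closed C"
      have "(\<lambda>k. E g (c k)) -` C = {k. \<exists>p. p \<in> frames B \<and> (p, k) \<in> {(p, k). p \<in> F k} \<inter> (\<lambda>x. E g (fst x)) -` C}"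
      proof (intro set_eqI iffI)
        fix k assume "k \<in> (\<lambda>k. E g (c k)) -` C"
        then show "k \<in> {k. \<exists>p. p \<in> frames B \<and> (p, k) \<in> {(p, k). p \<in> F k} \<inter> (\<lambda>x. E g (fst x)) -` C}"
          using c [of k] sub [of k] by (intro CollectI exI [of _ "c k"]) auto
      next
        fix k assume "k \<in> {k. \<exists>p. p \<in> frames B \<and> (p, k) \<in> {(p, k). p \<in> F k} \<inter> (\<lambda>x. E g (fst x)) -` C}"
        then obtain p where "p \<in> F k" "E g p \<in> C" by auto
        then show "k \<in> (\<lambda>k. E g (c k)) -` C" using E [OF c, of p k g] by simp
      qed
      moreover have "closed ((\<lambda>x :: ('n cmat \<times> (real ^ 'n)) \<times> 'a. E g (fst x)) -` C)"
        by (intro closed_vimage C continuous_on_compose2 [OF contE] continuous_intros) auto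
      ultimately show "closed ((\<lambda>k. E g (c k)) -` C \<inter> UNIV)"
        by (simp only: Int_UNIV_right closed_compact_projection [OF compact_frames closed_Int [OF closed]])
    qed
  qed
qed

lemma closed_unitary_frame:
  fixes A :: "'a::euclidean_space \<Rightarrow> 'n::finite cmat"
  assumes "continuous_on UNIV A"
  shows "closed {((W, \<theta> :: real ^ 'n), k). unitary W \<and> A k = udiag W (\<lambda>j. cis (\<theta> $ j))}"
proof -
  have cis: "continuous_on UNIV cis"
    unfolding cis_conv_exp by (intro continuous_intros)
  have "closed {x :: ('n cmat \<times> (real ^ 'n)) \<times> 'a. fst (fst x) \<in> {U. unitary U}}"
    using closed_vimage [OF compact_imp_closed [OF compact_unitary],
        of "\<lambda>x :: ('n cmat \<times> (real ^ 'n)) \<times> 'a. fst (fst x)"]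
    by (simp add: vimage_def continuous_on_fst)
  moreover have "closed {x :: ('n cmat \<times> (real ^ 'n)) \<times> 'a.
    A (snd x) = udiag (fst (fst x)) (\<lambda>j. cis (snd (fst x) $ j))}"
    by (intro closed_Collect_eq continuous_on_compose2 [OF assms] continuous_on_udiag
        continuous_on_compose2 [OF cis] continuous_on_component
        continuous_on_fst continuous_on_snd continuous_on_id) auto
  ultimately have "closed {x :: ('n cmat \<times> (real ^ 'n)) \<times> 'a. fst (fst x) \<in> {U. unitary U} \<and>
    A (snd x) = udiag (fst (fst x)) (\<lambda>j. cis (snd (fst x) $ j))}"
    by (rule closed_Collect_conj)
  then show ?thesis by (simp add: case_prod_unfold)
qed

lemma closed_logframe:
  fixes A :: "'a::euclidean_space \<Rightarrow> 'n::finite cmat"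
  assumes "continuous_on UNIV A" "continuous_on UNIV \<psi>"
  shows "closed {(p, k). p \<in> logframe (A k) (\<psi> k)}"
proof -
  have eq: "{(p, k). p \<in> logframe (A k) (\<psi> k)} =
     {((W, \<theta> :: real ^ 'n), k). unitary W \<and> A k = udiag W (\<lambda>j. cis (\<theta> $ j))} \<inter>
     {x. (\<Sum>j\<in>UNIV. snd (fst x) $ j) = \<psi> (snd x) \<and> (\<forall>i j. snd (fst x) $ i - snd (fst x) $ j \<le> 2 * pi)}"
    by (auto simp: logframe_def)
  show ?thesis
    unfolding eq
  proof (intro closed_Int closed_unitary_frame assms closed_Collect_conj closed_Collect_all)
    show "closed {x :: ('n cmat \<times> (real ^ 'n)) \<times> 'a. (\<Sum>j\<in>UNIV. snd (fst x) $ j) = \<psi> (snd x)}"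
      by (intro closed_Collect_eq continuous_on_compose2 [OF assms(2)] continuous_on_sum
          continuous_on_component continuous_on_fst continuous_on_snd continuous_on_id) auto
    show "closed {x :: ('n cmat \<times> (real ^ 'n)) \<times> 'a. snd (fst x) $ i - snd (fst x) $ j \<le> 2 * pi}" for i j
      by (intro closed_Collect_le continuous_on_diff continuous_on_const
          continuous_on_component continuous_on_fst continuous_on_snd continuous_on_id)
  qed
qed

section \<open>From gapped approximations to two-step logarithms\<close>

lemma periodic2D: "periodic2 f \<Longrightarrow> (\<And>i. z $ i \<in> \<int>) \<Longrightarrow> f (k + z) = f k"
  unfolding periodic2_def by blast

lemma periodic2_bounded:
  fixes f :: "real^2 \<Rightarrow> real"
  assumes "periodic2 f" "continuous_on UNIV f"
  obtains B where "\<And>k. \<bar>f k\<bar> \<le> B"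
proof -
  have "compact (f ` cbox 0 1)"
    by (intro compact_continuous_image continuous_on_subset [OF assms(2)]) auto
  then obtain B where B: "\<And>x. x \<in> cbox 0 1 \<Longrightarrow> \<bar>f x\<bar> \<le> B"
    using compact_imp_bounded bounded_iff by (metis image_eqI real_norm_def)
  have "\<bar>f k\<bar> \<le> B" for k
  proof -
    define z :: "real^2" where "z = (\<chi> i. - of_int \<lfloor>k $ i\<rfloor>)"
    have "f (k + z) = f k" by (rule periodic2D [OF assms(1)]) (simp add: z_def)
    moreover have "k + z \<in> cbox 0 1"
      by (auto simp: mem_box_cart z_def) linarith
    ultimately show ?thesis using B by metis
  qed
  with that show ?thesis by blast
qed

text \<open>A distance below 1 from the point 1 forces a positive real part. The bound pi/2 is
  comfortable: two such phases differ by at most pi, well below the 2 pi needed for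
  uniqueness.\<close>

lemma phase_small:
  assumes "norm (cis t - 1) < 1" "- pi < t" "t \<le> pi"
  shows "\<bar>t\<bar> \<le> pi / 2"
proof (rule ccontr)
  assume "\<not> \<bar>t\<bar> \<le> pi / 2"
  then have "cos \<bar>t\<bar> \<le> cos (pi / 2)"
    using assms by (intro cos_monotone_0_pi_le) auto
  then have "cos t \<le> 0" by simp
  moreover have "\<bar>Re (cis t - 1)\<bar> \<le> norm (cis t - 1)" by (rule abs_Re_le_cmod)
  ultimately show False using assms(1) by simp
qed

lemma twist_frame_H:
  assumes e: "real_orth \<epsilon>"
    and H: "\<And>g k W \<theta>. (W, \<theta>) \<in> F k \<Longrightarrow> H g k = udiag W (\<lambda>j. g (\<theta> $ j))"
    and ne: "\<And>k. F k \<noteq> {}" 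
    and tw: "\<And>k W \<theta>. (W, \<theta>) \<in> F (- k) \<Longrightarrow> (transpose \<epsilon> ** cnjm W, \<theta>) \<in> F k"
  shows "H g k = twist \<epsilon> (H g (- k))"
proof -
  obtain W \<theta> where p: "(W, \<theta>) \<in> F (- k)" using ne [of "- k"] by fastforce
  show ?thesis
    using H [OF p, of g] H [OF tw [OF p], of g] by (simp add: twist_udiag [OF e])
qed

text \<open>With E = exp (i h2 / 2) and E E = \<beta>, the middle factor is the product of \<alpha>
  with the inverse of E on either side. Unitary invariance of the norm makes it as close to the
  identity as \<alpha> is to \<beta>, and h1 is its principal logarithm. Both logarithms are
  obtained by functional calculus, so they inherit every symmetry shared by \<alpha>, \<beta> and
  \<psi>.\<close>

proposition two_step_assembly:
  fixes \<alpha> \<beta> :: "real^2 \<Rightarrow> 'n::finite cmat"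
  assumes cont: "continuous_on UNIV \<alpha>" "continuous_on UNIV \<beta>" "continuous_on UNIV \<psi>"
    and per: "periodic2 \<alpha>" "periodic2 \<beta>" "periodic2 \<psi>"
    and unit: "\<And>k. unitary (\<alpha> k)"
    and gap: "\<And>k. gapped (\<beta> k) (\<psi> k)"
    and close: "\<And>k. norm (\<alpha> k - \<beta> k) < 1"
  obtains h1 h2 where "two_step_log \<alpha> h1 h2"
    "\<And>\<epsilon>. real_orth \<epsilon> \<Longrightarrow> matching_rel \<epsilon> \<alpha> \<Longrightarrow> matching_rel \<epsilon> \<beta> \<Longrightarrow> (\<And>k. \<psi> (- k) = \<psi> k) \<Longrightarrow>
       matching_rel \<epsilon> h1 \<and> matching_rel \<epsilon> h2"
proof -
  obtain b where b: "\<And>k. \<bar>\<psi> k\<bar> \<le> b" using periodic2_bounded [OF per(3) cont(3)] by blast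
  define F where "F = (\<lambda>k. logframe (\<beta> k) (\<psi> k))"
  have Fu: "unitary W" "\<beta> k = udiag W (\<lambda>j. cis (\<theta> $ j))" if "(W, \<theta>) \<in> F k" for k W \<theta>
    using that by (auto simp: F_def logframe_def)
  have Fne: "F k \<noteq> {}" for k using gap [of k] by (auto simp: gapped_def F_def)
  have sub: "F k \<subseteq> frames (b + 2 * pi)" for k
  proof
    fix p assume p: "p \<in> F k"
    obtain W \<theta> where [simp]: "p = (W, \<theta>)" by (cases p)
    have "\<bar>\<theta> $ j\<bar> \<le> b + 2 * pi" for j
      using logframe_bound [of W \<theta> "\<beta> k" "\<psi> k" j] p b [of k] by (simp add: F_def)
    then show "p \<in> frames (b + 2 * pi)" using p Fu by (simp add: frames_iff)
  qed
  have clo: "closed {(p, k). p \<in> F k}"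
    unfolding F_def by (rule closed_logframe [OF cont(2,3)])
  have uni: "hmat p = hmat q" if "p \<in> F k" "q \<in> F k" for k p q
    using that unfolding F_def by (rule logframe_unique [OF gap])
  obtain H where "(\<forall>g k W \<theta>. (W, \<theta>) \<in> F k \<longrightarrow> H g k = udiag W (\<lambda>j. g (\<theta> $ j))) \<and>
    (\<forall>g. continuous_on UNIV g \<longrightarrow> continuous_on UNIV (H g))"
    by (rule exE [OF frame_calculus [OF sub Fne clo uni]])
  note this [THEN conjunct1, rule_format] this [THEN conjunct2, rule_format]
  note H = this(1) and contH = this(2)
  have perH: "periodic2 (H g)" for g
    unfolding periodic2_def
  proof (intro allI impI)
    fix k z :: "real^2" assume z: "\<forall>i. z $ i \<in> \<int>"
    then have "F (k + z) = F k" using per by (simp add: F_def periodic2D)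
    moreover obtain W \<theta> where "(W, \<theta>) \<in> F k" using Fne [of k] by fastforce
    ultimately show "H g (k + z) = H g k" using H by metis
  qed
  define h2 where "h2 = H of_real"
  define Em where "Em = H (\<lambda>x. cis (- (x / 2)))"
  define Ep where "Ep = H (\<lambda>x. cis (x / 2))"
  have fr: "unitary (Em k) \<and> Em k ** \<beta> k ** Em k = mat 1 \<and> Ep k ** Em k = mat 1 \<and> Em k ** Ep k = mat 1 \<and>
    selfadj (h2 k) \<and> mexp (cscale (\<i>/2) (h2 k)) = Ep k" for k
  proof -
    obtain W \<theta> where p: "(W, \<theta>) \<in> F k" using Fne [of k] by fastforce
    note W = Fu(1) [OF p]
    have "mexp (cscale (\<i>/2) (h2 k)) = Ep k"
      unfolding h2_def Ep_def H [OF p] mexp_cscale_udiag [OF W] by (simp add: cis_conv_exp)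
    then show ?thesis
      unfolding h2_def Em_def Ep_def H [OF p] Fu(2) [OF p]
      using W by (simp add: unitary_udiag udiag_mult cis_mult selfadj_udiag)
  qed
  define B where "B = (\<lambda>k. Em k ** \<alpha> k ** Em k)"
  have cis: "continuous_on UNIV cis"
    unfolding cis_conv_exp by (intro continuous_intros)
  have contB: "continuous_on UNIV B"
    unfolding B_def Em_def
    by (intro continuous_on_cmat_mult cont contH continuous_on_compose2 [OF cis] continuous_intros) auto
  have unitB: "unitary (B k)" for k
    unfolding B_def using fr unit by (intro unitary_mult) auto
  have smallB: "norm (B k - mat 1) < 1" for k
  proof -
    have "B k - mat 1 = Em k ** \<alpha> k ** Em k - Em k ** \<beta> k ** Em k"
      using fr by (simp add: B_def)
    also have "\<dots> = Em k ** (\<alpha> k - \<beta> k) ** Em k"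
      by (simp add: matrix_matrix_mult_def vec_eq_iff sum_subtractf algebra_simps)
    finally show ?thesis
      using fr close by (simp add: norm_mult_unitary_left norm_mult_unitary_right)
  qed
  have perB: "periodic2 B"
    using per(1) perH unfolding B_def Em_def periodic2_def by metis
  define G where "G = (\<lambda>k. {(W, \<theta>). unitary W \<and> B k = udiag W (\<lambda>j. cis (\<theta> $ j)) \<and> (\<forall>j. \<bar>\<theta> $ j\<bar> \<le> pi / 2)})"
  have Gsub: "G k \<subseteq> frames (pi / 2)" for k
    by (auto simp: G_def frames_iff)
  have Gne: "G k \<noteq> {}" for k
  proof -
    obtain W t where W: "unitary W" "B k = udiag W (\<lambda>j. cis (t j))" and t: "\<And>j. - pi < t j" "\<And>j. t j \<le> pi"
      using spectral_unitary [OF unitB, of k] by blast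
    have "\<bar>t j\<bar> \<le> pi / 2" for j
    proof (rule phase_small)
      have "B k - mat 1 = udiag W (\<lambda>j. cis (t j) - 1)"
        using W udiag_diff [of W "\<lambda>j. cis (t j)" "\<lambda>_. 1"] by simp
      then have "norm (cis (t j) - 1) \<le> norm (B k - mat 1)"
        using norm_udiag_entry_le [OF W(1), of "\<lambda>j. cis (t j) - 1" j] by simp
      then show "norm (cis (t j) - 1) < 1" using smallB [of k] by simp
    qed (rule t)+
    then have "(W, \<chi> j. t j) \<in> G k"
      using W by (simp add: G_def)
    then show ?thesis by blast
  qed
  have Gclo: "closed {(p, k). p \<in> G k}"
  proof -
    have eq: "{(p, k). p \<in> G k} =
      {((W, \<theta> :: real ^ 'n), k). unitary W \<and> B k = udiag W (\<lambda>j. cis (\<theta> $ j))} \<inter>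
      {x. \<forall>j. \<bar>snd (fst x) $ j\<bar> \<le> pi / 2}"
      by (auto simp: G_def)
    show ?thesis
      unfolding eq
      by (intro closed_Int closed_unitary_frame contB closed_Collect_all closed_Collect_le continuous_on_rabs
          continuous_on_const continuous_on_component continuous_on_fst continuous_on_snd continuous_on_id)
  qed
  have Guni: "hmat p = hmat q" if "p \<in> G k" "q \<in> G k" for k p q
  proof -
    obtain W \<theta> V \<phi> where pq: "p = (W, \<theta>)" "q = (V, \<phi>)" by (cases p, cases q)
    have p: "unitary W" "B k = udiag W (\<lambda>j. cis (\<theta> $ j))" "\<forall>j. \<bar>\<theta> $ j\<bar> \<le> pi / 2"
      using that(1) unfolding pq G_def by blast+
    have q: "unitary V" "B k = udiag V (\<lambda>j. cis (\<phi> $ j))" "\<forall>j. \<bar>\<phi> $ j\<bar> \<le> pi / 2"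
      using that(2) unfolding pq G_def by blast+
    have "\<bar>\<theta> $ i - \<phi> $ j\<bar> < 2 * pi" for i j
      using p(3) [rule_format, of i] q(3) [rule_format, of j] pi_gt_zero by linarith
    then show ?thesis
      unfolding pq by (rule hmat_eqI [OF p(1) q(1) trans [OF p(2) [symmetric] q(2)]])
  qed
  obtain K where "(\<forall>g k W \<theta>. (W, \<theta>) \<in> G k \<longrightarrow> K g k = udiag W (\<lambda>j. g (\<theta> $ j))) \<and>
    (\<forall>g. continuous_on UNIV g \<longrightarrow> continuous_on UNIV (K g))"
    by (rule exE [OF frame_calculus [OF Gsub Gne Gclo Guni]])
  note this [THEN conjunct1, rule_format] this [THEN conjunct2, rule_format]
  note K = this(1) and contK = this(2)
  define h1 where "h1 = K of_real"
  have h1: "selfadj (h1 k) \<and> mexp (cscale \<i> (h1 k)) = B k" for k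
  proof -
    obtain W \<theta> where p: "(W, \<theta>) \<in> G k" using Gne [of k] by fastforce
    then have W: "unitary W" "B k = udiag W (\<lambda>j. cis (\<theta> $ j))" by (auto simp: G_def)
    show ?thesis
      unfolding h1_def K [OF p] mexp_cscale_udiag [OF W(1)] W(2)
      by (simp add: selfadj_udiag cis_conv_exp)
  qed
  have "two_step_log \<alpha> h1 h2"
    unfolding two_step_log_def
  proof (intro conjI allI)
    show "continuous_on UNIV h1" "continuous_on UNIV h2"
      unfolding h1_def h2_def by (intro contK contH continuous_intros)+
    show "periodic2 h2" unfolding h2_def by (rule perH)
    show "periodic2 h1"
      unfolding periodic2_def
    proof (intro allI impI)
      fix k z :: "real^2" assume z: "\<forall>i. z $ i \<in> \<int>"
      then have "G (k + z) = G k" using perB by (simp add: G_def periodic2D)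
      moreover obtain W \<theta> where "(W, \<theta>) \<in> G k" using Gne [of k] by fastforce
      ultimately show "h1 (k + z) = h1 k" unfolding h1_def using K by metis
    qed
    fix k
    show "selfadj (h1 k)" "selfadj (h2 k)" using h1 fr by blast+
    have "Ep k ** B k ** Ep k = (Ep k ** Em k) ** \<alpha> k ** (Em k ** Ep k)"
      by (simp add: B_def matrix_mul_assoc)
    then show "\<alpha> k = mexp (cscale (\<i>/2) (h2 k)) ** mexp (cscale \<i> (h1 k)) ** mexp (cscale (\<i>/2) (h2 k))"
      using fr [of k] h1 [of k] by simp
  qed
  moreover have "matching_rel \<epsilon> h1 \<and> matching_rel \<epsilon> h2"
    if e: "real_orth \<epsilon>" and ma: "matching_rel \<epsilon> \<alpha>" and mb: "matching_rel \<epsilon> \<beta>"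
      and ev: "\<And>k. \<psi> (- k) = \<psi> k" for \<epsilon>
  proof -
    have twF: "(transpose \<epsilon> ** cnjm W, \<theta>) \<in> F k" if "(W, \<theta>) \<in> F (- k)" for k W \<theta>
    proof -
      have "\<beta> k = twist \<epsilon> (\<beta> (- k))" using mb matching_rel_iff [OF e] by blast
      then have "\<beta> k = udiag (transpose \<epsilon> ** cnjm W) (\<lambda>j. cis (\<theta> $ j))"
        using Fu(2) [OF that] by (simp add: twist_udiag [OF e])
      then show ?thesis
        using that ev [of k] unitary_twist_frame [OF e] by (auto simp: F_def logframe_def)
    qed
    have H': "H g k = twist \<epsilon> (H g (- k))" for g k
      by (rule twist_frame_H [where F = F and H = H, OF e H Fne twF])
    have B': "B k = twist \<epsilon> (B (- k))" for k
    proof -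
      have "\<alpha> k = twist \<epsilon> (\<alpha> (- k))" using ma matching_rel_iff [OF e] by blast
      moreover have "Em k = twist \<epsilon> (Em (- k))" unfolding Em_def by (rule H')
      ultimately show ?thesis by (simp add: B_def twist_mult [OF e] matrix_mul_assoc)
    qed
    have twG: "(transpose \<epsilon> ** cnjm W, \<theta>) \<in> G k" if "(W, \<theta>) \<in> G (- k)" for k W \<theta>
      using that B' [of k] unitary_twist_frame [OF e] by (auto simp: G_def twist_udiag [OF e])
    have K': "K g k = twist \<epsilon> (K g (- k))" for g k
      by (rule twist_frame_H [where F = G and H = K, OF e K Gne twG])
    show ?thesis
      unfolding matching_rel_iff [OF e] h1_def h2_def using H' K' by blast
  qed
  ultimately show ?thesis using that by blast
qed

section \<open>Generic perturbations have simple spectrum\<close>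

subsection \<open>Differentiability of matrix-valued maps\<close>

lemma differentiable_bounded_linear:
  assumes "bounded_linear L" "f differentiable (at x)"
  shows "(\<lambda>x. L (f x)) differentiable (at x)"
  using differentiable_chain_at [OF assms(2) bounded_linear_imp_differentiable [OF assms(1)]]
  by (simp add: o_def)

lemma bounded_linear_entry: "bounded_linear (\<lambda>A :: 'n::finite cmat. A $ i $ j)"
  using bounded_linear_compose [OF bounded_linear_vec_nth bounded_linear_vec_nth] .

lemma differentiable_entry:
  "A differentiable (at x) \<Longrightarrow> (\<lambda>x. (A x :: 'n::finite cmat) $ i $ j) differentiable (at x)"
  by (rule differentiable_bounded_linear [OF bounded_linear_entry])

lemma differentiable_cmat:
  assumes "\<And>i j. (\<lambda>x. A x $ i $ j) differentiable (at x)"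
  shows "(A :: _ \<Rightarrow> 'n::finite cmat) differentiable (at x)"
proof -
  have L: "bounded_linear (\<lambda>c. axis i (axis j c) :: 'n cmat)" for i j
    unfolding linear_conv_bounded_linear [symmetric]
    by (rule linearI) (simp_all add: axis_def vec_eq_iff)
  have "(\<Sum>j\<in>(UNIV :: 'n set). if P then g j else 0) = (if P then sum g UNIV else 0)"
    for P and g :: "'n \<Rightarrow> complex" by simp
  then have "A = (\<lambda>x. \<Sum>i\<in>UNIV. \<Sum>j\<in>UNIV. axis i (axis j (A x $ i $ j)))"
    by (simp add: fun_eq_iff vec_eq_iff axis_def if_distrib [where f = "\<lambda>x. x $ _"] cong: if_cong)
  moreover have "(\<lambda>x. \<Sum>i\<in>UNIV. \<Sum>j\<in>UNIV. axis i (axis j (A x $ i $ j)) :: 'n cmat) differentiable (at x)"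
    by (intro differentiable_sum finite ballI differentiable_bounded_linear [OF L] assms)
  ultimately show ?thesis by simp
qed

lemma differentiable_prod_complex:
  assumes "\<And>i. i \<in> S \<Longrightarrow> (\<lambda>x. f i x :: complex) differentiable (at x)"
  shows "(\<lambda>x. \<Prod>i\<in>S. f i x) differentiable (at x)"
  using assms by (induction S rule: infinite_finite_induct) auto

lemma differentiable_det:
  assumes "A differentiable (at x)"
  shows "(\<lambda>x. det (A x :: 'n::finite cmat)) differentiable (at x)"
  unfolding det_def
  by (intro differentiable_sum finite_permutations finite ballI differentiable_mult differentiable_const
      differentiable_prod_complex differentiable_entry assms)

lemma differentiable_cmat_mult:
  assumes "A differentiable (at x)" "B differentiable (at x)"
  shows "(\<lambda>x. (A x :: 'n::finite cmat) ** (B x :: 'n cmat)) differentiable (at x)"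
  by (rule differentiable_cmat, unfold matrix_matrix_mult_def vec_lambda_beta)
    (intro differentiable_sum finite ballI differentiable_mult differentiable_entry assms)

lemma differentiable_cscale:
  assumes "A differentiable (at x)"
  shows "(\<lambda>x. cscale c (A x)) differentiable (at x)"
  by (rule differentiable_cmat, unfold cscale_def vec_lambda_beta)
    (intro differentiable_mult differentiable_const differentiable_entry assms)

lemma bounded_linear_cadj: "bounded_linear (cadj :: 'n::finite cmat \<Rightarrow> _)"
  unfolding linear_conv_bounded_linear [symmetric]
  by (rule linearI) (simp_all add: cadj_def vec_eq_iff)

lemma differentiable_minv:
  assumes "A differentiable (at x)" "det (A x) \<noteq> 0"
  shows "(\<lambda>x. minv (A x :: 'n::finite cmat)) differentiable (at x)"
proof (rule differentiable_cmat, unfold minv_def vec_lambda_beta)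
  fix k l :: 'n
  have "(\<lambda>x. \<chi> i j. if j = k then if i = l then 1 else 0 else A x $ i $ j) differentiable (at x)"
  proof (rule differentiable_cmat)
    show "(\<lambda>x. (\<chi> i j. if j = k then if i = l then 1 else 0 else A x $ i $ j) $ i $ j) differentiable (at x)" for i j
      using differentiable_entry [OF assms(1)] by (cases "j = k") auto
  qed
  then show "(\<lambda>x. det (\<chi> i j. if j = k then if i = l then 1 else 0 else A x $ i $ j) / det (A x)) differentiable (at x)"
    by (intro differentiable_divide differentiable_det assms)
qed

lemma differentiable_cayley:
  assumes "A differentiable (at x)" "det (mat 1 - cscale \<i> (A x)) \<noteq> 0"
  shows "(\<lambda>x. cayley (A x :: 'n::finite cmat)) differentiable (at x)"
  unfolding cayley_def
  by (intro differentiable_cmat_mult differentiable_add differentiable_diff differentiable_const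
      differentiable_cscale differentiable_minv assms)

lemma differentiable_cayinv:
  assumes "A differentiable (at x)" "det (A x + mat 1) \<noteq> 0"
  shows "(\<lambda>x. cayinv (A x :: 'n::finite cmat)) differentiable (at x)"
  unfolding cayinv_def
  by (intro differentiable_cmat_mult differentiable_add differentiable_diff differentiable_const
      differentiable_cscale differentiable_minv assms)

lemma det_cayley_denominator:
  assumes "selfadj X" shows "det (mat 1 - cscale \<i> X) \<noteq> 0"
proof -
  obtain W x where W: "unitary W" "X = udiag W (\<lambda>j. of_real (x j))"
    using spectral_selfadj [OF assms] .
  show ?thesis
    unfolding W(2) mat1_udiag [OF W(1)] by (simp add: det_udiag W one_plus_i_neq_0)
qed

lemma cayinv_cayley:
  assumes "selfadj X" shows "cayinv (cayley X) = X" "det (cayley X + mat 1) \<noteq> 0"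
proof -
  obtain W x where W: "unitary W" "X = udiag W (\<lambda>j. of_real (x j))"
    using spectral_selfadj [OF assms] .
  show "cayinv (cayley X) = X" "det (cayley X + mat 1) \<noteq> 0"
    unfolding W(2) cayley_udiag [OF W(1)] using cayinv_cayley_udiag [OF W(1)] by auto
qed

lemma unitary_cayley:
  assumes "selfadj X" shows "unitary (cayley X)"
proof -
  obtain W x where W: "unitary W" "X = udiag W (\<lambda>j. of_real (x j))"
    using spectral_selfadj [OF assms] .
  show ?thesis
    unfolding W(2) cayley_udiag [OF W(1)] using W by (simp add: unitary_udiag)
qed

lemma twist_cayley:
  assumes "real_orth \<epsilon>" "selfadj X" shows "twist \<epsilon> (cayley X) = cayley (twist \<epsilon> X)"
proof -
  obtain W x where W: "unitary W" "X = udiag W (\<lambda>j. of_real (x j))"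
    using spectral_selfadj [OF assms(2)] .
  show ?thesis
    unfolding W(2) cayley_udiag [OF W(1)] twist_udiag [OF assms(1)]
    by (simp add: cayley_udiag unitary_twist_frame assms W)
qed

subsection \<open>Coordinates on Hermitian matrices\<close>

text \<open>A real-linear bijection from all real matrices to Hermitian ones: the symmetric part
  supplies the real entries, the antisymmetric part the imaginary ones. It provides Euclidean
  coordinates in which null sets of Hermitian matrices make sense.\<close>

definition herm :: "real ^ 'n ^ 'n \<Rightarrow> 'n::finite cmat" where
  "herm X = (\<chi> i j. Complex ((X $ i $ j + X $ j $ i) / 2) ((X $ i $ j - X $ j $ i) / 2))"

definition hcoord :: "'n::finite cmat \<Rightarrow> real ^ 'n ^ 'n" where
  "hcoord A = (\<chi> i j. Re (A $ i $ j) + Im (A $ i $ j))"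

lemma hcoord_herm: "hcoord (herm X) = X"
  by (simp add: hcoord_def herm_def vec_eq_iff field_simps)

lemma selfadj_entry: "selfadj A \<Longrightarrow> A $ i $ j = cnj (A $ j $ i)"
  unfolding selfadj_def cadj_def by (simp add: vec_eq_iff)

lemma herm_hcoord:
  assumes "selfadj A" shows "herm (hcoord A) = A"
proof -
  have "herm (hcoord A) $ i $ j = A $ i $ j" for i j
    using selfadj_entry [OF assms, of j i] by (simp add: hcoord_def herm_def complex_eq_iff)
  then show ?thesis by (simp add: vec_eq_iff)
qed

lemma selfadj_herm [simp]: "selfadj (herm X)"
proof -
  have "cnj (herm X $ j $ i) = herm X $ i $ j" for i j
    by (rule complex_eqI) (simp_all add: herm_def add.commute minus_divide_left del: divide_minus_left)
  then show ?thesis by (simp add: selfadj_def cadj_def vec_eq_iff)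
qed

lemma selfadj_scaleR: "selfadj A \<Longrightarrow> selfadj (c *\<^sub>R A)"
  by (simp add: selfadj_def cadj_def vec_eq_iff)

lemma selfadj_add: "selfadj A \<Longrightarrow> selfadj B \<Longrightarrow> selfadj (A + B)"
  by (simp add: selfadj_def cadj_add)

lemma bounded_linear_herm: "bounded_linear (herm :: _ \<Rightarrow> 'n::finite cmat)"
  unfolding linear_conv_bounded_linear [symmetric]
  by (rule linearI) (simp_all add: herm_def vec_eq_iff complex_eq_iff field_simps)

lemma bounded_linear_hcoord: "bounded_linear (hcoord :: 'n::finite cmat \<Rightarrow> _)"
  unfolding linear_conv_bounded_linear [symmetric]
  by (rule linearI) (simp_all add: hcoord_def vec_eq_iff field_simps)

text \<open>The projection used in \<open>corank2\<close>: rows \<open>a\<close> and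
  \<open>b\<close> vanish, the remaining coordinates are kept, and columns \<open>a\<close> and
  \<open>b\<close> carry, up to sign, a basis of the plane that is killed.\<close>

definition colmap :: "'n \<Rightarrow> 'n \<Rightarrow> real ^ 'n ^ 'n \<Rightarrow> 'n::finite cmat" where
  "colmap a b Z = (\<chi> s l. if s = a \<or> s = b then 0
     else if l = a \<or> l = b then herm Z $ s $ l else if s = l then 1 else 0)"

definition core :: "'n \<Rightarrow> 'n \<Rightarrow> real ^ 'n ^ 'n \<Rightarrow> 'n::finite cmat" where
  "core a b Z = (\<chi> s t. if s = a \<or> s = b \<or> t = a \<or> t = b then 0 else herm Z $ s $ t)"

text \<open>A Hermitian matrix whose kernel contains a plane that projects onto the coordinates
  \<open>a\<close>, \<open>b\<close> is \<open>M\<^sup>* C M\<close> with \<open>M\<close> the projection along that plane. The four entries of \<open>Z\<close>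
  indexed by \<open>a\<close> and \<open>b\<close> do not enter, which is the codimension count.\<close>
definition corank2 :: "'n \<Rightarrow> 'n \<Rightarrow> real ^ 'n ^ 'n \<Rightarrow> 'n::finite cmat" where
  "corank2 a b Z = cadj (colmap a b Z) ** core a b Z ** colmap a b Z"

lemma differentiable_corank2: "corank2 a b differentiable (at Z)"
proof -
  have h: "herm differentiable (at Z)" by (rule bounded_linear_imp_differentiable [OF bounded_linear_herm])
  have 1: "colmap a b differentiable (at Z)"
  proof (rule differentiable_cmat)
    show "(\<lambda>x. colmap a b x $ s $ l) differentiable (at Z)" for s l
      using differentiable_entry [OF h, of s l]
      by (cases "s = a \<or> s = b"; cases "l = a \<or> l = b") (simp_all add: colmap_def)
  qed
  have 2: "core a b differentiable (at Z)"
  proof (rule differentiable_cmat)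
    show "(\<lambda>x. core a b x $ s $ l) differentiable (at Z)" for s l
      using differentiable_entry [OF h, of s l]
      by (cases "s = a \<or> s = b \<or> l = a \<or> l = b") (simp_all add: core_def)
  qed
  have "(\<lambda>Z. cadj (colmap a b Z) ** core a b Z ** colmap a b Z) differentiable (at Z)"
    by (intro differentiable_cmat_mult differentiable_bounded_linear [OF bounded_linear_cadj] 1 2)
  then show ?thesis by (simp add: corank2_def [abs_def])
qed

text \<open>Subtracting the repeated eigenvalue leaves a Hermitian Y that kills columns
  \<open>l\<close> and \<open>l'\<close> of \<open>W\<close>. These are independent, so some 2x2
  minor, in rows \<open>a\<close> and \<open>b\<close>, is nonzero, and the plane they span projects
  isomorphically onto those two coordinates. Quantifying over all \<open>Z'\<close> that agree with
  \<open>Z\<close> off the block records that its four entries stay free.\<close>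

lemma corank2_repr:
  fixes W :: "'n::finite cmat" and y :: "'n \<Rightarrow> real"
  assumes W: "unitary W" and l: "l \<noteq> l'" "y l = y l'"
  shows "\<exists>a b Z. a \<noteq> b \<and>
    (\<forall>Z'. (\<forall>s t. \<not> ((s = a \<or> s = b) \<and> (t = a \<or> t = b)) \<longrightarrow> Z' $ s $ t = Z $ s $ t) \<longrightarrow>
       udiag W (\<lambda>j. of_real (y j)) = y l *\<^sub>R mat 1 + corank2 a b Z')"
proof -
  have col: "(\<Sum>i\<in>UNIV. cnj (W $ i $ j) * W $ i $ k) = (if j = k then 1 else 0)" for j k
    using unitaryD(2) [OF W] by (simp add: vec_eq_iff matrix_matrix_mult_def cadj_def mat_def)
  have "\<exists>a b. W $ a $ l * W $ b $ l' - W $ b $ l * W $ a $ l' \<noteq> 0"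
  proof (rule ccontr)
    assume "\<not> ?thesis"
    then have 0: "W $ a $ l * W $ b $ l' - W $ b $ l * W $ a $ l' = 0" for a b by blast
    have "W $ b $ l' = 0" for b
    proof -
      \<comment> \<open>Contracting the vanishing minors with the conjugate of column
        \<open>l\<close> leaves just \<open>W $ b $ l'\<close>, by orthonormality of the two
        columns.\<close>
      have "(\<Sum>a\<in>UNIV. cnj (W $ a $ l) * (W $ a $ l * W $ b $ l' - W $ b $ l * W $ a $ l')) =
        (\<Sum>a\<in>UNIV. cnj (W $ a $ l) * W $ a $ l) * W $ b $ l' - W $ b $ l * (\<Sum>a\<in>UNIV. cnj (W $ a $ l) * W $ a $ l')"
        by (simp add: sum_distrib_left sum_distrib_right sum_subtractf algebra_simps)
      then show ?thesis using 0 l by (simp add: col)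
    qed
    then show False using col [of l' l'] by simp
  qed
  then obtain a b where ab: "W $ a $ l * W $ b $ l' - W $ b $ l * W $ a $ l' \<noteq> 0" by blast
  define D where "D = W $ a $ l * W $ b $ l' - W $ b $ l * W $ a $ l'"
  have D: "D \<noteq> 0" using ab by (simp add: D_def)
  have "a \<noteq> b" using ab by auto
  \<comment> \<open>Cramer's rule for the minor: \<open>p\<close> and \<open>q\<close> lie in the
    span of columns \<open>l\<close> and \<open>l'\<close> and restrict to (1,0) and (0,1) on the
    coordinates \<open>a\<close>, \<open>b\<close>.\<close>
  define p where "p s = (W $ b $ l' * W $ s $ l - W $ b $ l * W $ s $ l') / D" for s
  define q where "q s = (W $ a $ l * W $ s $ l' - W $ a $ l' * W $ s $ l) / D" for s
  have pq: "p a = 1" "p b = 0" "q a = 0" "q b = 1"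
    using D by (simp_all add: p_def q_def D_def mult.commute)
  define Y where "Y = udiag W (\<lambda>j. of_real (y j - y l))"
  have selfY: "cadj Y = Y" using selfadj_udiag [of W "\<lambda>j. y j - y l"] by (simp add: selfadj_def Y_def)
  have YW: "(\<Sum>s\<in>UNIV. Y $ i $ s * W $ s $ j) = W $ i $ j * of_real (y j - y l)" for i j
  proof -
    have "Y ** W = W ** diagm (\<lambda>j. of_real (y j - y l))"
      using W by (simp add: Y_def udiag_def)
    then have "(Y ** W) $ i $ j = (W ** diagm (\<lambda>j. of_real (y j - y l))) $ i $ j" by simp
    then show ?thesis unfolding mult_diagm_entry by (simp add: matrix_matrix_mult_def)
  qed
  have Yl: "(\<Sum>s\<in>UNIV. Y $ i $ s * W $ s $ l) = 0" "(\<Sum>s\<in>UNIV. Y $ i $ s * W $ s $ l') = 0" for i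
    using YW [of i l] YW [of i l'] l(2) by simp_all
  have "(\<Sum>s\<in>UNIV. Y $ i $ s * p s) = (W $ b $ l' * (\<Sum>s\<in>UNIV. Y $ i $ s * W $ s $ l)
      - W $ b $ l * (\<Sum>s\<in>UNIV. Y $ i $ s * W $ s $ l')) / D" for i
    by (simp add: p_def sum_distrib_left sum_subtractf sum_divide_distrib algebra_simps diff_divide_distrib)
  then have Yp: "(\<Sum>s\<in>UNIV. Y $ i $ s * p s) = 0" for i by (simp add: Yl)
  have "(\<Sum>s\<in>UNIV. Y $ i $ s * q s) = (W $ a $ l * (\<Sum>s\<in>UNIV. Y $ i $ s * W $ s $ l')
      - W $ a $ l' * (\<Sum>s\<in>UNIV. Y $ i $ s * W $ s $ l)) / D" for i
    by (simp add: q_def sum_distrib_left sum_subtractf sum_divide_distrib algebra_simps diff_divide_distrib)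
  then have Yq: "(\<Sum>s\<in>UNIV. Y $ i $ s * q s) = 0" for i by (simp add: Yl)
  \<comment> \<open>The identity minus \<open>p\<close> in column \<open>a\<close> and
    \<open>q\<close> in column \<open>b\<close>. As \<open>Y\<close> kills \<open>p\<close> and
    \<open>q\<close>, Y M = Y; taking adjoints, M* Y = Y.\<close>
  define M :: "'n cmat" where "M = (\<chi> s k. (if s = k then 1 else 0) - (if k = a then p s else 0) - (if k = b then q s else 0))"
  have YM: "Y ** M = Y"
  proof -
    have "(Y ** M) $ i $ k = Y $ i $ k - (if k = a then \<Sum>s\<in>UNIV. Y $ i $ s * p s else 0)
        - (if k = b then \<Sum>s\<in>UNIV. Y $ i $ s * q s else 0)" for i k
      by (simp add: matrix_matrix_mult_def M_def right_diff_distrib sum_subtractf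
          if_distrib [where f = "\<lambda>x. _ * x"] cong: if_cong)
    then show ?thesis by (simp add: vec_eq_iff Yp Yq)
  qed
  have Mrow: "M $ a $ k = 0" "M $ b $ k = 0" for k
    using \<open>a \<noteq> b\<close> pq by (auto simp: M_def)
  \<comment> \<open>One Hermitian matrix storing both ingredients: the columns \<open>a\<close> and
    \<open>b\<close> of \<open>M\<close>, and \<open>Y\<close> on the remaining indices.\<close>
  define K :: "'n cmat" where "K = (\<chi> s t. if (s = a \<or> s = b) \<and> (t = a \<or> t = b) then 0
    else if s = a \<or> s = b then cnj (M $ t $ s) else if t = a \<or> t = b then M $ s $ t else Y $ s $ t)"
  have "cnj (Y $ t $ s) = Y $ s $ t" for s t
    using selfY by (simp add: cadj_def vec_eq_iff)
  then have "selfadj K"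
    by (simp add: selfadj_def cadj_def K_def vec_eq_iff)
  then have hK: "herm (hcoord K) = K" by (rule herm_hcoord)
  show ?thesis
  proof (intro exI conjI allI impI)
    show "a \<noteq> b" by fact
    fix Z' assume Z': "\<forall>s t. \<not> ((s = a \<or> s = b) \<and> (t = a \<or> t = b)) \<longrightarrow> Z' $ s $ t = hcoord K $ s $ t"
    have h: "herm Z' $ s $ t = K $ s $ t" if "\<not> ((s = a \<or> s = b) \<and> (t = a \<or> t = b))" for s t
    proof -
      have "herm Z' $ s $ t = herm (hcoord K) $ s $ t"
        using Z' [rule_format, of s t] Z' [rule_format, of t s] that by (auto simp: herm_def)
      then show ?thesis by (simp add: hK)
    qed
    have M: "colmap a b Z' = M"
    proof -
      have "colmap a b Z' $ s $ t = M $ s $ t" for s t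
      proof (cases "s = a \<or> s = b")
        case True
        then show ?thesis using Mrow by (auto simp: colmap_def)
      next
        case False
        then show ?thesis using h [of s t] by (auto simp: colmap_def K_def M_def)
      qed
      then show ?thesis by (simp add: vec_eq_iff)
    qed
    have core: "core a b Z' = (\<chi> s t. if s = a \<or> s = b \<or> t = a \<or> t = b then 0 else Y $ s $ t)"
      by (auto simp: core_def vec_eq_iff h K_def)
    have "cadj M ** core a b Z' ** M = cadj M ** Y ** M"
    proof -
      have "core a b Z' ** M = (\<chi> s t. if s = a \<or> s = b then 0 else (Y ** M) $ s $ t)"
        unfolding core matrix_matrix_mult_def vec_eq_iff vec_lambda_beta
      proof (intro allI)
        fix s k
        have "(if s = a \<or> s = b \<or> t = a \<or> t = b then 0 else Y $ s $ t) * M $ t $ k =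
          (if s = a \<or> s = b then 0 else Y $ s $ t * M $ t $ k)" for t
          using Mrow by auto
        then show "(\<Sum>t\<in>UNIV. (if s = a \<or> s = b \<or> t = a \<or> t = b then 0 else Y $ s $ t) * M $ t $ k) =
          (if s = a \<or> s = b then 0 else \<Sum>t\<in>UNIV. Y $ s $ t * M $ t $ k)"
          by simp
      qed
      then have "cadj M ** (core a b Z' ** M) = cadj M ** (Y ** M)"
        unfolding matrix_matrix_mult_def [of "cadj M"] vec_eq_iff
        using Mrow by (auto simp: cadj_def intro!: sum.cong)
      then show ?thesis by (simp only: matrix_mul_assoc)
    qed
    also have "cadj M ** Y ** M = Y"
    proof -
      have "cadj M ** Y = cadj (Y ** M)" by (simp add: cadj_mult selfY)
      then show ?thesis by (simp add: YM selfY)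
    qed
    finally have "corank2 a b Z' = Y" by (simp add: corank2_def M)
    moreover have "udiag W (\<lambda>j. of_real (y j)) = udiag W (\<lambda>j. of_real (y l)) + Y"
      by (simp add: Y_def udiag_add)
    moreover have "udiag W (\<lambda>j. of_real (y l)) = y l *\<^sub>R mat 1"
      using scaleR_udiag [of "y l" W "\<lambda>_. 1"] W by (simp add: scaleR_conv_of_real)
    ultimately show "udiag W (\<lambda>j. of_real (y j)) = y l *\<^sub>R mat 1 + corank2 a b Z'" by simp
  qed
qed

subsection \<open>Transversality\<close>

definition simple_spec :: "'n::finite cmat \<Rightarrow> bool" where
  "simple_spec A \<longleftrightarrow> (\<forall>W d. unitary W \<longrightarrow> A = udiag W d \<longrightarrow> inj d)"

lemma simple_spec_twist:
  assumes e: "real_orth \<epsilon>" and "simple_spec A" shows "simple_spec (twist \<epsilon> A)"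
  unfolding simple_spec_def
proof (intro allI impI)
  fix W d assume W: "unitary W" "twist \<epsilon> A = udiag W d"
  then have "A = udiag (transpose \<epsilon> ** cnjm W) d"
    by (metis twist_twist [OF e] twist_udiag [OF e])
  then show "inj d"
    using assms(2) unitary_twist_frame [OF e W(1)] unfolding simple_spec_def by blast
qed

lemma gapped_det: "gapped A \<psi> \<Longrightarrow> det A = cis \<psi>"
  by (auto simp: gapped_def logframe_def det_udiag cis_sum [symmetric])

text \<open>A diameter of exactly 2 pi would make two eigenvalues coincide, so a simple spectrum
  turns the weak bound of \<open>logframe\<close> into the strict one.\<close>

lemma gapped_simple:
  assumes "unitary A" "simple_spec A" "det A = cis \<psi>"
  shows "gapped A \<psi>"
proof -
  obtain W \<theta> where p: "(W, \<theta>) \<in> logframe A \<psi>"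
    using logframe_exists [OF assms(1,3)] by fastforce
  then have "inj (\<lambda>j. cis (\<theta> $ j))"
    using assms(2) unfolding simple_spec_def logframe_def by blast
  then have "\<theta> $ i - \<theta> $ j \<noteq> 2 * pi" for i j
  proof (intro notI)
    assume 1: "\<theta> $ i - \<theta> $ j = 2 * pi"
    then have "cis (\<theta> $ i) = cis (\<theta> $ j)" by (auto simp: cis_eq_cis intro!: exI [of _ 1])
    with \<open>inj (\<lambda>j. cis (\<theta> $ j))\<close> have "i = j" by (simp add: inj_def)
    with 1 show False by simp
  qed
  moreover have "\<theta> $ i - \<theta> $ j \<le> 2 * pi" for i j using p by (auto simp: logframe_def)
  ultimately have "\<forall>i j. \<theta> $ i - \<theta> $ j < 2 * pi" by (simp add: less_le)
  with p show ?thesis unfolding gapped_def by blast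
qed

text \<open>The numbers 1/(n+1) already give infinitely many different points on the circle.
  Rationality of the angle keeps the number of parametrisations of degenerate matrices
  countable.\<close>

lemma exists_rational_phase:
  assumes "finite S" shows "\<exists>t\<in>\<rat>. - cis t \<notin> S"
proof (rule ccontr)
  assume neg: "\<not> ?thesis"
  let ?R = "range (\<lambda>n::nat. 1 / real (n + 1))"
  have "infinite ?R" by (intro range_inj_infinite injI) simp
  moreover have "inj_on (\<lambda>t. - cis t) ?R"
  proof (rule inj_onI)
    fix x y assume xy: "x \<in> ?R" "y \<in> ?R" "- cis x = - cis y"
    have "0 \<le> z \<and> z \<le> 1" if "z \<in> ?R" for z using that by auto
    from this [OF xy(1)] this [OF xy(2)] have "\<bar>x - y\<bar> < 2 * pi" using pi_gt3 by linarith
    moreover have "cis x = cis y" using xy(3) by simp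
    ultimately show "x = y" by (intro cis_eq_imp_eq)
  qed
  ultimately have "infinite ((\<lambda>t. - cis t) ` ?R)" by (simp add: finite_image_iff)
  moreover have "(\<lambda>t. - cis t) ` ?R \<subseteq> S" using neg by force
  ultimately show False using assms finite_subset by blast
qed

text \<open>After rotation by \<open>cis (- t)\<close> no eigenvalue is -1, so the Cayley chart
  applies and turns a repeated eigenvalue into a repeated real parameter.\<close>

lemma degenerate_cayley:
  assumes D: "unitary D" "\<not> simple_spec D"
  obtains t W y l l' where "t \<in> \<rat>" "unitary W" "l \<noteq> l'" "y l = y l'"
    "D = cscale (cis t) (cayley (udiag W (\<lambda>j. of_real (y j))))"
proof -
  obtain W d where W: "unitary W" "D = udiag W d" "\<not> inj d"
    using D(2) by (auto simp: simple_spec_def)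
  obtain l l' where l: "l \<noteq> l'" "d l = d l'" using W(3) by (auto simp: inj_def)
  obtain t where t: "t \<in> \<rat>" "- cis t \<notin> range d"
    using exists_rational_phase [of "range d"] by auto
  have "\<forall>z. \<exists>x. norm z = 1 \<and> z \<noteq> -1 \<longrightarrow> z = cay (of_real x)" using exists_cay by blast
  then obtain g where g: "\<And>z. norm z = 1 \<Longrightarrow> z \<noteq> -1 \<Longrightarrow> z = cay (of_real (g z))" by metis
  have "cis (- t) * d j = cay (of_real (g (cis (- t) * d j)))" for j
  proof (rule g)
    show "norm (cis (- t) * d j) = 1"
      using unitary_udiag_norm [OF W(1)] D(1) W(2) by (simp add: norm_mult)
    show "cis (- t) * d j \<noteq> -1"
    proof
      assume "cis (- t) * d j = -1"
      then have "cis t * (cis (- t) * d j) = cis t * (-1)" by simp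
      then have "d j = - cis t" by (simp add: mult.assoc [symmetric] cis_mult)
      with t(2) show False by (metis rangeI)
    qed
  qed
  then have "cis t * cay (of_real (g (cis (- t) * d j))) = cis t * (cis (- t) * d j)" for j
    by simp
  then have "cis t * cay (of_real (g (cis (- t) * d j))) = d j" for j
    by (simp add: mult.assoc [symmetric] cis_mult)
  then have "D = cscale (cis t) (cayley (udiag W (\<lambda>j. of_real (g (cis (- t) * d j)))))"
    by (simp add: cayley_udiag W cscale_udiag)
  with t(1) W(1) l(1) show ?thesis
    using that [of t W l l' "\<lambda>j. g (cis (- t) * d j)"] l(2) by simp
qed

definition kpt :: "'n \<Rightarrow> 'n \<Rightarrow> real ^ 'n ^ 'n \<Rightarrow> real ^ 2" where
  "kpt a b Z = (\<chi> l. if l = 1 then Z $ a $ b else Z $ b $ a)"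

lemma differentiable_kpt: "kpt a b differentiable (at (Z :: real ^ 'n::finite ^ 'n))"
proof -
  have "linear (kpt a b :: real ^ 'n ^ 'n \<Rightarrow> _)"
    by (rule linearI) (simp_all add: kpt_def vec_eq_iff)
  then show ?thesis by (rule linear_imp_differentiable)
qed

text \<open>The bad parameters are covered by countably many differentiable images of a hyperplane: in
  the coordinates of \<open>corank2\<close> the unused entries carry the degenerate eigenvalue \<open>Z $ a $ a\<close> and the
  point \<open>k\<close>, and the fourth one is zero.\<close>
definition bad_map :: "(real^2 \<Rightarrow> 'n::finite cmat) \<Rightarrow> (real^2 \<Rightarrow> real) \<Rightarrow> real \<Rightarrow> 'n \<Rightarrow> 'n \<Rightarrow> real ^ 'n ^ 'n \<Rightarrow> real ^ 'n ^ 'n" where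
  "bad_map \<alpha> f t a b Z = hcoord ((1 / f (kpt a b Z)) *\<^sub>R cayinv (cscale (cis t)
     (cayley ((Z $ a $ a) *\<^sub>R mat 1 + corank2 a b Z)) ** cadj (\<alpha> (kpt a b Z))))"

definition bad_dom :: "(real^2 \<Rightarrow> 'n::finite cmat) \<Rightarrow> (real^2 \<Rightarrow> real) \<Rightarrow> real \<Rightarrow> 'n \<Rightarrow> 'n \<Rightarrow> (real ^ 'n ^ 'n) set" where
  "bad_dom \<alpha> f t a b = {Z. Z $ b $ b = 0 \<and> f (kpt a b Z) \<noteq> 0 \<and>
     det (mat 1 - cscale \<i> ((Z $ a $ a) *\<^sub>R mat 1 + corank2 a b Z)) \<noteq> 0 \<and>
     det (cscale (cis t) (cayley ((Z $ a $ a) *\<^sub>R mat 1 + corank2 a b Z)) ** cadj (\<alpha> (kpt a b Z)) + mat 1) \<noteq> 0}"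

lemma differentiable_bad_map:
  assumes \<alpha>: "\<And>k. \<alpha> differentiable (at k)" and f: "\<And>k. f differentiable (at k)"
    and Z: "Z \<in> bad_dom \<alpha> f t a b"
  shows "bad_map \<alpha> f t a b differentiable (at Z)"
proof -
  have k: "(\<lambda>Z. f (kpt a b Z)) differentiable (at Z)" "(\<lambda>Z. \<alpha> (kpt a b Z)) differentiable (at Z)"
    using differentiable_chain_at [OF differentiable_kpt f] differentiable_chain_at [OF differentiable_kpt \<alpha>]
    by (simp_all add: o_def)
  have d: "(\<lambda>Z. Z $ a $ a) differentiable (at Z)"
    by (rule linear_imp_differentiable, rule linearI) simp_all
  have X: "(\<lambda>Z. (Z $ a $ a) *\<^sub>R mat 1 + corank2 a b Z) differentiable (at Z)"
    by (intro differentiable_add differentiable_scaleR d differentiable_const differentiable_corank2)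
  have "(\<lambda>Z. hcoord ((1 / f (kpt a b Z)) *\<^sub>R cayinv (cscale (cis t)
     (cayley ((Z $ a $ a) *\<^sub>R mat 1 + corank2 a b Z)) ** cadj (\<alpha> (kpt a b Z))))) differentiable (at Z)"
    using Z unfolding bad_dom_def
    by (intro differentiable_bounded_linear [OF bounded_linear_hcoord] differentiable_scaleR
        differentiable_divide differentiable_const k differentiable_cayinv differentiable_cmat_mult
        differentiable_cscale differentiable_cayley X
        differentiable_bounded_linear [OF bounded_linear_cadj]) auto
  then show ?thesis by (simp add: bad_map_def [abs_def])
qed

lemma negligible_bad_image:
  assumes "\<And>k. \<alpha> differentiable (at k)" "\<And>k. f differentiable (at k)"
  shows "negligible (bad_map \<alpha> f t a b ` bad_dom \<alpha> f t a b)"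
proof (rule negligible_differentiable_image_negligible [OF order_refl])
  have "negligible {Z :: real ^ 'a ^ 'a. axis b (axis b 1) \<bullet> Z = 0}"
    by (rule negligible_hyperplane) (simp add: axis_eq_0_iff)
  then show "negligible (bad_dom \<alpha> f t a b)"
    by (rule negligible_subset) (auto simp: bad_dom_def inner_axis')
  show "bad_map \<alpha> f t a b differentiable_on bad_dom \<alpha> f t a b"
    using assms by (intro differentiable_at_imp_differentiable_on differentiable_bad_map)
qed

text \<open>A degenerate D = \<open>cayley (f k *\<^sub>R herm X) ** \<alpha> k\<close> determines X
  from D and k, after division by \<open>f k\<close>. With n the matrix size, D takes n^2 - 4
  entries and its repeated eigenvalue, and k two more coordinates: n^2 - 1 parameters against the
  n^2 coordinates of X. The rotation angle and the pair a, b range over countable sets.\<close>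

theorem negligible_degenerate:
  fixes \<alpha> :: "real^2 \<Rightarrow> 'n::finite cmat"
  assumes \<alpha>: "\<And>k. \<alpha> differentiable (at k)" "\<And>k. unitary (\<alpha> k)" and f: "\<And>k. f differentiable (at k)"
  shows "negligible {X. \<exists>k. f k \<noteq> 0 \<and> \<not> simple_spec (cayley (f k *\<^sub>R herm X) ** \<alpha> k)}"
proof (rule negligible_subset)
  show "negligible (\<Union>t\<in>\<rat>. \<Union>a. \<Union>b. bad_map \<alpha> f t a b ` bad_dom \<alpha> f t a b)"
    by (intro negligible_countable_Union countable_image countable_rat)
      (auto intro!: negligible_countable_Union negligible_bad_image [OF \<alpha>(1) f])
  show "{X. \<exists>k. f k \<noteq> 0 \<and> \<not> simple_spec (cayley (f k *\<^sub>R herm X) ** \<alpha> k)} \<subseteq>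
    (\<Union>t\<in>\<rat>. \<Union>a. \<Union>b. bad_map \<alpha> f t a b ` bad_dom \<alpha> f t a b)"
  proof clarify
    fix X k assume k: "f k \<noteq> 0" and ns: "\<not> simple_spec (cayley (f k *\<^sub>R herm X) ** \<alpha> k)"
    let ?Q = "f k *\<^sub>R herm X :: 'n cmat"
    let ?D = "cayley ?Q ** \<alpha> k"
    have Q: "selfadj ?Q" by (simp add: selfadj_scaleR)
    have uD: "unitary ?D" by (intro unitary_mult unitary_cayley Q \<alpha>)
    obtain t W y l l' where t: "t \<in> \<rat>" and W: "unitary W" and l: "l \<noteq> l'" "y l = y l'"
      and D: "?D = cscale (cis t) (cayley (udiag W (\<lambda>j. of_real (y j))))"
      by (rule degenerate_cayley [OF uD ns])
    define P where "P a b (Z :: real ^ 'n ^ 'n) \<longleftrightarrow> a \<noteq> b \<and>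
      (\<forall>Z'. (\<forall>s t. \<not> ((s = a \<or> s = b) \<and> (t = a \<or> t = b)) \<longrightarrow> Z' $ s $ t = Z $ s $ t) \<longrightarrow>
       udiag W (\<lambda>j. of_real (y j)) = y l *\<^sub>R mat 1 + corank2 a b Z')" for a b Z
    have "\<exists>a b Z. P a b Z" unfolding P_def by (rule corank2_repr [OF W l])
    then obtain a b Z where P: "P a b Z" by blast
    then have ab: "a \<noteq> b" unfolding P_def by (rule conjunct1)
    from P have Z: "\<forall>Z'. (\<forall>s t. \<not> ((s = a \<or> s = b) \<and> (t = a \<or> t = b)) \<longrightarrow> Z' $ s $ t = Z $ s $ t) \<longrightarrow>
       udiag W (\<lambda>j. of_real (y j)) = y l *\<^sub>R mat 1 + corank2 a b Z'"
      unfolding P_def by (rule conjunct2)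
    \<comment> \<open>The four free entries are filled with the repeated eigenvalue, the two
      coordinates of k, and zero, which puts \<open>Z'\<close> on the hyperplane.\<close>
    define Z' :: "real ^ 'n ^ 'n" where "Z' = (\<chi> s t. if s = a \<and> t = a then y l else if s = a \<and> t = b then k $ 1
      else if s = b \<and> t = a then k $ 2 else if s = b \<and> t = b then 0 else Z $ s $ t)"
    have Y: "udiag W (\<lambda>j. of_real (y j)) = (Z' $ a $ a) *\<^sub>R mat 1 + corank2 a b Z'"
    proof -
      have "udiag W (\<lambda>j. of_real (y j)) = y l *\<^sub>R mat 1 + corank2 a b Z'"
      proof (rule Z [THEN spec, THEN mp], intro allI impI)
        fix s t assume "\<not> ((s = a \<or> s = b) \<and> (t = a \<or> t = b))"
        then have "\<not> (s = a \<and> t = a)" "\<not> (s = a \<and> t = b)" "\<not> (s = b \<and> t = a)" "\<not> (s = b \<and> t = b)"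
          by blast+
        then show "Z' $ s $ t = Z $ s $ t" by (simp only: Z'_def vec_lambda_beta if_False)
      qed
      moreover have "Z' $ a $ a = y l" by (simp add: Z'_def)
      ultimately show ?thesis by (simp only:)
    qed
    have kk: "kpt a b Z' = k"
      using ab by (auto simp: kpt_def Z'_def vec_eq_iff forall_2)
    have *: "cscale (cis t) (cayley ((Z' $ a $ a) *\<^sub>R mat 1 + corank2 a b Z')) ** cadj (\<alpha> (kpt a b Z')) = cayley ?Q"
      unfolding kk Y [symmetric] D [symmetric] using \<alpha>(2) by simp
    have "Z' \<in> bad_dom \<alpha> f t a b"
      unfolding bad_dom_def mem_Collect_eq * unfolding kk
    proof (intro conjI)
      show "Z' $ b $ b = 0" using ab by (simp add: Z'_def)
    qed (rule k cayinv_cayley(2) [OF Q] det_cayley_denominator [OF selfadj_udiag, of W y, unfolded Y])+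
    moreover have "bad_map \<alpha> f t a b Z' = X"
      unfolding bad_map_def * unfolding kk cayinv_cayley(1) [OF Q] using k by (simp add: hcoord_herm)
    ultimately show "X \<in> (\<Union>t\<in>\<rat>. \<Union>a. \<Union>b. bad_map \<alpha> f t a b ` bad_dom \<alpha> f t a b)"
      using t by blast
  qed
qed

section \<open>Determinant phases and perturbation steps\<close>

text \<open>Two values with the same \<open>cis\<close> are equal or at least 2 pi apart, so the
  range is discrete.\<close>

lemma cis_constant:
  fixes f :: "'a::topological_space \<Rightarrow> real"
  assumes "connected S" "continuous_on S f" "\<And>x. x \<in> S \<Longrightarrow> cis (f x) = c"
  shows "f constant_on S"
proof (rule continuous_discrete_range_constant [OF assms(1,2)])
  fix x assume x: "x \<in> S"
  have "2 * pi \<le> norm (f y - f x)" if "y \<in> S" "f y \<noteq> f x" for y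
  proof (rule ccontr)
    assume "\<not> 2 * pi \<le> norm (f y - f x)"
    then have "\<bar>f y - f x\<bar> < 2 * pi" by simp
    moreover have "cis (f y) = cis (f x)" using assms(3) x that by simp
    ultimately show False using cis_eq_imp_eq that by blast
  qed
  then show "\<exists>e>0. \<forall>y. y \<in> S \<and> f y \<noteq> f x \<longrightarrow> e \<le> norm (f y - f x)"
    by (intro exI [of _ "2 * pi"]) auto
qed

lemma norm_1_exp_cis:
  assumes "norm (exp z) = 1" shows "exp z = cis (Im z)"
proof -
  have "Re z = 0" using assms by simp
  then show ?thesis by (simp add: exp_eq_polar)
qed

lemma det_phase:
  fixes A :: "'a::real_normed_vector \<Rightarrow> 'n::finite cmat"
  assumes "contractible S" "continuous_on S A" "\<And>x. x \<in> S \<Longrightarrow> unitary (A x)"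
  shows "\<exists>\<psi>. continuous_on S \<psi> \<and> (\<forall>x\<in>S. det (A x) = cis (\<psi> x))"
proof -
  have "det (A x) \<noteq> 0" if "x \<in> S" for x using det_unitary_norm [OF assms(3) [OF that]] by auto
  then obtain g where g: "continuous_on S g" "\<And>x. x \<in> S \<Longrightarrow> det (A x) = exp (g x)"
    using continuous_logarithm_on_contractible [OF continuous_on_det [OF assms(2)] assms(1)] by metis
  have "det (A x) = cis (Im (g x))" if "x \<in> S" for x
    using norm_1_exp_cis [of "g x"] g(2) [OF that] det_unitary_norm [OF assms(3) [OF that]] by simp
  moreover have "continuous_on S (\<lambda>x. Im (g x))" using g(1) by (intro continuous_intros)
  ultimately show ?thesis by blast
qed

text \<open>Both \<open>\<psi> (- k) - \<psi> k\<close> and \<open>\<psi> (k + z) - \<psi> k\<close>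
  are constant in k. The first vanishes at 0. The second vanishes at -z/2, because translation by z
  sends this point to its own reflection.\<close>

lemma phase_even_periodic:
  fixes \<psi> :: "real^2 \<Rightarrow> real"
  assumes cont: "continuous_on UNIV \<psi>" and D: "\<And>k. D k = cis (\<psi> k)"
    and even: "\<And>k. D (- k) = D k" and per: "periodic2 D"
  shows "\<psi> (- k) = \<psi> k" "periodic2 \<psi>"
proof -
  have cis_diff: "cis (a - b) = 1" if "cis a = cis b" for a b
    using that by (simp add: cis_divide [symmetric])
  have "(\<lambda>k. \<psi> (- k) - \<psi> k) constant_on UNIV"
  proof (rule cis_constant)
    show "continuous_on UNIV (\<lambda>k. \<psi> (- k) - \<psi> k)"
      by (intro continuous_intros cont continuous_on_compose2 [OF cont]) auto
    show "cis (\<psi> (- k) - \<psi> k) = 1" for k using even [of k] by (intro cis_diff) (simp add: D)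
  qed (rule convex_connected [OF convex_UNIV])
  then obtain c where c: "\<And>k. \<psi> (- k) - \<psi> k = c" by (auto simp: constant_on_def)
  have "c = 0" using c [of 0] by simp
  then have ev: "\<psi> (- k) = \<psi> k" for k using c [of k] by simp
  then show "\<psi> (- k) = \<psi> k" .
  show "periodic2 \<psi>"
    unfolding periodic2_def
  proof (intro allI impI)
    fix k z :: "real^2" assume z: "\<forall>i. z $ i \<in> \<int>"
    have "(\<lambda>k. \<psi> (k + z) - \<psi> k) constant_on UNIV"
    proof (rule cis_constant)
      show "continuous_on UNIV (\<lambda>k. \<psi> (k + z) - \<psi> k)"
        by (intro continuous_intros cont continuous_on_compose2 [OF cont]) auto
      show "cis (\<psi> (k + z) - \<psi> k) = 1" for k
        using periodic2D [OF per, of z k] z by (intro cis_diff) (simp add: D)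
    qed (rule convex_connected [OF convex_UNIV])
    then obtain d where d: "\<And>k. \<psi> (k + z) - \<psi> k = d" by (auto simp: constant_on_def)
    let ?h = "- ((1/2) *\<^sub>R z)"
    have hz: "?h + z = - ?h" by (simp add: vec_eq_iff)
    have "\<psi> (?h + z) = \<psi> ?h" unfolding hz by (rule ev)
    then have "d = 0" using d [of ?h] by linarith
    then show "\<psi> (k + z) = \<psi> k" using d [of k] by simp
  qed
qed

text \<open>The quotient of the determinants stays within distance 1 of 1, away from the branch cut
  of \<open>Ln\<close>. Where the determinants agree the correction is zero, so the old phase
  survives at points that were not perturbed.\<close>

lemma phase_transfer:
  fixes \<alpha> \<beta> :: "'a::topological_space \<Rightarrow> 'n::finite cmat"
  assumes "continuous_on UNIV \<alpha>" "continuous_on UNIV \<beta>" "continuous_on UNIV \<psi>"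
    and unit: "\<And>k. unitary (\<alpha> k)" "\<And>k. unitary (\<beta> k)"
    and D: "\<And>k. det (\<alpha> k) = cis (\<psi> k)" and close: "\<And>k. norm (det (\<beta> k) - det (\<alpha> k)) < 1"
  defines "\<psi>' \<equiv> \<lambda>k. \<psi> k + Im (Ln (det (\<beta> k) / det (\<alpha> k)))"
  shows "continuous_on UNIV \<psi>'" "det (\<beta> k) = cis (\<psi>' k)"
proof -
  have n: "norm (det (\<alpha> k)) = 1" "norm (det (\<beta> k)) = 1" "det (\<alpha> k) \<noteq> 0" "det (\<beta> k) \<noteq> 0" for k
    using det_unitary_norm [OF unit(1), of k] det_unitary_norm [OF unit(2), of k] by auto
  let ?r = "\<lambda>k. det (\<beta> k) / det (\<alpha> k)"
  have rp: "?r k \<notin> \<real>\<^sub>\<le>\<^sub>0" for k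
  proof -
    have "?r k - 1 = (det (\<beta> k) - det (\<alpha> k)) / det (\<alpha> k)" using n by (simp add: field_simps)
    then have "norm (?r k - 1) < 1" using close [of k] n by (simp add: norm_divide)
    then have "Re (?r k) > 0" using abs_Re_le_cmod [of "?r k - 1"] by simp
    then show ?thesis by (auto simp: complex_nonpos_Reals_iff)
  qed
  show "continuous_on UNIV \<psi>'"
    unfolding \<psi>'_def using n rp
    by (intro continuous_on_add assms continuous_on_Im continuous_on_Ln' continuous_on_divide continuous_on_det) auto
  have "norm (exp (Ln (?r k))) = 1" using n by (simp add: norm_divide)
  then have "?r k = cis (Im (Ln (?r k)))" using norm_1_exp_cis [of "Ln (?r k)"] n by simp
  then have "cis (\<psi> k) * cis (Im (Ln (?r k))) = det (\<beta> k)" using n [of k] by (simp flip: D)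
  then show "det (\<beta> k) = cis (\<psi>' k)" by (simp add: \<psi>'_def cis_mult)
qed

lemma det_uniform:
  obtains \<eta> where "\<eta> > 0" "\<And>U V :: 'n::finite cmat. unitary U \<Longrightarrow> unitary V \<Longrightarrow> norm (U - V) < \<eta> \<Longrightarrow> norm (det U - det V) < 1"
proof -
  have "uniformly_continuous_on {U :: 'n cmat. unitary U} det"
    by (intro compact_uniformly_continuous compact_unitary continuous_on_det continuous_on_id)
  then obtain d where "d > 0" "\<And>U V :: 'n cmat. unitary U \<Longrightarrow> unitary V \<Longrightarrow> dist V U < d \<Longrightarrow> dist (det V) (det U) < 1"
    unfolding uniformly_continuous_on_def by (metis mem_Collect_eq zero_less_one)
  then show ?thesis using that [of d] by (metis dist_norm)
qed

lemma cayley_0 [simp]: "cayley (0 :: 'n::finite cmat) = mat 1"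
proof -
  have "cscale \<i> (0 :: 'n cmat) = 0" by (simp add: cscale_def vec_eq_iff)
  then show ?thesis by (simp add: cayley_def minv_unique [of "mat 1" "mat 1"])
qed

lemma selfadj_0: "selfadj 0"
  by (simp add: selfadj_def cadj_def vec_eq_iff)

lemma cayley_small:
  assumes "\<eta> > 0"
  obtains \<delta> where "\<delta> > 0" "\<And>X :: 'n::finite cmat. norm X < \<delta> \<Longrightarrow> norm (cayley X - mat 1) < \<eta>"
proof -
  have "cayley differentiable (at (0 :: 'n cmat))"
    by (rule differentiable_cayley) (use det_cayley_denominator [OF selfadj_0] in simp_all)
  then have "continuous (at 0) (cayley :: 'n cmat \<Rightarrow> _)" by (rule differentiable_imp_continuous_within)
  then obtain d where "d > 0" "\<And>X :: 'n cmat. dist X 0 < d \<Longrightarrow> dist (cayley X) (cayley 0) < \<eta>"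
    using assms unfolding continuous_at_eps_delta by metis
  then show ?thesis using that [of d] by (simp add: dist_norm)
qed

lemma differentiable_reflect:
  fixes f :: "real^2 \<Rightarrow> 'a::real_normed_vector"
  assumes "\<And>k. f differentiable (at k)" shows "(\<lambda>k. f (- k)) differentiable (at k)"
  using differentiable_chain_at [of uminus k f] assms by (simp add: o_def)

lemma differentiable_continuous_on:
  assumes "\<And>k. f differentiable (at k)" shows "continuous_on UNIV f"
  using assms by (meson continuous_at_imp_continuous_on differentiable_imp_continuous_within)

section \<open>Perturbations that respect the matching relation\<close>

definition regular_family :: "'n::finite cmat \<Rightarrow> (real^2 \<Rightarrow> 'n cmat) \<Rightarrow> bool" where
  "regular_family \<epsilon> \<alpha> \<longleftrightarrow> matching_family \<epsilon> \<alpha> \<and> (\<forall>k. \<alpha> differentiable (at k))"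

text \<open>The right factor is the time reversal of the left factor taken at -k, so the product
  satisfies the matching relation for an arbitrary Hermitian \<open>F\<close>.\<close>

definition perturb :: "'n::finite cmat \<Rightarrow> (real^2 \<Rightarrow> 'n cmat) \<Rightarrow> (real^2 \<Rightarrow> 'n cmat) \<Rightarrow> real^2 \<Rightarrow> 'n cmat" where
  "perturb \<epsilon> F \<alpha> k = cayley (F k) ** \<alpha> k ** twist \<epsilon> (cayley (F (- k)))"

lemma regular_perturb:
  assumes e: "real_orth \<epsilon>" and \<alpha>: "regular_family \<epsilon> \<alpha>"
    and F: "\<And>k. F differentiable (at k)" "\<And>k. selfadj (F k)" "periodic2 F"
  shows "regular_family \<epsilon> (perturb \<epsilon> F \<alpha>)"
proof -
  have \<alpha>': "\<And>k. \<alpha> differentiable (at k)" "\<And>k. unitary (\<alpha> k)" "periodic2 \<alpha>" "\<And>k. \<alpha> k = twist \<epsilon> (\<alpha> (- k))"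
    using \<alpha> unfolding regular_family_def matching_family_def matching_rel_iff [OF e] by blast+
  have c: "(\<lambda>k. cayley (F k)) differentiable (at k)" for k
    by (intro differentiable_cayley F det_cayley_denominator)
  have d: "perturb \<epsilon> F \<alpha> differentiable (at k)" for k
    unfolding perturb_def [abs_def]
    by (intro differentiable_cmat_mult c \<alpha>' differentiable_bounded_linear [OF bounded_linear_twist] differentiable_reflect [OF c])
  have per: "periodic2 (perturb \<epsilon> F \<alpha>)"
    unfolding periodic2_def
  proof (intro allI impI)
    fix k z :: "real^2" assume z: "\<forall>i. z $ i \<in> \<int>"
    then have "F (k + z) = F k" "\<alpha> (k + z) = \<alpha> k" "F (- k + - z) = F (- k)"
      by (intro periodic2D F \<alpha>'; simp)+
    then show "perturb \<epsilon> F \<alpha> (k + z) = perturb \<epsilon> F \<alpha> k"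
      by (simp add: perturb_def)
  qed
  have "perturb \<epsilon> F \<alpha> k = twist \<epsilon> (perturb \<epsilon> F \<alpha> (- k))" for k
    using \<alpha>'(4) [of k] by (simp add: perturb_def twist_mult [OF e] twist_twist [OF e] matrix_mul_assoc)
  then show ?thesis
    unfolding regular_family_def matching_family_def matching_rel_iff [OF e]
    using d per by (intro conjI allI differentiable_continuous_on)
      (auto simp: perturb_def intro!: unitary_mult unitary_cayley twist_unitary e F \<alpha>')
qed

lemma cmat_diff_mult: "(A - B) ** C = A ** C - B ** (C :: 'n::finite cmat)"
  "C ** (A - B) = C ** A - C ** B"
  by (simp_all add: matrix_matrix_mult_def vec_eq_iff algebra_simps sum_subtractf)

lemma perturb_close:
  assumes e: "real_orth \<epsilon>" and \<alpha>: "\<And>k. unitary (\<alpha> k)" and F: "\<And>k. selfadj (F k)"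
    and \<eta>: "\<And>k. norm (cayley (F k) - mat 1) < \<eta>"
  shows "norm (perturb \<epsilon> F \<alpha> k - \<alpha> k) < 2 * \<eta>"
proof -
  let ?T = "twist \<epsilon> (cayley (F (- k)))"
  have "perturb \<epsilon> F \<alpha> k - \<alpha> k = (cayley (F k) - mat 1) ** (\<alpha> k ** ?T) + \<alpha> k ** (?T - mat 1)"
  proof -
    have "(A - mat 1) ** (B ** C) + B ** (C - mat 1) = A ** B ** C - B" for A B C :: "'a cmat"
      by (simp add: cmat_diff_mult matrix_mul_assoc)
    then show ?thesis by (simp add: perturb_def)
  qed
  also have "norm \<dots> \<le> norm ((cayley (F k) - mat 1) ** (\<alpha> k ** ?T)) + norm (\<alpha> k ** (?T - mat 1))"
    by (rule norm_triangle_ineq)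
  also have "\<dots> = norm (cayley (F k) - mat 1) + norm (?T - mat 1)"
    by (simp add: norm_mult_unitary_left norm_mult_unitary_right unitary_mult \<alpha> twist_unitary [OF e] unitary_cayley F)
  also have "norm (?T - mat 1) = norm (cayley (F (- k)) - mat 1)"
  proof -
    have "?T - mat 1 = twist \<epsilon> (cayley (F (- k)) - mat 1)"
      using linear_diff [OF bounded_linear.linear [OF bounded_linear_twist], of \<epsilon>] by (simp add: e)
    then show ?thesis by (simp add: norm_twist [OF e])
  qed
  also have "norm (cayley (F k) - mat 1) + norm (cayley (F (- k)) - mat 1) < 2 * \<eta>"
    using \<eta> [of k] \<eta> [of "- k"] by simp
  finally show ?thesis .
qed

lemma small_generic:
  fixes S :: "'a::euclidean_space set"
  assumes "negligible S" "\<delta> > 0"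
  obtains X where "norm X < \<delta>" "X \<notin> S"
proof -
  have "\<not> negligible (ball (0::'a) \<delta>)"
    using assms(2) by (simp add: open_not_negligible)
  then have "\<not> ball 0 \<delta> \<subseteq> S" using assms(1) negligible_subset by blast
  then show ?thesis using that by (auto simp: subset_iff)
qed

text \<open>The exceptional set is null and balls are not. One X serves all k, because that null set
  already collects the exceptional parameters of every k.\<close>

lemma small_generic_hermitian:
  fixes \<alpha> :: "real^2 \<Rightarrow> 'n::finite cmat"
  assumes "\<And>k. \<alpha> differentiable (at k)" "\<And>k. unitary (\<alpha> k)" "\<And>k. f differentiable (at k)" "\<delta> > 0"
  shows "\<exists>X. selfadj X \<and> norm X < \<delta> \<and> (\<forall>k. f k \<noteq> 0 \<longrightarrow> simple_spec (cayley (f k *\<^sub>R X) ** \<alpha> k))"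
proof -
  obtain B where B: "B > 0" "\<And>Y. norm (herm Y :: 'n cmat) \<le> norm Y * B"
    using bounded_linear.pos_bounded [OF bounded_linear_herm] by blast
  obtain Y where Y: "norm Y < \<delta> / B"
    "Y \<notin> {X. \<exists>k. f k \<noteq> 0 \<and> \<not> simple_spec (cayley (f k *\<^sub>R herm X) ** \<alpha> k)}"
    by (rule small_generic [OF negligible_degenerate [OF assms(1-3)] divide_pos_pos [OF assms(4) B(1)]])
  have "norm (herm Y :: 'n cmat) < \<delta>"
    using B(2) [of Y] Y(1) B(1) by (simp add: pos_less_divide_eq)
  with Y(2) show ?thesis by (intro exI [of _ "herm Y"]) auto
qed

text \<open>As \<open>f\<close> never acts at both k and -k, at most one Cayley factor is nontrivial
  at each point and the one-sided genericity applies. At the reflected points simplicity comes from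
  \<open>twist\<close>, which preserves the spectrum.\<close>

lemma perturb_generic:
  fixes f :: "real^2 \<Rightarrow> real"
  assumes e: "real_orth \<epsilon>" and \<alpha>: "regular_family \<epsilon> \<alpha>" and \<eta>: "\<eta> > 0"
    and f: "\<And>k. f differentiable (at k)" "periodic2 f" "\<And>k. \<bar>f k\<bar> \<le> 1" "\<And>k. f k \<noteq> 0 \<Longrightarrow> f (- k) = 0"
  obtains \<beta> where "regular_family \<epsilon> \<beta>" "\<And>k. norm (\<beta> k - \<alpha> k) < \<eta>"
    "\<And>k. f k = 0 \<Longrightarrow> f (- k) = 0 \<Longrightarrow> \<beta> k = \<alpha> k"
    "\<And>k. f k \<noteq> 0 \<or> f (- k) \<noteq> 0 \<Longrightarrow> simple_spec (\<beta> k)"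
proof -
  have \<alpha>': "\<And>k. \<alpha> differentiable (at k)" "\<And>k. unitary (\<alpha> k)"
    using \<alpha> by (auto simp: regular_family_def matching_family_def)
  obtain \<delta> where \<delta>: "\<delta> > 0" "\<And>X :: 'a cmat. norm X < \<delta> \<Longrightarrow> norm (cayley X - mat 1) < \<eta> / 2"
    using cayley_small [of "\<eta> / 2"] \<eta> by (metis half_gt_zero)
  obtain X where X: "selfadj X" "norm X < \<delta>" "\<And>k. f k \<noteq> 0 \<Longrightarrow> simple_spec (cayley (f k *\<^sub>R X) ** \<alpha> k)"
    using small_generic_hermitian [OF \<alpha>' f(1) \<delta>(1)] by blast
  define F where "F k = f k *\<^sub>R X" for k
  have sF: "selfadj (F k)" for k by (simp add: F_def selfadj_scaleR X)
  have dF: "F differentiable (at k)" for k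
    unfolding F_def [abs_def] by (intro differentiable_scaleR f differentiable_const)
  have pF: "periodic2 F" using f(2) by (simp add: periodic2_def F_def)
  have reg: "regular_family \<epsilon> (perturb \<epsilon> F \<alpha>)" by (rule regular_perturb [OF e \<alpha> dF sF pF])
  have simp1: "simple_spec (perturb \<epsilon> F \<alpha> k)" if "f k \<noteq> 0" for k
  proof -
    have "F (- k) = 0" using f(4) [OF that] by (simp add: F_def)
    then have "perturb \<epsilon> F \<alpha> k = cayley (F k) ** \<alpha> k"
      by (simp add: perturb_def e)
    then show ?thesis using X(3) [OF that] by (simp add: F_def)
  qed
  show ?thesis
  proof (rule that [of "perturb \<epsilon> F \<alpha>"])
    show "regular_family \<epsilon> (perturb \<epsilon> F \<alpha>)" by fact
    have "norm (cayley (F k) - mat 1) < \<eta> / 2" for k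
    proof (rule \<delta>(2))
      have "norm (F k) \<le> norm X"
        using f(3) [of k] by (simp add: F_def mult_left_le_one_le)
      also have "\<dots> < \<delta>" by (rule X)
      finally show "norm (F k) < \<delta>" .
    qed
    from perturb_close [OF e \<alpha>'(2) sF this] show "norm (perturb \<epsilon> F \<alpha> k - \<alpha> k) < \<eta>" for k by simp
    show "perturb \<epsilon> F \<alpha> k = \<alpha> k" if "f k = 0" "f (- k) = 0" for k
      using that by (simp add: perturb_def F_def e)
    show "simple_spec (perturb \<epsilon> F \<alpha> k)" if "f k \<noteq> 0 \<or> f (- k) \<noteq> 0" for k
    proof (cases "f k \<noteq> 0")
      case False
      with that have "simple_spec (perturb \<epsilon> F \<alpha> (- k))" by (intro simp1) auto
      moreover have "perturb \<epsilon> F \<alpha> k = twist \<epsilon> (perturb \<epsilon> F \<alpha> (- k))"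
        using reg unfolding regular_family_def matching_family_def matching_rel_iff [OF e] by blast
      ultimately show ?thesis using simple_spec_twist [OF e] by metis
    qed (rule simp1)
  qed
qed

section \<open>Time-reversal invariant momenta\<close>

definition even_frame :: "'n::finite cmat \<Rightarrow> 'n cmat \<Rightarrow> real \<Rightarrow> ('n cmat \<times> (real ^ 'n)) set" where
  "even_frame \<epsilon> A \<psi> = {p \<in> logframe A \<psi>. twist \<epsilon> (hmat p) = hmat p}"

text \<open>With \<tau> the identity, \<open>twist\<close> fixes \<open>udiag W x\<close> for every
  \<open>x\<close>, so any phases in the frame \<open>W\<close> give a time-reversal invariant
  logarithm. All that remains is to reach the trace \<psi>.\<close>

lemma even_frame_exists_id:
  assumes comp: "compatible \<epsilon> id" and A: "unitary A" "twist \<epsilon> A = A" and D: "det A = cis \<psi>"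
  shows "even_frame \<epsilon> A \<psi> \<noteq> {}"
proof -
  obtain W d where W: "unitary W" "A = udiag W d" "\<And>x. twist \<epsilon> (udiag W x) = udiag W (x \<circ> id)"
    using spectral_kramers [OF comp normal_unitary [OF A(1)] A(2)] by metis
  have "norm (d j) = 1" for j using unitary_udiag_norm [OF W(1)] A(1) W(2) by simp
  then have d: "cis (Arg (d j)) = d j" for j
    using rcis_cmod_Arg [of "d j"] by (simp add: rcis_def)
  have "cis (\<Sum>j\<in>UNIV. Arg (d j)) = cis \<psi>"
    using D W by (simp add: cis_sum d det_udiag)
  then obtain n :: int where n: "\<psi> = (\<Sum>j\<in>UNIV. Arg (d j)) + 2 * pi * n" by (metis cis_eq_cis)
  have "Arg z - Arg w \<le> 2 * pi" for z w using Arg_bounded [of z] Arg_bounded [of w] by linarith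
  then have "\<forall>i\<in>UNIV. \<forall>j\<in>UNIV. Arg (d i) - Arg (d j) \<le> 2 * pi" by blast
  from shift_phases [OF _ _ this, of n] obtain \<theta> where \<theta>: "\<And>i. cis (\<theta> i) = cis (Arg (d i))"
    "sum \<theta> UNIV = \<psi>" "\<And>i j. \<theta> i - \<theta> j \<le> 2 * pi" using n by auto
  have "(W, \<chi> j. \<theta> j) \<in> even_frame \<epsilon> A \<psi>"
    using W \<theta> by (simp add: even_frame_def logframe_def d hmat_def)
  then show ?thesis by blast
qed

lemma sum_paired:
  assumes "\<forall>i. \<tau> (\<tau> i) = i" "\<forall>i. \<tau> i \<in> J \<longleftrightarrow> i \<notin> J" "\<forall>i. g (\<tau> i) = g i"
  shows "(\<Sum>i\<in>(UNIV :: 'n::finite set). g i) = 2 * (\<Sum>i\<in>J. g i :: real)"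
proof -
  have "(\<Sum>i\<in>- J. g i) = (\<Sum>i\<in>J. g i)"
    by (rule sum.reindex_bij_witness [of _ \<tau> \<tau>]) (use assms in auto)
  moreover have "(\<Sum>i\<in>UNIV. g i) = (\<Sum>i\<in>J. g i) + (\<Sum>i\<in>- J. g i)"
    by (metis finite sum.subset_diff subset_UNIV Compl_eq_Diff_UNIV add.commute)
  ultimately show ?thesis by simp
qed

lemma prod_paired:
  assumes "\<forall>i. \<tau> (\<tau> i) = i" "\<forall>i. \<tau> i \<in> J \<longleftrightarrow> i \<notin> J" "\<forall>i. g (\<tau> i) = g i"
  shows "(\<Prod>i\<in>(UNIV :: 'n::finite set). g i) = (\<Prod>i\<in>J. g i :: 'b::comm_semiring_1)\<^sup>2"
proof -
  have "(\<Prod>i\<in>- J. g i) = (\<Prod>i\<in>J. g i)"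
    by (rule prod.reindex_bij_witness [of _ \<tau> \<tau>]) (use assms in auto)
  moreover have "(\<Prod>i\<in>UNIV. g i) = (\<Prod>i\<in>J. g i) * (\<Prod>i\<in>- J. g i)"
    by (metis finite prod.subset_diff subset_UNIV Compl_eq_Diff_UNIV mult.commute)
  ultimately show ?thesis by (simp add: power2_eq_square)
qed

text \<open>For \<open>\<epsilon> = J\<close> a logarithm commuting with time reversal has doubly degenerate spectrum, so its
  trace is determined modulo \<open>4\<pi>\<close>: exactly one of the phases \<open>\<psi>\<close> and \<open>\<psi> - 2\<pi>\<close> occurs.\<close>
lemma even_frame_exists_paired:
  assumes comp: "compatible \<epsilon> \<tau>" and J: "\<forall>i. \<tau> i \<in> J \<longleftrightarrow> i \<notin> J"
    and A: "unitary A" "twist \<epsilon> A = A" and D: "det A = cis \<psi>"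
  shows "even_frame \<epsilon> A \<psi> \<noteq> {} \<or> even_frame \<epsilon> A (\<psi> - 2 * pi) \<noteq> {}"
proof -
  have tt: "\<forall>i. \<tau> (\<tau> i) = i" using comp by (simp add: compatible_def)
  obtain W d where W: "unitary W" "A = udiag W d" "\<And>x. twist \<epsilon> (udiag W x) = udiag W (x \<circ> \<tau>)"
    and d\<tau>: "d \<circ> \<tau> = d"
    using spectral_kramers [OF comp normal_unitary [OF A(1)] A(2)] by metis
  have d\<tau>': "\<forall>i. d (\<tau> i) = d i" using d\<tau> by (metis comp_apply)
  have "norm (d j) = 1" for j using unitary_udiag_norm [OF W(1)] A(1) W(2) by simp
  then have d: "cis (Arg (d j)) = d j" for j
    using rcis_cmod_Arg [of "d j"] by (simp add: rcis_def)
  let ?S = "\<Sum>j\<in>J. Arg (d j)"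
  have "(\<Sum>j\<in>UNIV. Arg (d j)) = 2 * ?S" by (rule sum_paired [OF tt J]) (simp add: d\<tau>')
  then have "cis (2 * ?S) = (\<Prod>j\<in>UNIV. d j)" using cis_sum [of "\<lambda>j. Arg (d j)" UNIV] by (simp add: d)
  then have "cis (2 * ?S) = cis \<psi>" using D W by (simp add: det_udiag)
  then obtain n :: int where n: "\<psi> = 2 * ?S + 2 * pi * n" by (metis cis_eq_cis)
  \<comment> \<open>Phases are chosen on one member of each pair and copied to the other, so the
    trace moves in steps of 4 pi. The remainder of \<open>n\<close> modulo 2 decides between \<psi>
    and \<psi> - 2 pi.\<close>
  define m where "m = n div 2"
  have Jne: "finite J" "J \<noteq> {}" using J by auto
  have "Arg z - Arg w \<le> 2 * pi" for z w using Arg_bounded [of z] Arg_bounded [of w] by linarith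
  then have "\<forall>i\<in>J. \<forall>j\<in>J. Arg (d i) - Arg (d j) \<le> 2 * pi" by blast
  from shift_phases [OF Jne this, of m] obtain \<theta> where \<theta>: "\<And>i. i \<in> J \<Longrightarrow> cis (\<theta> i) = d i"
    "sum \<theta> J = ?S + 2 * pi * m" "\<And>i j. i \<in> J \<Longrightarrow> j \<in> J \<Longrightarrow> \<theta> i - \<theta> j \<le> 2 * pi" by (auto simp: d)
  define \<phi> where "\<phi> i = (if i \<in> J then \<theta> i else \<theta> (\<tau> i))" for i
  have \<phi>\<tau>: "\<forall>i. \<phi> (\<tau> i) = \<phi> i" using J tt by (auto simp: \<phi>_def)
  have "(\<Sum>i\<in>UNIV. \<phi> i) = 2 * (\<Sum>i\<in>J. \<phi> i)" by (rule sum_paired [OF tt J \<phi>\<tau>])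
  also have "(\<Sum>i\<in>J. \<phi> i) = sum \<theta> J" by (simp add: \<phi>_def)
  finally have sum: "(\<Sum>i\<in>UNIV. \<phi> i) = 2 * ?S + 4 * pi * m" by (simp add: \<theta>)
  have cis: "cis (\<phi> i) = d i" for i using \<theta>(1) J d\<tau>' by (auto simp: \<phi>_def)
  have diam: "\<phi> i - \<phi> j \<le> 2 * pi" for i j using \<theta>(3) J by (auto simp: \<phi>_def)
  have "(\<lambda>j. complex_of_real (\<phi> j)) \<circ> \<tau> = (\<lambda>j. of_real (\<phi> j))" using \<phi>\<tau> by (simp add: fun_eq_iff)
  then have fr: "(W, \<chi> j. \<phi> j) \<in> even_frame \<epsilon> A (\<Sum>i\<in>UNIV. \<phi> i)"
    using W diam by (simp add: even_frame_def logframe_def cis hmat_def)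
  have "n = 2 * m \<or> n = 2 * m + 1" unfolding m_def by presburger
  then have "(\<Sum>i\<in>UNIV. \<phi> i) = \<psi> \<or> (\<Sum>i\<in>UNIV. \<phi> i) = \<psi> - 2 * pi"
    unfolding sum n by (auto simp: algebra_simps)
  then show ?thesis using fr by auto
qed

text \<open>Diagonalising the logarithm itself in a frame adapted to time reversal makes its phases
  constant on the orbits of \<tau>. Functional calculus recovers \<open>A\<close>, and the trace
  recovers the sum.\<close>

lemma even_frame_phase:
  assumes comp: "compatible \<epsilon> \<tau>" and p: "p \<in> even_frame \<epsilon> A \<psi>"
  obtains W r where "unitary W" "A = udiag W (\<lambda>j. cis (r j))" "(\<Sum>j\<in>UNIV. r j) = \<psi>" "\<forall>i. r (\<tau> i) = r i"
proof -
  obtain V \<theta> where [simp]: "p = (V, \<theta>)" by (cases p)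
  have V: "unitary V" "A = udiag V (\<lambda>j. cis (\<theta> $ j))" "(\<Sum>j\<in>UNIV. \<theta> $ j) = \<psi>"
    and tw: "twist \<epsilon> (hmat p) = hmat p"
    using p by (auto simp: even_frame_def logframe_def)
  have "selfadj (hmat p)" by (simp add: hmat_def selfadj_udiag)
  then obtain W d where W: "unitary W" "hmat p = udiag W d" and d: "d \<circ> \<tau> = d"
    using spectral_kramers [OF comp normal_selfadj tw] by metis
  have eq: "udiag V (\<lambda>j. of_real (\<theta> $ j)) = udiag W d" using W(2) by (simp add: hmat_def)
  have "A = udiag W (\<lambda>j. cis (Re (d j)))"
    using udiag_funcalc [OF V(1) W(1) eq, of "\<lambda>z. cis (Re z)"] V(2) by simp
  moreover have "(\<Sum>j\<in>UNIV. Re (d j)) = \<psi>"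
  proof -
    have "(\<Sum>j\<in>UNIV. d j) = (\<Sum>j\<in>UNIV. of_real (\<theta> $ j))"
      using trace_udiag [OF V(1)] trace_udiag [OF W(1)] eq by metis
    then have "Re (\<Sum>j\<in>UNIV. d j) = Re (\<Sum>j\<in>UNIV. of_real (\<theta> $ j))" by simp
    then show ?thesis using V(3) by simp
  qed
  moreover have "\<forall>i. Re (d (\<tau> i)) = Re (d i)" using d by (metis comp_apply)
  ultimately show ?thesis using that [of W "\<lambda>j. Re (d j)"] W(1) by simp
qed

text \<open>The characteristic polynomial is the square of the product over one member of each pair.
  The two frames give two monic square roots, hence the same one. Their constant terms then force
  cis (\<psi>/2) = cis (\<psi>/2 - pi), although these numbers differ by a sign.\<close>

lemma even_frame_exclusive:
  assumes comp: "compatible \<epsilon> \<tau>" and J: "\<forall>i. \<tau> i \<in> J \<longleftrightarrow> i \<notin> J"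
    and p: "p \<in> even_frame \<epsilon> A \<psi>" and q: "q \<in> even_frame \<epsilon> A (\<psi> - 2 * pi)"
  shows False
proof -
  have tt: "\<forall>i. \<tau> (\<tau> i) = i" using comp by (simp add: compatible_def)
  obtain W r where W: "unitary W" "A = udiag W (\<lambda>j. cis (r j))" and r: "(\<Sum>j\<in>UNIV. r j) = \<psi>" "\<forall>i. r (\<tau> i) = r i"
    using even_frame_phase [OF comp p] by metis
  obtain V s where V: "unitary V" "A = udiag V (\<lambda>j. cis (s j))" and s: "(\<Sum>j\<in>UNIV. s j) = \<psi> - 2 * pi" "\<forall>i. s (\<tau> i) = s i"
    using even_frame_phase [OF comp q] by metis
  obtain \<pi> where \<pi>: "\<pi> permutes UNIV" "\<forall>i. cis (r i) = cis (s (\<pi> i))"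
    using udiag_matching [OF W(1) V(1)] W(2) V(2) by metis
  let ?P = "\<lambda>r :: 'a \<Rightarrow> real. \<Prod>i\<in>J. [:- cis (r i), 1:]"
  have "(\<Prod>i\<in>UNIV. [:- cis (r i), 1:]) = (\<Prod>i\<in>UNIV. [:- cis (s i), 1:])"
    using prod.permute [OF \<pi>(1), of "\<lambda>i. [:- cis (s i), 1:]"] \<pi>(2) by (simp add: o_def)
  moreover have "(\<Prod>i\<in>UNIV. [:- cis (r i), 1:]) = (?P r)\<^sup>2" by (rule prod_paired [OF tt J]) (simp add: r)
  moreover have "(\<Prod>i\<in>UNIV. [:- cis (s i), 1:]) = (?P s)\<^sup>2" by (rule prod_paired [OF tt J]) (simp add: s)
  ultimately have "?P r = ?P s \<or> ?P r = - ?P s" by (simp add: power2_eq_iff)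
  moreover have lead: "lead_coeff (?P r) = 1" for r by (simp add: lead_coeff_prod)
  then have "?P r \<noteq> - ?P s"
    by (metis lead_coeff_minus one_neq_neg_one)
  ultimately have "poly (?P r) 0 = poly (?P s) 0" by metis
  then have "(\<Prod>i\<in>J. cis (r i)) = (\<Prod>i\<in>J. cis (s i))"
    by (simp add: poly_prod prod_uminus)
  then have "cis (sum r J) = cis (sum s J)" by (simp add: cis_sum)
  moreover have "sum r J = \<psi> / 2" using sum_paired [OF tt J r(2)] r(1) by simp
  moreover have "sum s J = \<psi> / 2 - pi" using sum_paired [OF tt J s(2)] s(1) by simp
  ultimately have "cis (\<psi> / 2) = cis (\<psi> / 2 - pi)" by simp
  then have "\<psi> / 2 = \<psi> / 2 - pi" by (rule cis_eq_imp_eq) simp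
  then show False by simp
qed

lemma continuous_on_hmat: "continuous_on UNIV hmat"
  unfolding hmat_def [abs_def]
  by (intro continuous_on_udiag continuous_on_of_real continuous_on_component continuous_on_fst continuous_on_snd continuous_on_id)

lemma closed_even_frame:
  fixes A :: "'a::euclidean_space \<Rightarrow> 'n::finite cmat"
  assumes "continuous_on UNIV A" "continuous_on UNIV \<psi>"
  shows "closed {(p, k). p \<in> even_frame \<epsilon> (A k) (\<psi> k)}"
proof -
  have "{(p, k). p \<in> even_frame \<epsilon> (A k) (\<psi> k)} = {(p, k). p \<in> logframe (A k) (\<psi> k)} \<inter>
    {x. twist \<epsilon> (hmat (fst x)) = hmat (fst x)}"
    by (auto simp: even_frame_def)
  moreover have h: "continuous_on UNIV (\<lambda>x :: ('n cmat \<times> (real ^ 'n)) \<times> 'a. hmat (fst x))"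
    by (intro continuous_on_compose2 [OF continuous_on_hmat] continuous_on_fst continuous_on_id) auto
  have "closed {x :: ('n cmat \<times> (real ^ 'n)) \<times> 'a. twist \<epsilon> (hmat (fst x)) = hmat (fst x)}"
    by (intro closed_Collect_eq h bounded_linear.continuous_on [OF bounded_linear_twist])
  ultimately show ?thesis using closed_logframe [OF assms] by (simp add: closed_Int)
qed

text \<open>The set of times is again the projection of a closed relation along a compact set of
  frames; boundedness of \<psi> supplies the compactness.\<close>

lemma closed_even_frame_times:
  fixes A :: "real \<Rightarrow> 'n::finite cmat"
  assumes A: "continuous_on UNIV A" "continuous_on UNIV \<psi>" and b: "\<And>t. \<bar>\<psi> t\<bar> \<le> b"
  shows "closed {t. even_frame \<epsilon> (A t) (\<psi> t) \<noteq> {}}"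
proof -
  have "even_frame \<epsilon> (A t) (\<psi> t) \<subseteq> frames (b + 2 * pi)" for t
  proof
    fix p assume p: "p \<in> even_frame \<epsilon> (A t) (\<psi> t)"
    obtain W \<theta> where [simp]: "p = (W, \<theta>)" by (cases p)
    have p': "(W, \<theta>) \<in> logframe (A t) (\<psi> t)" using p by (simp add: even_frame_def)
    have "\<bar>\<theta> $ j\<bar> \<le> b + 2 * pi" for j
      using logframe_bound [OF p', of j] b [of t] by simp
    then show "p \<in> frames (b + 2 * pi)" using p' by (simp add: frames_iff logframe_def)
  qed
  then have "{t. even_frame \<epsilon> (A t) (\<psi> t) \<noteq> {}} =
    {t. \<exists>p. p \<in> frames (b + 2 * pi) \<and> (p, t) \<in> {(p, k). p \<in> even_frame \<epsilon> (A k) (\<psi> k)}}"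
    by blast
  then show ?thesis
    using closed_compact_projection [OF compact_frames closed_even_frame [OF A]] by simp
qed

lemma zero_even_frame: "(mat 1, 0) \<in> even_frame \<epsilon> (mat 1) 0"
proof -
  have "udiag (mat 1) (\<lambda>_. 0) = (0 :: 'a cmat)" by (simp add: vec_eq_iff udiag_entry)
  then have "hmat (mat 1, 0) = (0 :: 'a cmat)" by (simp add: hmat_def)
  moreover have "twist \<epsilon> (0 :: 'a cmat) = 0"
    using linear_0 [OF bounded_linear.linear [OF bounded_linear_twist]] .
  ultimately show ?thesis by (simp add: even_frame_def logframe_def)
qed

text \<open>The times at which \<psi> occurs and those at which \<psi> - 2 pi occurs are closed,
  disjoint and cover the line. By connectedness one set is empty, and the trivial end lies in the
  first.\<close>

lemma even_frame_homotopy: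
  fixes A :: "real \<Rightarrow> 'n::finite cmat"
  assumes comp: "compatible \<epsilon> \<tau>" and J: "\<forall>i. \<tau> i \<in> J \<longleftrightarrow> i \<notin> J"
    and A: "continuous_on {0..1} A" "\<And>t. t \<in> {0..1} \<Longrightarrow> unitary (A t) \<and> twist \<epsilon> (A t) = A t"
    and \<psi>: "continuous_on {0..1} \<psi>" "\<And>t. t \<in> {0..1} \<Longrightarrow> det (A t) = cis (\<psi> t)"
    and one: "A 1 = mat 1" "\<psi> 1 = 0"
  shows "even_frame \<epsilon> (A 0) (\<psi> 0) \<noteq> {}"
proof -
  \<comment> \<open>Clamping extends the homotopy from the unit interval to all real times.\<close>
  define c where "c t = max 0 (min 1 t)" for t :: real
  have c: "c t \<in> {0..1}" for t by (simp add: c_def)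
  have cc: "continuous_on UNIV c" unfolding c_def [abs_def] by (intro continuous_intros)
  have A': "continuous_on UNIV (\<lambda>t. A (c t))" by (rule continuous_on_compose2 [OF A(1) cc]) (use c in auto)
  have \<psi>': "continuous_on UNIV (\<lambda>t. \<psi> (c t))" by (rule continuous_on_compose2 [OF \<psi>(1) cc]) (use c in auto)
  have "compact (\<psi> ` {0..1})" by (intro compact_continuous_image \<psi>) simp
  then obtain b where b: "\<And>t. t \<in> {0..1} \<Longrightarrow> \<bar>\<psi> t\<bar> \<le> b"
    using compact_imp_bounded bounded_iff by (metis image_eqI real_norm_def)
  let ?S1 = "{t. even_frame \<epsilon> (A (c t)) (\<psi> (c t)) \<noteq> {}}"
  let ?S2 = "{t. even_frame \<epsilon> (A (c t)) (\<psi> (c t) - 2 * pi) \<noteq> {}}"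
  have 1: "closed ?S1" by (rule closed_even_frame_times [OF A' \<psi>']) (rule b [OF c])
  have 2: "closed ?S2"
  proof (rule closed_even_frame_times [OF A'])
    show "continuous_on UNIV (\<lambda>t. \<psi> (c t) - 2 * pi)" by (intro continuous_intros \<psi>')
    show "\<bar>\<psi> (c t) - 2 * pi\<bar> \<le> b + 2 * pi" for t using b [OF c [of t]] pi_gt_zero by linarith
  qed
  have 3: "UNIV \<subseteq> ?S1 \<union> ?S2"
    using even_frame_exists_paired [OF comp J] A(2) [OF c] \<psi>(2) [OF c] by blast
  have 4: "?S1 \<inter> ?S2 \<inter> UNIV = {}"
    using even_frame_exclusive [OF comp J] by blast
  have "1 \<in> ?S1" using zero_even_frame one by (auto simp: c_def)
  then have "?S2 = {}"
    using connected_UNIV 1 2 3 4 unfolding connected_closed by blast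
  then have "0 \<in> ?S1" using 3 by blast
  then show ?thesis by (simp add: c_def)
qed

text \<open>Moving every phase towards the mean \<psi>/m, with m the matrix size, by a fraction s
  keeps the trace and multiplies the diameter by 1 - s, which makes it strictly less than 2 pi. The
  correction is a function of a time-reversal invariant logarithm, hence invariant itself.\<close>

lemma even_frame_perturb:
  assumes e: "real_orth \<epsilon>" and p: "even_frame \<epsilon> A \<psi> \<noteq> {}" and \<delta>: "\<delta> > 0"
  shows "\<exists>X. selfadj X \<and> twist \<epsilon> X = X \<and> norm X < \<delta> \<and> gapped (cayley X ** A ** cayley X) \<psi>"
proof -
  obtain W \<theta> where WT: "(W, \<theta>) \<in> even_frame \<epsilon> A \<psi>" using p by fastforce
  then have W: "unitary W" "A = udiag W (\<lambda>j. cis (\<theta> $ j))" "(\<Sum>j\<in>UNIV. \<theta> $ j) = \<psi>"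
    and diam: "\<And>i j. \<theta> $ i - \<theta> $ j \<le> 2 * pi" and tw: "twist \<epsilon> (hmat (W, \<theta>)) = hmat (W, \<theta>)"
    by (auto simp: even_frame_def logframe_def)
  define m where "m = \<psi> / real CARD('a)"
  \<comment> \<open>One factor 2 because the Cayley factor stands on both sides of \<open>A\<close>,
    another because \<open>cay\<close> doubles the angle whose tangent it is given.\<close>
  define x where "x s j = s * (m - \<theta> $ j) / 4" for s j
  define X where "X s = udiag W (\<lambda>j. of_real (tan (x s j)))" for s
  have xlim: "((\<lambda>s. x s j) \<longlongrightarrow> 0) (at_right 0)" for j
    unfolding x_def by (auto intro!: tendsto_eq_intros)
  have "((\<lambda>s. tan (x s j)) \<longlongrightarrow> 0) (at_right 0)" for j
    using tendsto_tan [OF xlim [of j]] by simp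
  then have "(X \<longlongrightarrow> udiag W (\<lambda>j. of_real 0)) (at_right 0)"
    unfolding X_def by (intro vec_tendstoI, unfold udiag_entry) (intro tendsto_intros)
  moreover have "udiag W (\<lambda>j. of_real 0) = 0" by (simp add: vec_eq_iff udiag_entry)
  ultimately have "eventually (\<lambda>s. dist (X s) 0 < \<delta>) (at_right 0)"
    using tendstoD [OF _ \<delta>] by metis
  moreover have "eventually (\<lambda>s. \<forall>j. cos (x s j) > 0) (at_right 0)"
  proof (rule eventually_all_finite)
    fix j
    have "((\<lambda>s. cos (x s j)) \<longlongrightarrow> 1) (at_right 0)"
      using tendsto_cos [OF xlim [of j]] by simp
    then show "eventually (\<lambda>s. cos (x s j) > 0) (at_right 0)"
      by (rule order_tendstoD) simp
  qed
  moreover have "eventually (\<lambda>s::real. s \<in> {0<..<1}) (at_right 0)"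
    by (rule eventually_at_right_real) simp
  ultimately have "eventually (\<lambda>s. dist (X s) 0 < \<delta> \<and> (\<forall>j. cos (x s j) > 0) \<and> s \<in> {0<..<1}) (at_right 0)"
    by (intro eventually_conj)
  then obtain s where s: "dist (X s) 0 < \<delta>" "\<And>j. cos (x s j) > 0" "0 < s" "s < 1"
    using eventually_happens [of _ "at_right (0::real)"] by auto
  have "udiag (transpose \<epsilon> ** cnjm W) (\<lambda>j. of_real (\<theta> $ j)) = udiag W (\<lambda>j. of_real (\<theta> $ j))"
    using tw by (simp add: hmat_def twist_udiag [OF e])
  from udiag_funcalc [OF unitary_twist_frame [OF e W(1)] W(1) this, of "\<lambda>z. of_real (tan (s * (m - Re z) / 4))"]
  have "twist \<epsilon> (X s) = X s" by (simp add: X_def x_def twist_udiag [OF e])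
  moreover have "selfadj (X s)" by (simp add: X_def selfadj_udiag)
  moreover have "norm (X s) < \<delta>" using s(1) by simp
  moreover have "gapped (cayley (X s) ** A ** cayley (X s)) \<psi>"
  proof -
    let ?t = "\<lambda>j. \<theta> $ j + s * (m - \<theta> $ j)"
    have "cayley (X s) = udiag W (\<lambda>j. cis (2 * x s j))"
    proof -
      have "cos (x s j) \<noteq> 0" for j using s(2) [of j] by simp
      then show ?thesis unfolding X_def cayley_udiag [OF W(1)] by (simp add: cay_tan)
    qed
    then have "cayley (X s) ** A ** cayley (X s) = udiag W (\<lambda>j. cis (?t j))"
      unfolding W(2) by (simp add: udiag_mult W(1) cis_mult x_def algebra_simps)
    moreover have "(\<Sum>j\<in>UNIV. ?t j) = \<psi>"
      using W(3) by (simp add: sum.distrib sum_subtractf m_def flip: sum_distrib_left)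
    moreover have "?t i - ?t j < 2 * pi" for i j
    proof -
      have "?t i - ?t j = (1 - s) * (\<theta> $ i - \<theta> $ j)" by (simp add: algebra_simps)
      also have "\<dots> \<le> (1 - s) * (2 * pi)" using s diam by (intro mult_left_mono) auto
      also have "\<dots> < 2 * pi" using s pi_gt_zero by (simp add: algebra_simps)
      finally show ?thesis .
    qed
    ultimately have "(W, \<chi> j. ?t j) \<in> logframe (cayley (X s) ** A ** cayley (X s)) \<psi>"
      "\<forall>i j. (\<chi> j. ?t j) $ i - (\<chi> j. ?t j) $ j < 2 * pi"
      using W(1) by (simp_all add: logframe_def less_imp_le)
    then show ?thesis unfolding gapped_def by blast
  qed
  ultimately show ?thesis by blast
qed

section \<open>The four invariant momenta modulo the lattice\<close>

definition trim :: "real^2 \<Rightarrow> bool" where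
  "trim k \<longleftrightarrow> (\<forall>i. sin (2 * pi * k $ i) = 0)"

text \<open>The vanishing sines say that 2 k is integral, so k and -k differ by a lattice
  vector.\<close>

lemma trim_reflect:
  assumes "trim k" "periodic2 f"
  shows "f (- k) = f k"
proof -
  have "(- 2 *\<^sub>R k) $ i \<in> \<int>" for i
  proof -
    have "sin (2 * pi * k $ i) = 0" using assms(1) by (simp add: trim_def)
    then obtain n :: int where "2 * pi * k $ i = of_int n * pi" using sin_zero_iff_int2 by auto
    then have "2 * k $ i = of_int n" by (simp add: algebra_simps)
    then have "(- 2 *\<^sub>R k) $ i = of_int (- n)" by simp
    then show ?thesis by (metis Ints_of_int)
  qed
  then have "f (k + (- 2 *\<^sub>R k)) = f k" by (intro periodic2D [OF assms(2)])
  moreover have "- k = k + (- 2 *\<^sub>R k)" by (simp add: vec_eq_iff)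
  ultimately show ?thesis by metis
qed

lemma cos_periodic_Ints: "z \<in> \<int> \<Longrightarrow> cos (2 * pi * (x + z)) = cos (2 * pi * x)"
  "z \<in> \<int> \<Longrightarrow> sin (2 * pi * (x + z)) = sin (2 * pi * x)"
  using sin_cos_eq_iff [of "2 * pi * (x + z)" "2 * pi * x"]
  by (auto simp: Ints_def algebra_simps)

text \<open>For signs \<open>a\<close> and \<open>b\<close> the value is 1 at the invariant momenta
  whose cosines are \<open>a\<close>, \<open>b\<close>, and 0 at all other invariant
  momenta.\<close>

definition bump :: "real \<Rightarrow> real \<Rightarrow> real^2 \<Rightarrow> real" where
  "bump a b k = ((1 + a * cos (2 * pi * k $ 1)) / 2) * ((1 + b * cos (2 * pi * k $ 2)) / 2)"

lemma differentiable_bump: "bump a b differentiable (at k)"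
proof -
  have c: "(\<lambda>k. cos (2 * pi * k $ i)) differentiable (at (k :: real^2))" for i
  proof -
    have "(\<lambda>k :: real^2. 2 * pi * k $ i) differentiable (at k)"
      by (rule linear_imp_differentiable, rule linearI) (simp_all add: algebra_simps)
    then show ?thesis
      using differentiable_chain_at [of "\<lambda>k. 2 * pi * k $ i" k cos]
      by (simp add: o_def real_differentiable_def) (meson DERIV_cos)
  qed
  show ?thesis
    unfolding bump_def [abs_def]
    by (intro differentiable_mult differentiable_divide differentiable_add differentiable_const c) simp_all
qed

lemma abs_bump_le:
  assumes "\<bar>a\<bar> = 1" "\<bar>b\<bar> = 1" shows "\<bar>bump a b k\<bar> \<le> 1"
proof -
  have "\<bar>(1 + a * cos t) / 2\<bar> \<le> 1" if "\<bar>a\<bar> = 1" for a t :: real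
  proof -
    have "\<bar>a * cos t\<bar> \<le> 1" using that by (simp add: abs_mult)
    then show ?thesis by (simp add: abs_le_iff)
  qed
  then show ?thesis
    unfolding bump_def abs_mult using assms by (intro mult_le_one) auto
qed

text \<open>The four points are corrected independently and glued by bumps. At such a point both
  Cayley factors come from the same invariant \<open>X\<close>, so the perturbation is exactly the
  one provided by \<open>even_frame_perturb\<close>.\<close>

lemma perturb_trim:
  fixes \<alpha> :: "real^2 \<Rightarrow> 'n::finite cmat"
  assumes e: "real_orth \<epsilon>" and \<alpha>: "regular_family \<epsilon> \<alpha>" and \<eta>: "\<eta> > 0" and per: "periodic2 \<psi>"
    and fr: "\<And>k. trim k \<Longrightarrow> even_frame \<epsilon> (\<alpha> k) (\<psi> k) \<noteq> {}"
  obtains \<beta> where "regular_family \<epsilon> \<beta>" "\<And>k. norm (\<beta> k - \<alpha> k) < \<eta>"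
    "\<And>k. trim k \<Longrightarrow> gapped (\<beta> k) (\<psi> k)"
proof -
  have \<alpha>': "\<And>k. unitary (\<alpha> k)" "periodic2 \<alpha>"
    using \<alpha> unfolding regular_family_def matching_family_def by blast+
  obtain \<delta> where \<delta>: "\<delta> > 0" "\<And>X :: 'n cmat. norm X < \<delta> \<Longrightarrow> norm (cayley X - mat 1) < \<eta> / 2"
    using cayley_small [of "\<eta> / 2"] \<eta> by (metis half_gt_zero)
  \<comment> \<open>Representatives of the four points: sign 1 stands for coordinate 0, sign -1 for
    coordinate 1/2.\<close>
  define c :: "real \<Rightarrow> real \<Rightarrow> real^2" where "c a b = (\<chi> i. if (if i = 1 then a else b) = 1 then 0 else 1 / 2)" for a b
  have "trim (c a b)" for a b by (simp add: trim_def c_def)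
  then have "\<exists>X. selfadj X \<and> twist \<epsilon> X = X \<and> norm X < \<delta> / 4 \<and>
      gapped (cayley X ** \<alpha> (c a b) ** cayley X) (\<psi> (c a b))" for a b
    using even_frame_perturb [OF e fr, of "c a b" "\<delta> / 4" for a b] \<delta>(1) by simp
  then obtain X where X: "\<And>a b. selfadj (X a b)" "\<And>a b. twist \<epsilon> (X a b) = X a b" "\<And>a b. norm (X a b) < \<delta> / 4"
    "\<And>a b. gapped (cayley (X a b) ** \<alpha> (c a b) ** cayley (X a b)) (\<psi> (c a b))" by metis
  define F where "F k = bump 1 1 k *\<^sub>R X 1 1 + bump 1 (-1) k *\<^sub>R X 1 (-1)
    + bump (-1) 1 k *\<^sub>R X (-1) 1 + bump (-1) (-1) k *\<^sub>R X (-1) (-1)" for k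
  have sF: "selfadj (F k)" for k
    unfolding F_def by (intro selfadj_add selfadj_scaleR X)
  have dF: "F differentiable (at k)" for k
    unfolding F_def [abs_def] by (intro differentiable_add differentiable_scaleR differentiable_bump differentiable_const)
  have bper: "bump a b (k + z) = bump a b k" if "\<forall>i. z $ i \<in> \<int>" for a b k z
    using that by (simp add: bump_def cos_periodic_Ints)
  have pF: "periodic2 F" unfolding periodic2_def F_def by (simp add: bper)
  have reg: "regular_family \<epsilon> (perturb \<epsilon> F \<alpha>)" by (rule regular_perturb [OF e \<alpha> dF sF pF])
  have nF: "norm (F k) < \<delta>" for k
  proof -
    have 1: "norm (bump a b k *\<^sub>R X a b) < \<delta> / 4" if "\<bar>a\<bar> = 1" "\<bar>b\<bar> = 1" for a b
    proof -
      have "norm (bump a b k *\<^sub>R X a b) \<le> norm (X a b)"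
        using abs_bump_le [OF that] by (simp add: mult_left_le_one_le)
      also have "\<dots> < \<delta> / 4" by (rule X)
      finally show ?thesis .
    qed
    have "norm (F k) \<le> norm (bump 1 1 k *\<^sub>R X 1 1) + norm (bump 1 (-1) k *\<^sub>R X 1 (-1))
      + norm (bump (-1) 1 k *\<^sub>R X (-1) 1) + norm (bump (-1) (-1) k *\<^sub>R X (-1) (-1))"
      unfolding F_def by (intro norm_triangle_le add_mono order_refl)
    also have "\<dots> < \<delta>" using 1 [of 1 1] 1 [of 1 "-1"] 1 [of "-1" 1] 1 [of "-1" "-1"] by simp
    finally show ?thesis .
  qed
  have gap: "gapped (perturb \<epsilon> F \<alpha> k) (\<psi> k)" if k: "trim k" for k
  proof -
    define a b where "a = cos (2 * pi * k $ 1)" and "b = cos (2 * pi * k $ 2)"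
    have sq: "cos (2 * pi * k $ i) = 1 \<or> cos (2 * pi * k $ i) = -1" for i
    proof -
      have "(cos (2 * pi * k $ i))\<^sup>2 = 1"
        using k sin_cos_squared_add [of "2 * pi * k $ i"] by (simp add: trim_def)
      then show ?thesis by (simp add: power2_eq_1_iff)
    qed
    then have ab: "a = 1 \<or> a = -1" "b = 1 \<or> b = -1" by (simp_all add: a_def b_def)
    then have F: "F k = X a b"
      unfolding F_def bump_def a_def [symmetric] b_def [symmetric] by auto
    have z: "(k - c a b) $ i \<in> \<int>" for i
    proof -
      have s0: "sin (2 * pi * k $ i) = 0" using k by (simp add: trim_def)
      have c: "c a b $ i = (if cos (2 * pi * k $ i) = 1 then 0 else 1 / 2)"
        using exhaust_2 [of i] by (elim disjE) (simp_all add: c_def a_def b_def)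
      have "sin (2 * pi * k $ i) = sin (2 * pi * c a b $ i) \<and> cos (2 * pi * k $ i) = cos (2 * pi * c a b $ i)"
      proof (cases "cos (2 * pi * k $ i) = 1")
        case True
        then have "c a b $ i = 0" using c by simp
        then show ?thesis using True s0 by simp
      next
        case False
        then have "c a b $ i = 1 / 2" using c by simp
        then have c': "2 * pi * c a b $ i = pi" by simp
        show ?thesis unfolding c' using False sq [of i] s0 by simp
      qed
      then obtain n :: int where "2 * pi * k $ i = 2 * pi * c a b $ i + 2 * pi * n"
        unfolding sin_cos_eq_iff by blast
      then have "2 * pi * k $ i = 2 * pi * (c a b $ i + n)" by (simp only: distrib_left)
      then have "(k - c a b) $ i = of_int n" by simp
      then show ?thesis by simp
    qed
    have "\<alpha> (c a b + (k - c a b)) = \<alpha> (c a b)" "\<psi> (c a b + (k - c a b)) = \<psi> (c a b)"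
      using periodic2D [OF \<alpha>'(2) z, of "c a b"] periodic2D [OF per z, of "c a b"] by blast+
    then have "\<alpha> k = \<alpha> (c a b)" "\<psi> k = \<psi> (c a b)" by simp_all
    moreover have "perturb \<epsilon> F \<alpha> k = cayley (X a b) ** \<alpha> k ** cayley (X a b)"
      using trim_reflect [OF k pF] by (simp add: perturb_def F twist_cayley [OF e X(1)] X(2))
    ultimately show ?thesis using X(4) [of a b] by simp
  qed
  have "norm (perturb \<epsilon> F \<alpha> k - \<alpha> k) < \<eta>" for k
    using perturb_close [OF e, of \<alpha> F "\<eta> / 2" k] \<alpha>'(1) sF \<delta>(2) [OF nF] by simp
  with reg gap that show ?thesis by blast
qed

text \<open>Squaring makes the truncated sine differentiable where it vanishes. The region where it
  is nonzero is disjoint from its reflection, as \<open>perturb_generic\<close> requires.\<close>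

definition halfbump :: "2 \<Rightarrow> real^2 \<Rightarrow> real" where
  "halfbump i k = (max 0 (sin (2 * pi * k $ i)))\<^sup>2"

lemma differentiable_max_sq: "(\<lambda>x::real. (max 0 x)\<^sup>2) differentiable (at x)"
proof -
  have "((\<lambda>x. (max 0 x)\<^sup>2) has_real_derivative 2 * max 0 x) (at x)"
  proof (cases x "0 :: real" rule: linorder_cases)
    case less
    have "((\<lambda>x::real. 0) has_real_derivative 2 * max 0 x) (at x)" using less by simp
    then show ?thesis
      by (rule has_field_derivative_transform_within_open [of _ _ _ "{..<0}"]) (use less in auto)
  next
    case greater
    have "((\<lambda>x::real. x\<^sup>2) has_real_derivative 2 * max 0 x) (at x)"
      using greater by (auto intro!: derivative_eq_intros)
    then show ?thesis
      by (rule has_field_derivative_transform_within_open [of _ _ _ "{0<..}"]) (use greater in auto)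
  next
    case equal
    have "((\<lambda>h::real. (max 0 h)\<^sup>2 / h) \<longlongrightarrow> 0) (at 0)"
    proof (rule tendsto_rabs_zero_cancel, rule tendsto_sandwich [of "\<lambda>_. 0" _ _ "\<lambda>h. \<bar>h\<bar>"])
      show "\<forall>\<^sub>F h in at 0. \<bar>(max 0 h)\<^sup>2 / h\<bar> \<le> \<bar>h :: real\<bar>"
        by (rule always_eventually) (auto simp: max_def power2_eq_square)
      show "((\<lambda>h. \<bar>h :: real\<bar>) \<longlongrightarrow> 0) (at 0)" by (auto intro!: tendsto_eq_intros)
    qed auto
    then show ?thesis by (simp add: equal DERIV_def)
  qed
  then show ?thesis unfolding real_differentiable_def by blast
qed

lemma halfbump:
  shows "halfbump i differentiable (at k)" "periodic2 (halfbump i)" "\<bar>halfbump i k\<bar> \<le> 1"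
    "halfbump i k \<noteq> 0 \<longleftrightarrow> sin (2 * pi * k $ i) > 0"
proof -
  have l: "(\<lambda>k :: real^2. 2 * pi * k $ i) differentiable (at k)"
    by (rule linear_imp_differentiable, rule linearI) (simp_all add: algebra_simps)
  have s: "(\<lambda>k. sin (2 * pi * k $ i)) differentiable (at (k :: real^2))"
    using differentiable_chain_at [OF l, of sin]
    by (simp add: o_def real_differentiable_def) (meson DERIV_sin)
  show "halfbump i differentiable (at k)"
    using differentiable_chain_at [OF s differentiable_max_sq] by (simp add: o_def halfbump_def [abs_def])
  show "periodic2 (halfbump i)"
    unfolding periodic2_def halfbump_def by (simp add: cos_periodic_Ints)
  show "\<bar>halfbump i k\<bar> \<le> 1"
    unfolding halfbump_def by (simp add: power_le_one)
  show "halfbump i k \<noteq> 0 \<longleftrightarrow> sin (2 * pi * k $ i) > 0"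
    unfolding halfbump_def by (auto simp: max_def)
qed

lemma perturb_direction:
  assumes e: "real_orth \<epsilon>" and \<alpha>: "regular_family \<epsilon> \<alpha>" and \<eta>: "\<eta> > 0"
  obtains \<beta> where "regular_family \<epsilon> \<beta>" "\<And>k. norm (\<beta> k - \<alpha> k) < \<eta>"
    "\<And>k. sin (2 * pi * k $ i) = 0 \<Longrightarrow> \<beta> k = \<alpha> k"
    "\<And>k. sin (2 * pi * k $ i) \<noteq> 0 \<Longrightarrow> simple_spec (\<beta> k)"
proof -
  have odd: "sin (2 * pi * (- k) $ i) = - sin (2 * pi * k $ i)" for k :: "real^2" by simp
  have 0: "halfbump i (- k) = 0" if "halfbump i k \<noteq> 0" for k
    using that halfbump(4) [of i k] halfbump(4) [of i "- k"] odd [of k] by auto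
  have 1: "halfbump i k = 0 \<and> halfbump i (- k) = 0 \<longleftrightarrow> sin (2 * pi * k $ i) = 0" for k
    using halfbump(4) [of i k] halfbump(4) [of i "- k"] odd [of k] by auto
  show ?thesis
    by (rule perturb_generic [OF e \<alpha> \<eta> halfbump(1,2,3) 0]) (use 1 that in blast)+
qed

text \<open>Continuous partial derivatives along the two coordinate axes give total
  differentiability.\<close>

lemma smooth2_differentiable:
  assumes "smooth2 f"
  shows "f differentiable (at k)"
proof -
  let ?D = "\<lambda>v. iter_dd [v] f"
  have D: "((\<lambda>t. f (x + t *\<^sub>R v)) has_vector_derivative ?D v x) (at 0)" for v x
    using assms unfolding smooth2_def by (metis iter_dd.simps(1))
  have cD: "continuous_on UNIV (?D v)" for v using assms unfolding smooth2_def by blast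
  define e1 e2 :: "real^2" where "e1 = axis 1 1" and "e2 = axis 2 1"
  define g where "g x y = f (x *\<^sub>R e1 + y *\<^sub>R e2)" for x y
  have along: "((\<lambda>s. f (p + (s - t) *\<^sub>R v)) has_vector_derivative ?D v p) (at t)" for p v t
  proof -
    have "((\<lambda>s. s - t) has_vector_derivative 1) (at t)"
      by (auto intro!: derivative_eq_intros simp: has_vector_derivative_def)
    from vector_diff_chain_at [OF this, of "\<lambda>s. f (p + s *\<^sub>R v)" "?D v p"] D [of p v]
    show ?thesis by (simp add: o_def)
  qed
  have g1: "((\<lambda>x. g x y) has_vector_derivative ?D e1 (x *\<^sub>R e1 + y *\<^sub>R e2)) (at x)" for x y
    using along [of "x *\<^sub>R e1 + y *\<^sub>R e2" x e1] by (simp add: g_def algebra_simps)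
  have g2: "((\<lambda>y. g x y) has_vector_derivative ?D e2 (x *\<^sub>R e1 + y *\<^sub>R e2)) (at y)" for x y
    using along [of "x *\<^sub>R e1 + y *\<^sub>R e2" y e2] by (simp add: g_def algebra_simps)
  have "((\<lambda>(x, y). g x y) has_derivative (\<lambda>(tx, ty). tx *\<^sub>R ?D e1 (x *\<^sub>R e1 + y *\<^sub>R e2) +
     blinfun_apply (blinfun_scaleR_left (?D e2 (x *\<^sub>R e1 + y *\<^sub>R e2))) ty)) (at (x, y) within UNIV \<times> UNIV)" for x y
  proof (rule has_derivative_partialsI)
    show "((\<lambda>x. g x y) has_derivative (\<lambda>tx. tx *\<^sub>R ?D e1 (x *\<^sub>R e1 + y *\<^sub>R e2))) (at x within UNIV)"
      using g1 [of y x] by (simp add: has_vector_derivative_def)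
    show "((\<lambda>y. g x y) has_derivative blinfun_apply (blinfun_scaleR_left (?D e2 (x *\<^sub>R e1 + y *\<^sub>R e2)))) (at y within UNIV)" for x y
      using g2 [of x y] by (simp add: has_vector_derivative_def)
    have "continuous_on UNIV (\<lambda>z. blinfun_scaleR_left (?D e2 (fst z *\<^sub>R e1 + snd z *\<^sub>R e2)))"
      by (intro bounded_linear.continuous_on [OF bounded_linear_blinfun_scaleR_left]
          continuous_on_compose2 [OF cD] continuous_intros) auto
    then show "continuous (at (x, y) within UNIV \<times> UNIV) (\<lambda>(x, y). blinfun_scaleR_left (?D e2 (x *\<^sub>R e1 + y *\<^sub>R e2)))"
      by (simp add: continuous_on_eq_continuous_at case_prod_unfold)
  qed auto
  then have "(\<lambda>(x, y). g x y) differentiable (at (k $ 1, k $ 2))"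
    unfolding differentiable_def by (metis UNIV_Times_UNIV)
  moreover have "(\<lambda>k. (k $ 1, k $ 2)) differentiable (at k)"
    by (rule linear_imp_differentiable, rule linearI) simp_all
  ultimately have "(\<lambda>k. g (k $ 1) (k $ 2)) differentiable (at k)"
    using differentiable_chain_at [of "\<lambda>k. (k $ 1, k $ 2)" k "\<lambda>(x, y). g x y"] by (simp add: o_def)
  moreover have "g (k $ 1) (k $ 2) = f k" for k
    unfolding g_def by (rule arg_cong [of _ _ f]) (simp add: e1_def e2_def vec_eq_iff axis_def forall_2)
  ultimately show ?thesis by simp
qed

section \<open>The two admissible symmetries and their index involutions\<close>

lemma compatible_1: "compatible (mat 1) id"
proof -
  have "real_orth (mat 1 :: 'a cmat)" by (simp add: real_orth_def transpose_mat)
  then show ?thesis by (simp add: compatible_def transpose_mat)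
qed

text \<open>The involution exchanges the two halves of the enumeration, and \<open>S\<close> is its
  first half. Row i of J has a single nonzero entry, in column \<tau> i, and its sign flips under
  \<tau>.\<close>

lemma compatible_Jmat:
  fixes b :: "'n::finite \<Rightarrow> nat"
  assumes m: "even CARD('n)" and b: "bij_betw b (UNIV :: 'n set) {..<CARD('n)}"
  shows "\<exists>\<tau> S. compatible (Jmat b) \<tau> \<and> (\<forall>i. \<tau> i \<in> S \<longleftrightarrow> i \<notin> S)"
proof -
  define h where "h = CARD('n) div 2"
  have mh: "CARD('n) = 2 * h" using m by (simp add: h_def)
  have h0: "h > 0" using mh zero_less_card_finite [where 'a = 'n] by linarith
  have lt: "b i < 2 * h" for i using b mh by (auto simp: bij_betw_def)
  have inj: "b i = b j \<longleftrightarrow> i = j" for i j using b by (auto simp: bij_betw_def inj_def)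
  have "\<exists>j. b j = (if b i < h then b i + h else b i - h)" for i
  proof -
    have "(if b i < h then b i + h else b i - h) \<in> {..<CARD('n)}" using lt [of i] mh by auto
    then show ?thesis using b unfolding bij_betw_def by (metis imageE)
  qed
  then obtain \<tau> where \<tau>: "\<And>i. b (\<tau> i) = (if b i < h then b i + h else b i - h)" by metis
  have "b (\<tau> (\<tau> i)) = b i" for i using \<tau> [of i] \<tau> [of "\<tau> i"] lt [of i] by auto
  then have tt: "\<tau> (\<tau> i) = i" for i by (simp add: inj)
  have "b (\<tau> i) \<noteq> b i" for i using \<tau> [of i] lt [of i] h0 by auto
  then have tn: "\<tau> i \<noteq> i" for i by metis
  define s :: "'n \<Rightarrow> complex" where "s i = (if b i < h then 1 else - 1)" for i
  have J: "Jmat b $ i $ j = (if j = \<tau> i then s i else 0)" for i j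
    using \<tau> [of i] lt [of i] lt [of j] h0 unfolding Jmat_def s_def inj [symmetric]
    by (auto simp: h_def [symmetric])
  have s2: "s i * s i = 1" "cnj (s i) = s i" for i by (simp_all add: s_def)
  have s\<tau>: "s (\<tau> i) = - s i" for i using \<tau> [of i] lt [of i] by (auto simp: s_def)
  have tr: "transpose (Jmat b) = - Jmat b"
    by (auto simp: vec_eq_iff transpose_def J s\<tau> tt)
  have cadj: "cadj (Jmat b) = transpose (Jmat b)"
    by (simp add: vec_eq_iff transpose_def cadj_def J s2)
  have JJ: "Jmat b ** Jmat b = - mat 1"
  proof -
    have "(Jmat b ** Jmat b) $ i $ j = (if i = j then s i * s (\<tau> i) else 0)" for i j
      by (auto simp: matrix_matrix_mult_def J tt if_distrib [where f = "\<lambda>x. x * _"] cong: if_cong)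
    then show ?thesis by (simp add: vec_eq_iff mat_def s\<tau> s2)
  qed
  have "unitary (Jmat b)"
    by (rule unitaryI) (simp add: cadj tr minus_mult_minus JJ)
  then have "real_orth (Jmat b)" using cadj tr by (simp add: real_orth_def)
  moreover have "transpose (Jmat b) ** transpose (Jmat b) = - mat 1"
    by (simp add: tr minus_mult_minus JJ)
  ultimately have "compatible (Jmat b) \<tau>" using tt tn by (simp add: compatible_def)
  moreover have "\<tau> i \<in> {i. b i < h} \<longleftrightarrow> i \<notin> {i. b i < h}" for i
    using \<tau> [of i] lt [of i] by auto
  ultimately show ?thesis by blast
qed

lemma admissible_compatible:
  assumes "admissible_eps \<epsilon>"
  shows "compatible \<epsilon> id \<or> (\<exists>\<tau> S. compatible \<epsilon> \<tau> \<and> (\<forall>i. \<tau> i \<in> S \<longleftrightarrow> i \<notin> S))"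
  using assms compatible_1 compatible_Jmat unfolding admissible_eps_def by blast

text \<open>The phase is lifted over the whole homotopy and normalised to vanish at its trivial end.
  For \<epsilon> = J a shift of \<psi> by 2 pi would flip the parity, so this normalisation is what
  makes one phase right at all invariant momenta simultaneously.\<close>

lemma trim_even_frames:
  fixes \<alpha> :: "real^2 \<Rightarrow> 'n::finite cmat"
  assumes adm: "admissible_eps \<epsilon>" and \<alpha>: "matching_family \<epsilon> \<alpha>" and null: "equiv_null_homotopic \<epsilon> \<alpha>"
  obtains \<psi> where "continuous_on UNIV \<psi>" "\<And>k. det (\<alpha> k) = cis (\<psi> k)"
    "\<And>k. trim k \<Longrightarrow> even_frame \<epsilon> (\<alpha> k) (\<psi> k) \<noteq> {}"
proof -
  have e: "real_orth \<epsilon>" using admissible_compatible [OF adm] by (auto simp: compatible_def)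
  have even: "twist \<epsilon> (\<beta> k) = \<beta> k" if "matching_family \<epsilon> \<beta>" "trim k" for \<beta> k
  proof -
    have "\<beta> k = twist \<epsilon> (\<beta> (- k))" "periodic2 \<beta>"
      using that(1) unfolding matching_family_def matching_rel_iff [OF e] by blast+
    then show ?thesis using trim_reflect [OF that(2)] by metis
  qed
  obtain H :: "real \<Rightarrow> real^2 \<Rightarrow> 'n cmat" where "continuous_on ({0..1} \<times> UNIV) (\<lambda>(t, k). H t k) \<and>
    (\<forall>t\<in>{0..1}. matching_family \<epsilon> (H t)) \<and> H 0 = \<alpha> \<and> H 1 = (\<lambda>k. mat 1)"
    by (rule exE [OF null [unfolded equiv_null_homotopic_def]])
  then have H: "continuous_on ({0..1} \<times> UNIV) (\<lambda>(t, k). H t k)"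
    "\<And>t. t \<in> {0..1} \<Longrightarrow> matching_family \<epsilon> (H t)" "H 0 = \<alpha>" "H 1 = (\<lambda>k. mat 1)"
    by simp_all
  have uH: "unitary (H t k)" if "t \<in> {0..1}" for t k
    using H(2) [OF that] by (simp add: matching_family_def)
  have "contractible ({0..1::real} \<times> (UNIV :: (real^2) set))"
    by (intro convex_imp_contractible convex_Times) auto
  from det_phase [OF this H(1)] uH obtain \<phi> where \<phi>: "continuous_on ({0..1} \<times> UNIV) \<phi>"
    "\<forall>x\<in>{0..1} \<times> UNIV. det (case x of (t, k) \<Rightarrow> H t k) = cis (\<phi> x)"
    by auto
  have \<phi>': "det (H t k) = cis (\<phi> (t, k))" if "t \<in> {0..1}" for t k
    using \<phi>(2) that by auto
  have c1: "continuous_on UNIV (\<lambda>k. \<phi> (t, k))" if "t \<in> {0..1}" for t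
    by (rule continuous_on_compose2 [OF \<phi>(1)]) (use that in \<open>auto intro!: continuous_intros\<close>)
  have c2: "continuous_on {0..1} (\<lambda>t. \<phi> (t, k))" for k
    by (rule continuous_on_compose2 [OF \<phi>(1)]) (auto intro!: continuous_intros)
  have "(\<lambda>k. \<phi> (1, k)) constant_on UNIV"
  proof (rule cis_constant [OF convex_connected [OF convex_UNIV]])
    show "continuous_on UNIV (\<lambda>k. \<phi> (1, k))" by (rule c1) simp
    show "cis (\<phi> (1, k)) = 1" for k using \<phi>' [of 1 k] H(4) by simp
  qed
  then obtain c where c: "\<And>k. \<phi> (1, k) = c" by (auto simp: constant_on_def)
  have c1': "cis c = 1" using \<phi>' [of 1 0] H(4) c [of 0] by simp
  \<comment> \<open>The determinant is 1 at the trivial end, so \<open>c\<close> is a multiple of 2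
    pi and may be subtracted.\<close>
  define \<psi> where "\<psi> k = \<phi> (0, k) - c" for k
  have det: "det (H t k) = cis (\<phi> (t, k) - c)" if "t \<in> {0..1}" for t k
    using \<phi>' [OF that] c1' by (simp add: cis_divide [symmetric])
  have cont: "continuous_on UNIV \<psi>"
    unfolding \<psi>_def by (intro continuous_intros c1) simp
  have det0: "det (\<alpha> k) = cis (\<psi> k)" for k
    using det [of 0 k] H(3) by (simp add: \<psi>_def)
  have "even_frame \<epsilon> (\<alpha> k) (\<psi> k) \<noteq> {}" if k: "trim k" for k
  proof -
    consider "compatible \<epsilon> id" | \<tau> S where "compatible \<epsilon> \<tau>" "\<forall>i. \<tau> i \<in> S \<longleftrightarrow> i \<notin> S"
      using admissible_compatible [OF adm] by blast
    then show ?thesis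
    proof cases
      case 1
      have "unitary (\<alpha> k)" using \<alpha> by (simp add: matching_family_def)
      then show ?thesis using even_frame_exists_id [OF 1] even [OF \<alpha> k] det0 by blast
    next
      case 2
      have "even_frame \<epsilon> (H 0 k) (\<phi> (0, k) - c) \<noteq> {}"
      proof (rule even_frame_homotopy [OF 2, of "\<lambda>t. H t k" "\<lambda>t. \<phi> (t, k) - c"])
        have "continuous_on {0..1} (\<lambda>t. (\<lambda>(t, k). H t k) (t, k))"
          by (rule continuous_on_compose2 [OF H(1)]) (auto intro!: continuous_intros)
        then show "continuous_on {0..1} (\<lambda>t. H t k)" by simp
        show "unitary (H t k) \<and> twist \<epsilon> (H t k) = H t k" if "t \<in> {0..1}" for t
          using uH [OF that] even [OF H(2) [OF that] k] by blast
        show "continuous_on {0..1} (\<lambda>t. \<phi> (t, k) - c)" by (intro continuous_intros c2)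
        show "det (H t k) = cis (\<phi> (t, k) - c)" if "t \<in> {0..1}" for t by (rule det [OF that])
      qed (simp_all add: H(4) c)
      then show ?thesis using H(3) by (simp add: \<psi>_def)
    qed
  qed
  with cont det0 that show ?thesis by blast
qed

text \<open>The approximation needs its own determinant phase \<psi>'. Where the spectrum of \<beta>
  is simple any phase of its determinant will do. Elsewhere the gap is known for \<psi>, hence the
  two determinants agree and \<psi>' equals \<psi>.\<close>

proposition two_step_log_of_approximation:
  fixes \<alpha> \<beta> :: "real^2 \<Rightarrow> 'n::finite cmat"
  assumes c: "continuous_on UNIV \<alpha>" "continuous_on UNIV \<beta>" "continuous_on UNIV \<psi>"
    and p: "periodic2 \<alpha>" "periodic2 \<beta>" "periodic2 \<psi>"
    and u: "\<And>k. unitary (\<alpha> k)" "\<And>k. unitary (\<beta> k)" and det: "\<And>k. det (\<alpha> k) = cis (\<psi> k)"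
    and close: "\<And>k. norm (\<beta> k - \<alpha> k) < 1" "\<And>k. norm (det (\<beta> k) - det (\<alpha> k)) < 1"
    and gap: "\<And>k. simple_spec (\<beta> k) \<or> gapped (\<beta> k) (\<psi> k)"
  shows "\<exists>h1 h2. two_step_log \<alpha> h1 h2 \<and>
    (\<forall>\<epsilon>. real_orth \<epsilon> \<longrightarrow> matching_rel \<epsilon> \<alpha> \<longrightarrow> matching_rel \<epsilon> \<beta> \<longrightarrow> (\<forall>k. \<psi> (- k) = \<psi> k) \<longrightarrow>
       matching_rel \<epsilon> h1 \<and> matching_rel \<epsilon> h2)"
proof -
  define \<psi>' where "\<psi>' k = \<psi> k + Im (Ln (det (\<beta> k) / det (\<alpha> k)))" for k
  have c': "continuous_on UNIV \<psi>'" and d': "\<And>k. det (\<beta> k) = cis (\<psi>' k)"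
    using phase_transfer [OF c u det close(2)] by (simp_all add: \<psi>'_def [abs_def])
  have p': "periodic2 \<psi>'"
    using p by (simp add: periodic2_def \<psi>'_def)
  have gap': "gapped (\<beta> k) (\<psi>' k)" for k
  proof (cases "simple_spec (\<beta> k)")
    case True
    then show ?thesis using gapped_simple [OF u(2)] d' by blast
  next
    case False
    then have g: "gapped (\<beta> k) (\<psi> k)" using gap by blast
    then have "\<psi>' k = \<psi> k" by (simp add: \<psi>'_def det gapped_det)
    then show ?thesis using g by simp
  qed
  have small: "norm (\<alpha> k - \<beta> k) < 1" for k using close(1) [of k] by (simp add: norm_minus_commute)
  show ?thesis
  proof (rule two_step_assembly [OF c(1,2) c' p(1,2) p' u(1) gap' small])
    fix h1 h2
    assume 1: "two_step_log \<alpha> h1 h2" and 2: "\<And>\<epsilon>. real_orth \<epsilon> \<Longrightarrow> matching_rel \<epsilon> \<alpha> \<Longrightarrow> matching_rel \<epsilon> \<beta> \<Longrightarrow>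
      (\<And>k. \<psi>' (- k) = \<psi>' k) \<Longrightarrow> matching_rel \<epsilon> h1 \<and> matching_rel \<epsilon> h2"
    have "matching_rel \<epsilon> h1 \<and> matching_rel \<epsilon> h2"
      if e: "real_orth \<epsilon>" and m: "matching_rel \<epsilon> \<alpha>" "matching_rel \<epsilon> \<beta>" and ev: "\<forall>k. \<psi> (- k) = \<psi> k" for \<epsilon>
    proof (rule 2 [OF e m])
      have "det (\<gamma> (- k)) = det (\<gamma> k)" if "matching_rel \<epsilon> \<gamma>" for \<gamma> k
        using that unfolding matching_rel_iff [OF e] by (metis det_twist [OF e])
      then show "\<psi>' (- k) = \<psi>' k" for k using m ev by (simp add: \<psi>'_def)
    qed
    with 1 show ?thesis by blast
  qed
qed

text \<open>No symmetry is asked of the logarithms, so left multiplication by one constant Cayley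
  factor, the cut-off being 1, makes the spectrum simple everywhere. The matching relation of
  \<alpha> still enters: it makes the determinant even and thereby its phase periodic.\<close>

lemma unrestricted_two_step_log:
  fixes \<alpha> :: "real^2 \<Rightarrow> 'n::finite cmat"
  assumes e: "real_orth \<epsilon>" and \<alpha>: "regular_family \<epsilon> \<alpha>"
  shows "\<exists>h1 h2. two_step_log \<alpha> h1 h2"
proof -
  have \<alpha>': "continuous_on UNIV \<alpha>" "\<And>k. \<alpha> differentiable (at k)" "\<And>k. unitary (\<alpha> k)" "periodic2 \<alpha>"
    "\<And>k. \<alpha> k = twist \<epsilon> (\<alpha> (- k))"
    using \<alpha> unfolding regular_family_def matching_family_def matching_rel_iff [OF e] by blast+
  obtain \<psi> where \<psi>: "continuous_on UNIV \<psi>" "\<And>k. det (\<alpha> k) = cis (\<psi> k)"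
    using det_phase [OF contractible_UNIV \<alpha>'(1) \<alpha>'(3)] by auto
  have per: "periodic2 \<psi>"
  proof (rule phase_even_periodic(2) [OF \<psi>])
    show "det (\<alpha> (- k)) = det (\<alpha> k)" for k
      using arg_cong [OF \<alpha>'(5) [of k], of det] by (simp only: det_twist [OF e])
    show "periodic2 (\<lambda>k. det (\<alpha> k))" using \<alpha>'(4) by (simp add: periodic2_def)
  qed
  obtain \<eta> where \<eta>: "\<eta> > 0" "\<And>U V :: 'n cmat. unitary U \<Longrightarrow> unitary V \<Longrightarrow> norm (U - V) < \<eta> \<Longrightarrow> norm (det U - det V) < 1"
    using det_uniform by blast
  obtain \<delta> where \<delta>: "\<delta> > 0" "\<And>X :: 'n cmat. norm X < \<delta> \<Longrightarrow> norm (cayley X - mat 1) < min 1 \<eta>"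
    using cayley_small [of "min 1 \<eta>"] \<eta>(1) by (metis min_less_iff_conj zero_less_one)
  obtain X where X: "selfadj X" "norm X < \<delta>" and simple: "\<And>k. simple_spec (cayley X ** \<alpha> k)"
    using small_generic_hermitian [OF \<alpha>'(2,3) differentiable_const [of "1::real"] \<delta>(1)] by auto
  define \<beta> where "\<beta> k = cayley X ** \<alpha> k" for k
  have u\<beta>: "unitary (\<beta> k)" for k
    unfolding \<beta>_def by (intro unitary_mult unitary_cayley X \<alpha>')
  have close: "norm (\<beta> k - \<alpha> k) < min 1 \<eta>" for k
  proof -
    have "\<beta> k - \<alpha> k = (cayley X - mat 1) ** \<alpha> k" by (simp add: \<beta>_def cmat_diff_mult)
    then show ?thesis
      using \<delta>(2) [OF X(2)] by (simp add: norm_mult_unitary_right \<alpha>'(3))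
  qed
  have c\<beta>: "continuous_on UNIV \<beta>"
    unfolding \<beta>_def by (intro continuous_on_cmat_mult continuous_on_const \<alpha>')
  have p\<beta>: "periodic2 \<beta>" using \<alpha>'(4) by (simp add: periodic2_def \<beta>_def)
  have dclose: "norm (det (\<beta> k) - det (\<alpha> k)) < 1" for k
    using \<eta>(2) [OF u\<beta> \<alpha>'(3)] close [of k] by simp
  have small: "norm (\<beta> k - \<alpha> k) < 1" for k using close [of k] by simp
  have gap: "simple_spec (\<beta> k) \<or> gapped (\<beta> k) (\<psi> k)" for k by (simp add: \<beta>_def simple)
  show ?thesis
    using two_step_log_of_approximation
      [OF \<alpha>'(1) c\<beta> \<psi>(1) \<alpha>'(4) p\<beta> per \<alpha>'(3) u\<beta> \<psi>(2) small dclose gap] by blast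
qed

text \<open>The order matters: each of the two direction perturbations leaves the family unchanged
  where its sine vanishes. The last one therefore keeps the simple spectrum already gained on the
  lines where only the second sine vanishes, and neither touches the gaps at the invariant
  momenta.\<close>

lemma matching_two_step_log:
  fixes \<alpha> :: "real^2 \<Rightarrow> 'n::finite cmat"
  assumes adm: "admissible_eps \<epsilon>" and \<alpha>: "regular_family \<epsilon> \<alpha>" and null: "equiv_null_homotopic \<epsilon> \<alpha>"
  shows "\<exists>h1 h2. two_step_log \<alpha> h1 h2 \<and> matching_rel \<epsilon> h1 \<and> matching_rel \<epsilon> h2"
proof -
  have e: "real_orth \<epsilon>" using admissible_compatible [OF adm] by (auto simp: compatible_def)
  have reg: "continuous_on UNIV \<beta> \<and> (\<forall>k. unitary (\<beta> k)) \<and> periodic2 \<beta> \<and> matching_rel \<epsilon> \<beta>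
      \<and> (\<forall>k. det (\<beta> (- k)) = det (\<beta> k))"
    if "regular_family \<epsilon> \<beta>" for \<beta>
  proof -
    have "\<beta> k = twist \<epsilon> (\<beta> (- k))" for k
      using that unfolding regular_family_def matching_family_def matching_rel_iff [OF e] by blast
    from arg_cong [OF this, of det] have "det (\<beta> (- k)) = det (\<beta> k)" for k
      by (simp only: det_twist [OF e])
    then show ?thesis
      using that unfolding regular_family_def matching_family_def by blast
  qed
  have m\<alpha>: "matching_family \<epsilon> \<alpha>" using \<alpha> by (simp add: regular_family_def)
  obtain \<psi> where \<psi>: "continuous_on UNIV \<psi>" "\<And>k. det (\<alpha> k) = cis (\<psi> k)"
    "\<And>k. trim k \<Longrightarrow> even_frame \<epsilon> (\<alpha> k) (\<psi> k) \<noteq> {}"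
    using trim_even_frames [OF adm m\<alpha> null] by blast
  have "periodic2 (\<lambda>k. det (\<alpha> k))" using reg [OF \<alpha>] by (simp add: periodic2_def)
  then have ev: "\<psi> (- k) = \<psi> k" and per: "periodic2 \<psi>" for k
    using phase_even_periodic [OF \<psi>(1,2)] reg [OF \<alpha>] by blast+
  obtain \<eta> where \<eta>: "\<eta> > 0" "\<And>U V :: 'n cmat. unitary U \<Longrightarrow> unitary V \<Longrightarrow> norm (U - V) < \<eta> \<Longrightarrow> norm (det U - det V) < 1"
    using det_uniform by blast
  \<comment> \<open>Three successive perturbations share the total error.\<close>
  define \<mu> where "\<mu> = min 1 \<eta> / 3"
  have \<mu>: "\<mu> > 0" using \<eta>(1) by (simp add: \<mu>_def)
  obtain \<alpha>1 where \<alpha>1: "regular_family \<epsilon> \<alpha>1" "\<And>k. norm (\<alpha>1 k - \<alpha> k) < \<mu>" "\<And>k. trim k \<Longrightarrow> gapped (\<alpha>1 k) (\<psi> k)"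
    using perturb_trim [OF e \<alpha> \<mu> per \<psi>(3)] by blast
  obtain \<alpha>2 where \<alpha>2: "regular_family \<epsilon> \<alpha>2" "\<And>k. norm (\<alpha>2 k - \<alpha>1 k) < \<mu>"
    "\<And>k. sin (2 * pi * k $ 1) = 0 \<Longrightarrow> \<alpha>2 k = \<alpha>1 k" "\<And>k. sin (2 * pi * k $ 1) \<noteq> 0 \<Longrightarrow> simple_spec (\<alpha>2 k)"
    using perturb_direction [OF e \<alpha>1(1) \<mu>, of 1] by blast
  obtain \<beta> where \<beta>: "regular_family \<epsilon> \<beta>" "\<And>k. norm (\<beta> k - \<alpha>2 k) < \<mu>"
    "\<And>k. sin (2 * pi * k $ 2) = 0 \<Longrightarrow> \<beta> k = \<alpha>2 k" "\<And>k. sin (2 * pi * k $ 2) \<noteq> 0 \<Longrightarrow> simple_spec (\<beta> k)"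
    using perturb_direction [OF e \<alpha>2(1) \<mu>, of 2] by blast
  have close: "norm (\<beta> k - \<alpha> k) < min 1 \<eta>" for k
  proof -
    have "norm (\<beta> k - \<alpha> k) = norm ((\<beta> k - \<alpha>2 k) + ((\<alpha>2 k - \<alpha>1 k) + (\<alpha>1 k - \<alpha> k)))"
      by simp
    also have "\<dots> \<le> norm (\<beta> k - \<alpha>2 k) + (norm (\<alpha>2 k - \<alpha>1 k) + norm (\<alpha>1 k - \<alpha> k))"
      by (intro norm_triangle_le add_left_mono norm_triangle_ineq)
    also have "\<dots> < 3 * \<mu>" using \<alpha>1(2) [of k] \<alpha>2(2) [of k] \<beta>(2) [of k] by linarith
    finally show ?thesis by (simp add: \<mu>_def)
  qed
  have u: "unitary (\<alpha> k)" "unitary (\<beta> k)" for k using reg [OF \<alpha>] reg [OF \<beta>(1)] by blast+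
  have dclose: "norm (det (\<beta> k) - det (\<alpha> k)) < 1" for k
    using \<eta>(2) [OF u(2,1)] close [of k] by simp
  have c: "continuous_on UNIV \<alpha>" "continuous_on UNIV \<beta>" using reg [OF \<alpha>] reg [OF \<beta>(1)] by blast+
  have p: "periodic2 \<alpha>" "periodic2 \<beta>" using reg [OF \<alpha>] reg [OF \<beta>(1)] by blast+
  have r: "matching_rel \<epsilon> \<alpha>" "matching_rel \<epsilon> \<beta>" using reg [OF \<alpha>] reg [OF \<beta>(1)] by blast+
  have gap: "simple_spec (\<beta> k) \<or> gapped (\<beta> k) (\<psi> k)" for k
  proof (cases "trim k")
    case True
    then show ?thesis using \<beta>(3) \<alpha>2(3) \<alpha>1(3) by (simp add: trim_def)
  next
    case False
    then have "sin (2 * pi * k $ 1) \<noteq> 0 \<or> sin (2 * pi * k $ 2) \<noteq> 0" by (auto simp: trim_def forall_2)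
    then show ?thesis using \<alpha>2(4) \<beta>(3,4) by metis
  qed
  have small: "norm (\<beta> k - \<alpha> k) < 1" for k using close [of k] by simp
  show ?thesis
    using two_step_log_of_approximation [OF c \<psi>(1) p per u \<psi>(2) small dclose gap] e r ev by blast
qed

theorem theorem4p6:
  fixes \<epsilon> :: "'n::finite cmat" and \<alpha> :: "real^2 \<Rightarrow> 'n cmat"
  assumes "admissible_eps \<epsilon>"
    and "matching_family \<epsilon> \<alpha>"
    and "smooth2 \<alpha>"
  shows "(\<exists>h1 h2. two_step_log \<alpha> h1 h2) \<and>
         (equiv_null_homotopic \<epsilon> \<alpha> \<longrightarrow>
            (\<exists>h1 h2. two_step_log \<alpha> h1 h2 \<and> matching_rel \<epsilon> h1 \<and> matching_rel \<epsilon> h2))"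
proof -
  have "real_orth \<epsilon>" using admissible_compatible [OF assms(1)] by (auto simp: compatible_def)
  moreover have "regular_family \<epsilon> \<alpha>"
    using assms(2) smooth2_differentiable [OF assms(3)] by (simp add: regular_family_def)
  ultimately show ?thesis
    using unrestricted_two_step_log matching_two_step_log [OF assms(1)] by blast
qed

end
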